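(* Let $X_{jk}$, $1\le j\le k<\infty$, be a triangular array of real random variables with $\mathbb{E}X_{jk}=0$ and $\mathbb{E}X_{jk}^2=\sigma_{jk}^2$, let $X_{kj}=X_{jk}$ (and $\sigma_{kj}=\sigma_{jk}$) for $j<k$, and let $\mathbf{X}_n=\{X_{jk}\}_{j,k=1}^n$. Assume that the following conditions hold: (a) $\mathbb{E}(X_{ij}\mid \mathfrak{F}^{(i,j)})=0$ for all $n$ and all $1\le i\le j\le n$; (b) $\displaystyle \frac{1}{n^2}\sum_{i,j=1}^n \mathbb{E}\left|\mathbb{E}(X_{ij}^2\mid\mathfrak{F}^{(i,j)})-\sigma_{ij}^2\right|\to 0$ as $n\to\infty$; (c) for every fixed $\tau>0$, $\displaystyle L_n(\tau):=\frac{1}{n^2}\sum_{i,j=1}^n \mathbb{E}|X_{ij}|^2\,\mathbf{1}(|X_{ij}|\ge \tau\sqrt{n})\to 0$ as $n\to\infty$; (d) $\displaystyle \frac1n\sum_{i=1}^n |B_i^2-1|\to 0$ as $n\to\infty$, where $B_i^2:=\frac1n\sum_{j=1}^n\sigma_{ij}^2$; (e) there is an absolute constant $C$ (independent of $n$) such that $\max_{1\le i\le n}B_i\le C$ for all $n$. Then $$\sup_{x\in\mathbb{R}}|F^{\mathbf{X}_n}(x)-G(x)|\to 0\quad\text{as } n\to\infty.$$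
   Context: All random variables are defined on a common probability space. $\mathbf{1}(B)$ denotes the indicator of an event $B$. The $\sigma$-algebras (depending on $n$) are $\mathfrak{F}^{(i,j)}:=\sigma\{X_{kl}:1\le k\le l\le n,\ (k,l)\ne(i,j)\}$ for $1\le i\le j\le n$, and $\mathfrak{F}^{(j,i)}:=\mathfrak{F}^{(i,j)}$. The quantity $B_i\ge 0$ also depends on $n$. For a real symmetric random $n\times n$ matrix $\mathbf{X}_n$, let $\lambda_1\le\dots\le\lambda_n$ be the eigenvalues of $n^{-1/2}\mathbf{X}_n$, let $\mathcal{F}^{\mathbf{X}_n}(x)=\frac1n\sum_{i=1}^n\mathbf{1}(\lambda_i\le x)$, and let $F^{\mathbf{X}_n}(x):=\mathbb{E}\,\mathcal{F}^{\mathbf{X}_n}(x)$. $G$ is the distribution function of the standard semicircle law: $G(x)=\int_{-\infty}^x g(u)\,du$ with $g(x)=\frac{1}{2\pi}\sqrt{4-x^2}\,\mathbf{1}(|x|\le 2)$. *)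

theory Defs
  imports "HOL-Probability.Conditional_Expectation" "Jordan_Normal_Form.Char_Poly"
begin

section \<open>Eigenvalues of symmetric matrices\<close>

text \<open>The eigenvalues of a real matrix in increasing order, repeated according to multiplicity as
  roots of the characteristic polynomial. The lemmas below show that a symmetric matrix of size
  \<open>n\<close> has exactly \<open>n\<close> of them, and that they are its eigenvalues in the sense of \<open>eigenvalue\<close>.\<close>

definition eigenvalue_list :: "real mat \<Rightarrow> real list" where
  "eigenvalue_list A = sorted_list_of_multiset (proots (char_poly A))"

lemma set_eigenvalue_list:
  assumes "A \<in> carrier_mat n n"
  shows "set (eigenvalue_list A) = {a. eigenvalue A a}"
proof -
  have "char_poly A \<noteq> 0"
    using degree_monic_char_poly[OF assms] by auto
  then show ?thesis
    by (simp add: eigenvalue_list_def eigenvalue_root_char_poly[OF assms])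
qed

lemma symmetric_real_root_char_poly:
  fixes A :: "real mat"
  assumes A: "A \<in> carrier_mat n n" and sym: "transpose_mat A = A"
    and r: "poly (char_poly (map_mat complex_of_real A)) a = 0"
  shows "a \<in> \<real>"
proof -
  define B where "B = map_mat complex_of_real A"
  have B: "B \<in> carrier_mat n n" using A by (simp add: B_def)
  have Bt: "transpose_mat B = B"
    unfolding B_def by (subst (2) sym[symmetric]) (rule eq_matI, auto)
  have "eigenvalue B a" using r eigenvalue_root_char_poly[OF B] by (simp add: B_def)
  then obtain v where v: "v \<in> carrier_vec n" "v \<noteq> 0\<^sub>v n" and ev: "B *\<^sub>v v = a \<cdot>\<^sub>v v"
    using B by (auto simp: eigenvalue_def eigenvector_def)
  have cv: "conjugate v \<in> carrier_vec n" using v by simp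
  have Bc: "conjugate (B *\<^sub>v v) = B *\<^sub>v conjugate v"
    using A v by (intro eq_vecI) (auto simp: B_def scalar_prod_def)
  have "a * (v \<bullet>c v) = (B *\<^sub>v v) \<bullet>c v"
    using v cv by (simp add: ev)
  also have "\<dots> = (transpose_mat B *\<^sub>v v) \<bullet>c v" by (simp add: Bt)
  also have "\<dots> = v \<bullet> (B *\<^sub>v conjugate v)"
    using B v cv by (metis transpose_vec_mult_scalar)
  also have "\<dots> = v \<bullet>c (a \<cdot>\<^sub>v v)" by (simp add: Bc[symmetric] ev)
  also have "\<dots> = cnj a * (v \<bullet>c v)"
    using v cv by (simp add: conjugate_smult_vec)
  finally have "a * (v \<bullet>c v) = cnj a * (v \<bullet>c v)" .
  moreover have "v \<bullet>c v \<noteq> 0" using v by (simp add: conjugate_square_eq_0_vec)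
  ultimately have "cnj a = a" by simp
  then show ?thesis by (simp add: Reals_cnj_iff)
qed

lemma length_eigenvalue_list:
  assumes A: "A \<in> carrier_mat n n" and sym: "transpose_mat A = A"
  shows "length (eigenvalue_list A) = n"
proof -
  define B where "B = map_mat complex_of_real A"
  have B: "B \<in> carrier_mat n n" using A by (simp add: B_def)
  interpret mp: map_poly_inj_idom_hom complex_of_real ..
  obtain as where as: "char_poly B = (\<Prod>a\<leftarrow>as. [:- a, 1:])" "length as = n"
    using char_poly_factorized[OF B] by auto
  have "a \<in> \<real>" if "a \<in> set as" for a
  proof -
    have "poly (char_poly B) a = 0"
      using that by (auto simp: as poly_prod_list prod_list_zero_iff)
    then show ?thesis
      using symmetric_real_root_char_poly[OF A sym] by (simp add: B_def)
  qed
  then have re: "map_poly complex_of_real [:- Re a, 1:] = [:- a, 1:]" if "a \<in> set as" for a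
    using that by (auto simp: of_real_Re)
  have "map_poly complex_of_real (char_poly A) = char_poly B"
    unfolding B_def using A by (simp add: of_real_hom.char_poly_hom)
  also have "\<dots> = (\<Prod>a\<leftarrow>as. map_poly complex_of_real [:- Re a, 1:])"
    unfolding as using re by (metis (no_types, lifting) map_cong)
  also have "\<dots> = map_poly complex_of_real (\<Prod>a\<leftarrow>as. [:- Re a, 1:])"
    by (induction as) (simp_all only: list.map prod_list.Nil prod_list.Cons mp.hom_mult mp.hom_one)
  finally have "char_poly A = (\<Prod>a\<leftarrow>as. [:- Re a, 1:])"
    by (simp only: mp.eq_iff)
  moreover have "proots (\<Prod>a\<leftarrow>as. [:- Re a, 1:]) = mset (map Re as)"
  proof (induction as)
    case (Cons a as)
    have "(\<Prod>a\<leftarrow>as. [:- Re a, 1:]) \<noteq> 0" by (auto simp: prod_list_zero_iff)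
    then have "proots ([:- Re a, 1:] * (\<Prod>a\<leftarrow>as. [:- Re a, 1:]))
        = proots [:- Re a, 1:] + proots (\<Prod>a\<leftarrow>as. [:- Re a, 1:])"
      by (intro proots_mult) auto
    also have "proots [:- Re a, 1:] = {#Re a#}"
      by (simp only: proots_linear_factor minus_minus)
    finally show ?case
      unfolding list.map prod_list.Cons Cons.IH by simp
  qed simp
  ultimately have "proots (char_poly A) = mset (map Re as)" by simp
  then show ?thesis
    by (metis as(2) eigenvalue_list_def length_map mset_sorted_list_of_multiset size_mset)
qed


section \<open>Spectral distribution functions\<close>

text \<open>Array entries \<open>X j k\<close> are indexed from 1, whereas matrix indices start at 0.\<close>

definition array_matrix :: "(nat \<Rightarrow> nat \<Rightarrow> 'a \<Rightarrow> real) \<Rightarrow> nat \<Rightarrow> 'a \<Rightarrow> real mat" where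
  "array_matrix X n \<omega> = Matrix.mat n n (\<lambda>(j, k). X (Suc j) (Suc k) \<omega>)"

definition empirical_spectral_cdf :: "(nat \<Rightarrow> nat \<Rightarrow> 'a \<Rightarrow> real) \<Rightarrow> nat \<Rightarrow> real \<Rightarrow> 'a \<Rightarrow> real" where
  "empirical_spectral_cdf X n x \<omega> =
     (1 / real n) * (\<Sum>i<n. indicator {..x}
        (eigenvalue_list ((1 / sqrt (real n)) \<cdot>\<^sub>m array_matrix X n \<omega>) ! i))"

definition expected_spectral_cdf ::
    "'a measure \<Rightarrow> (nat \<Rightarrow> nat \<Rightarrow> 'a \<Rightarrow> real) \<Rightarrow> nat \<Rightarrow> real \<Rightarrow> real" where
  "expected_spectral_cdf M X n x = (\<integral>\<omega>. empirical_spectral_cdf X n x \<omega> \<partial>M)"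

definition semicircle_density :: "real \<Rightarrow> real" where
  "semicircle_density x = 1 / (2 * pi) * sqrt (4 - x\<^sup>2) * indicator {x. \<bar>x\<bar> \<le> 2} x"

definition semicircle_cdf :: "real \<Rightarrow> real" where
  "semicircle_cdf x = (LBINT u:{..x}. semicircle_density u)"


section \<open>Quantities attached to the array\<close>

text \<open>The sigma-algebra generated by all entries of the upper triangle of the \<open>n\<close>-th matrix other
  than the one at position \<open>(i, j)\<close>. Using \<open>min\<close> and \<open>max\<close> makes it symmetric in \<open>i\<close> and \<open>j\<close>.\<close>

definition sigma_without ::
    "'a measure \<Rightarrow> (nat \<Rightarrow> nat \<Rightarrow> 'a \<Rightarrow> real) \<Rightarrow> nat \<Rightarrow> nat \<Rightarrow> nat \<Rightarrow> 'a measure" where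
  "sigma_without M X n i j = sigma (space M)
     {X k l -` S \<inter> space M | k l S.
        1 \<le> k \<and> k \<le> l \<and> l \<le> n \<and> (k, l) \<noteq> (min i j, max i j) \<and> S \<in> sets borel}"

lemma subalgebra_sigma_without:
  assumes "\<And>k l. 1 \<le> k \<Longrightarrow> k \<le> l \<Longrightarrow> X k l \<in> borel_measurable M"
  shows "subalgebra M (sigma_without M X n i j)"
  unfolding subalgebra_def
proof
  show "space (sigma_without M X n i j) = space M"
    by (simp add: sigma_without_def space_measure_of_conv)
  show "sets (sigma_without M X n i j) \<subseteq> sets M"
    unfolding sigma_without_def
    by (subst sets_measure_of) (use assms in \<open>auto intro!: sets.sigma_sets_subset measurable_sets\<close>)
qed

definition lindeberg_fraction ::
    "'a measure \<Rightarrow> (nat \<Rightarrow> nat \<Rightarrow> 'a \<Rightarrow> real) \<Rightarrow> nat \<Rightarrow> real \<Rightarrow> real" where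
  "lindeberg_fraction M X n \<tau> = 1 / (real n)\<^sup>2 *
     (\<Sum>i=1..n. \<Sum>j=1..n.
        \<integral>\<omega>. \<bar>X i j \<omega>\<bar>\<^sup>2 * indicator {\<omega>. \<bar>X i j \<omega>\<bar> \<ge> \<tau> * sqrt (real n)} \<omega> \<partial>M)"

definition row_scale :: "(nat \<Rightarrow> nat \<Rightarrow> real) \<Rightarrow> nat \<Rightarrow> nat \<Rightarrow> real" where
  "row_scale \<sigma> n i = sqrt (1 / real n * (\<Sum>j=1..n. (\<sigma> i j)\<^sup>2))"

end

theory Submission
  imports Defs "HOL-Complex_Analysis.Conformal_Mappings" "HOL-Probability.Helly_Selection"
    "HOL-Probability.Probability_Mass_Function" "Jordan_Normal_Form.Schur_Decomposition"
begin

text \<open>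
  Let \<open>W = X / sqrt n\<close>, \<open>G = (W - z)\<^sup>-\<^sup>1\<close> and \<open>S i j = (\<sigma> i j)\<^sup>2 / n\<close>. Neither truncation nor a comparison with
  Gaussian entries is needed: one expands the resolvent of \<open>W\<close> directly. The quantity
  \<open>D i = 1 + z G i i + G i i * (\<Sum>k. S i k * G k k)\<close> measures the failure of the self-consistent equation.
  Since \<open>1 + z G i i = (\<Sum>j. W i j * G i j)\<close>, the expectation of \<open>D i * cnj (D i)\<close> is a sum of terms
  \<open>W i j * f\<close> with \<open>f\<close> a smooth bounded function of the matrix. Expanding \<open>f\<close> to second order around
  the matrix with entry \<open>(i, j)\<close> set to 0, whose resolvent is measurable with respect to all other entries,
  hypothesis (a) removes the constant term, (b) replaces \<open>W i j\<close> squared by \<open>S i j\<close> in the linear term, where the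
  main contribution cancels, and (c) controls the remainder. Hence the average of \<open>|D i|\<^sup>2\<close> tends to 0.

  For \<open>Im z\<close> large the self-consistent equation is a contraction in the averaged \<open>l\<^sup>1\<close> norm, so (d) and (e) give
  that the Stieltjes transform of the expected spectral measure converges to a root of
  \<open>m\<^sup>2 + z m + 1 = 0\<close>. These measures are tight; the Stieltjes transform of any weak limit satisfies this
  equation for large \<open>Im z\<close>, hence by analytic continuation on the whole upper half plane, and Stieltjes inversion
  identifies the limit with the semicircle law. Its distribution function is continuous, so the convergence is uniform.
\<close>

section \<open>Symmetric matrices and their eigenvalues\<close>

text \<open>Without independence the entries of \<open>G\<close> need not concentrate around their
  means, so a small expectation of \<open>D i\<close> would say nothing about products such as
  \<open>G i i * G k k\<close>. Hence the second moment: one factor \<open>D i\<close> is expanded,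
  and \<open>cnj (D i)\<close> is carried along as part of the smooth function. The cancellation
  comes from the derivative of \<open>G i j\<close> in its own entry,
  \<open>- (G i i * G j j + G i j * G i j)\<close> off the diagonal: its first part removes the term
  \<open>S i j * G i i * G j j\<close> of \<open>D i\<close>, and what is left has a factor
  \<open>G i j\<close>. For \<open>Im z\<close> at least 1 the Ward identity bounds the l2 norm of
  each column of \<open>G\<close> by 1, so such factors are small on average unless the weights
  \<open>S i j\<close> single out a few entries. Hypothesis (c) excludes this, since it makes most
  variances small compared with n. Hypotheses (b), (c) and (d) are averages, so no individual
  \<open>D i\<close> is controlled. This forces the averaged l1 norm in the stability step, where
  column sums of \<open>S\<close> enter; symmetry turns them into the row sums bounded by
  (e).\<close>

lemma monic_split_poly_eq_prod_proots:
  fixes p :: "'a :: field poly"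
  assumes "lead_coeff p = 1" "size (proots p) = degree p"
  shows "(\<Prod>x\<in>#proots p. [:- x, 1:]) = p"
  using assms
proof (induction "degree p" arbitrary: p)
  case 0
  then have "p = 1" by (metis degree_0_id one_pCons)
  then show ?case by simp
next
  case (Suc d)
  then have "proots p \<noteq> {#}" and p0: "p \<noteq> 0" by auto
  then obtain x where x: "x \<in># proots p" by blast
  then have "poly p x = 0" using p0 by simp
  then obtain q where q: "p = [:- x, 1:] * q" by (auto simp: poly_eq_0_iff_dvd)
  have q0: "q \<noteq> 0" using p0 q by auto
  have pr: "proots p = {#x#} + proots q" unfolding q using q0 by (subst proots_mult) auto
  have deg: "degree p = Suc (degree q)" unfolding q using q0 by (subst degree_mult_eq) auto
  have "lead_coeff p = lead_coeff q" unfolding q lead_coeff_mult by simp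
  then have "(\<Prod>x\<in>#proots q. [:- x, 1:]) = q"
    using Suc.hyps(2) Suc.prems pr deg by (intro Suc.hyps(1)) auto
  then show ?case unfolding pr by (simp add: q)
qed

text \<open>A symmetric matrix has as many real roots, with multiplicity, as the degree, so its real
  characteristic polynomial splits. This factorization is the input of
  \<open>schur_decomposition\<close> and fixes the order of the diagonal.\<close>

lemma char_poly_eigenvalue_list:
  assumes A: "A \<in> carrier_mat n n" and sym: "transpose_mat A = A"
  shows "char_poly A = (\<Prod>a\<leftarrow>eigenvalue_list A. [:- a, 1:])"
proof -
  have monic: "degree (char_poly A) = n" "lead_coeff (char_poly A) = 1"
    using degree_monic_char_poly[OF A] by auto
  have ms: "mset (eigenvalue_list A) = proots (char_poly A)"
    by (simp add: eigenvalue_list_def)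
  then have "size (proots (char_poly A)) = degree (char_poly A)"
    using length_eigenvalue_list[OF A sym] monic by (metis size_mset)
  then have "char_poly A = (\<Prod>x\<in>#mset (eigenvalue_list A). [:- x, 1:])"
    unfolding ms using monic(2) by (intro monic_split_poly_eq_prod_proots[symmetric])
  then show ?thesis by (metis mset_map prod_mset_prod_list)
qed

section \<open>Traces of powers and of the resolvent through a triangular form\<close>

lemma upper_triangular_mult:
  fixes A B :: "'a :: comm_ring_1 mat"
  assumes A: "A \<in> carrier_mat n n" "upper_triangular A"
    and B: "B \<in> carrier_mat n n" "upper_triangular B"
  shows "upper_triangular (A * B)" "i < n \<Longrightarrow> (A * B) $$ (i, i) = A $$ (i, i) * B $$ (i, i)"
proof -
  have prod: "(A * B) $$ (i, j) = (\<Sum>k<n. A $$ (i, k) * B $$ (k, j))" if "i < n" "j < n" for i j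
    using A B that by (auto simp: scalar_prod_def lessThan_atLeast0)
  show "upper_triangular (A * B)"
  proof (rule upper_triangularI)
    fix i j assume ij: "j < i" "i < dim_row (A * B)"
    have "A $$ (i, k) * B $$ (k, j) = 0" if "k < n" for k
    proof (cases "k < i")
      case True
      then have "A $$ (i, k) = 0" using A ij by (intro upper_triangularD) auto
      then show ?thesis by simp
    next
      case False
      then have "B $$ (k, j) = 0" using B ij that by (intro upper_triangularD) auto
      then show ?thesis by simp
    qed
    then show "(A * B) $$ (i, j) = 0" using ij A by (subst prod) auto
  qed
  show "(A * B) $$ (i, i) = A $$ (i, i) * B $$ (i, i)" if "i < n"
  proof -
    have "A $$ (i, k) * B $$ (k, i) = 0" if "k < n" "k \<noteq> i" for k
    proof (cases "k < i")
      case True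
      then have "A $$ (i, k) = 0" using A \<open>i < n\<close> by (intro upper_triangularD) auto
      then show ?thesis by simp
    next
      case False
      then have "B $$ (k, i) = 0" using B that by (intro upper_triangularD) auto
      then show ?thesis by simp
    qed
    then have "(\<Sum>k<n. A $$ (i, k) * B $$ (k, i)) = (\<Sum>k\<in>{i}. A $$ (i, k) * B $$ (k, i))"
      using that by (intro sum.mono_neutral_right) auto
    then show ?thesis using prod that by simp
  qed
qed

lemma upper_triangular_pow:
  fixes A :: "'a :: comm_ring_1 mat"
  assumes A: "A \<in> carrier_mat n n" "upper_triangular A"
  shows "upper_triangular (A ^\<^sub>m k) \<and> (\<forall>i<n. (A ^\<^sub>m k) $$ (i, i) = (A $$ (i, i)) ^ k)"
proof (induction k)
  case 0
  then show ?case using A by auto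
next
  case (Suc k)
  have "A ^\<^sub>m k \<in> carrier_mat n n" using A by simp
  with Suc A upper_triangular_mult[of "A ^\<^sub>m k" n A] show ?case by (auto simp: mult.commute)
qed

lemma trace_mult_commute:
  fixes A B :: "'a :: comm_ring_1 mat"
  assumes "A \<in> carrier_mat n n" "B \<in> carrier_mat n n"
  shows "(\<Sum>i<n. (A * B) $$ (i, i)) = (\<Sum>i<n. (B * A) $$ (i, i))"
proof -
  have "(\<Sum>i<n. (A * B) $$ (i, i)) = (\<Sum>i<n. \<Sum>k<n. A $$ (i, k) * B $$ (k, i))"
    using assms by (intro sum.cong) (auto simp: scalar_prod_def lessThan_atLeast0)
  also have "\<dots> = (\<Sum>k<n. \<Sum>i<n. B $$ (k, i) * A $$ (i, k))"
    by (subst sum.swap) (simp add: mult.commute)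
  also have "\<dots> = (\<Sum>i<n. (B * A) $$ (i, i))"
    using assms by (intro sum.cong) (auto simp: scalar_prod_def lessThan_atLeast0)
  finally show ?thesis .
qed

text \<open>A triangular form is enough for traces: they are invariant under similarity, and powers
  and inverses of a triangular matrix carry the powers and reciprocals of its diagonal.\<close>

lemma real_schur_symmetric:
  assumes A: "A \<in> carrier_mat n n" and sym: "transpose_mat A = A"
  obtains B P Q where "similar_mat_wit A B P Q" "upper_triangular B" "diag_mat B = eigenvalue_list A"
    "B \<in> carrier_mat n n" "P \<in> carrier_mat n n" "Q \<in> carrier_mat n n" "A = P * B * Q" "Q * P = 1\<^sub>m n"
proof -
  obtain B P Q where sd: "schur_decomposition A (eigenvalue_list A) = (B, P, Q)"
    by (metis prod_cases3)
  have "similar_mat_wit A B P Q" "upper_triangular B" "diag_mat B = eigenvalue_list A"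
    using schur_decomposition[OF A char_poly_eigenvalue_list[OF A sym] sd] by auto
  with similar_mat_witD2[OF A this(1)] show ?thesis by (intro that[of B P Q]) auto
qed

lemma sum_diag_mat:
  assumes "diag_mat B = xs" "B \<in> carrier_mat n n"
  shows "(\<Sum>i<n. f (B $$ (i, i))) = (\<Sum>i<n. f (xs ! i))"
  using assms by (intro sum.cong) (auto simp: diag_mat_def)

text \<open>Power sums of the eigenvalues become polynomials in the entries. This serves twice: for
  measurability of the eigenvalues, and with \<open>k = 2\<close> for tightness.\<close>

lemma trace_pow_eigenvalue_list:
  assumes A: "A \<in> carrier_mat n n" and sym: "transpose_mat A = A"
  shows "(\<Sum>i<n. (A ^\<^sub>m k) $$ (i, i)) = (\<Sum>i<n. (eigenvalue_list A ! i) ^ k)"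
proof -
  obtain B P Q where w: "similar_mat_wit A B P Q" "upper_triangular B" "diag_mat B = eigenvalue_list A"
    and c: "B \<in> carrier_mat n n" "P \<in> carrier_mat n n" "Q \<in> carrier_mat n n" and eq: "Q * P = 1\<^sub>m n"
    using real_schur_symmetric[OF A sym] by blast
  have Bk: "B ^\<^sub>m k \<in> carrier_mat n n" using c by simp
  have "(\<Sum>i<n. (A ^\<^sub>m k) $$ (i, i)) = (\<Sum>i<n. (P * B ^\<^sub>m k * Q) $$ (i, i))"
    using similar_mat_wit_pow_id[OF w(1)] by simp
  also have "\<dots> = (\<Sum>i<n. (Q * (P * B ^\<^sub>m k)) $$ (i, i))"
    using c Bk by (intro trace_mult_commute) auto
  also have "Q * (P * B ^\<^sub>m k) = Q * P * B ^\<^sub>m k"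
    using c Bk by (intro assoc_mult_mat[symmetric]) auto
  also have "\<dots> = B ^\<^sub>m k" using eq Bk by (simp add: left_mult_one_mat)
  also have "(\<Sum>i<n. (B ^\<^sub>m k) $$ (i, i)) = (\<Sum>i<n. (B $$ (i, i)) ^ k)"
    using upper_triangular_pow[OF c(1) w(2), of k] by simp
  also have "\<dots> = (\<Sum>i<n. (eigenvalue_list A ! i) ^ k)"
    by (rule sum_diag_mat[OF w(3) c(1)])
  finally show ?thesis .
qed

lemma upper_triangular_right_inverse_diag:
  fixes U V :: "'a :: field mat"
  assumes U: "U \<in> carrier_mat n n" "upper_triangular U" and V: "V \<in> carrier_mat n n"
    and UV: "U * V = 1\<^sub>m n" and i: "i < n" and nz: "\<And>k. k < n \<Longrightarrow> U $$ (k, k) \<noteq> 0"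
  shows "V $$ (i, i) = inverse (U $$ (i, i))"
proof -
  have prod: "(\<Sum>k<n. U $$ (l, k) * V $$ (k, i)) = (if l = i then 1 else 0)" if "l < n" for l
  proof -
    have "(U * V) $$ (l, i) = (\<Sum>k<n. U $$ (l, k) * V $$ (k, i))"
      using U V that i by (auto simp: scalar_prod_def lessThan_atLeast0)
    then show ?thesis using UV that i by simp
  qed
  have row: "U $$ (l, l) * V $$ (l, i) = (if l = i then 1 else 0)"
    if "l < n" and zero: "\<And>k. l < k \<Longrightarrow> k < n \<Longrightarrow> V $$ (k, i) = 0" for l
  proof -
    have "U $$ (l, k) * V $$ (k, i) = 0" if "k < n" "k \<noteq> l" for k
    proof (cases "k < l")
      case True
      then have "U $$ (l, k) = 0" using U \<open>l < n\<close> by (intro upper_triangularD) auto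
      then show ?thesis by simp
    qed (use that zero in auto)
    then have "(\<Sum>k<n. U $$ (l, k) * V $$ (k, i)) = (\<Sum>k\<in>{l}. U $$ (l, k) * V $$ (k, i))"
      using that by (intro sum.mono_neutral_right) auto
    then show ?thesis using prod[OF that(1)] by simp
  qed
  \<comment> \<open>Back substitution starting from the last row, hence induction on
    \<open>n - l\<close>: column \<open>i\<close> of the inverse vanishes below the
    diagonal.\<close>
  have below: "V $$ (l, i) = 0" if "i < l" "l < n" for l
    using that
  proof (induction "n - l" arbitrary: l rule: less_induct)
    case less
    then have "U $$ (l, l) * V $$ (l, i) = (if l = i then 1 else 0)"
      by (intro row less(1)) auto
    then show ?case using nz[of l] less by auto
  qed
  then have "U $$ (i, i) * V $$ (i, i) = 1" using row[OF i] by auto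
  then show ?thesis by (metis inverse_unique)
qed

section \<open>The resolvent\<close>

text \<open>Restricted to indices from 1 to n because nothing is assumed about array entries of
  index 0.\<close>

definition symmetric_upto :: "nat \<Rightarrow> (nat \<Rightarrow> nat \<Rightarrow> real) \<Rightarrow> bool" where
  "symmetric_upto n A \<longleftrightarrow> (\<forall>i\<in>{1..n}. \<forall>j\<in>{1..n}. A i j = A j i)"

definition fun_mat :: "nat \<Rightarrow> (nat \<Rightarrow> nat \<Rightarrow> 'b) \<Rightarrow> 'b mat" where
  "fun_mat n A = Matrix.mat n n (\<lambda>(i, j). A (Suc i) (Suc j))"

definition shifted :: "(nat \<Rightarrow> nat \<Rightarrow> real) \<Rightarrow> complex \<Rightarrow> nat \<Rightarrow> nat \<Rightarrow> complex" where
  "shifted A z i j = complex_of_real (A i j) - (if i = j then z else 0)"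

text \<open>Rows and columns are indexed from 1, as in the array; at index 0 the truncated \<open>i - 1\<close> returns a
  junk value.\<close>

definition resolvent :: "nat \<Rightarrow> (nat \<Rightarrow> nat \<Rightarrow> real) \<Rightarrow> complex \<Rightarrow> nat \<Rightarrow> nat \<Rightarrow> complex" where
  "resolvent n A z i j =
     adj_mat (fun_mat n (shifted A z)) $$ (i - 1, j - 1) / Determinant.det (fun_mat n (shifted A z))"

lemma fun_mat_carrier [simp]: "fun_mat n A \<in> carrier_mat n n"
  by (simp add: fun_mat_def)

lemma fun_mat_index [simp]: "i < n \<Longrightarrow> j < n \<Longrightarrow> fun_mat n A $$ (i, j) = A (Suc i) (Suc j)"
  by (simp add: fun_mat_def)

lemma fun_mat_dim [simp]: "dim_row (fun_mat n A) = n" "dim_col (fun_mat n A) = n"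
  by (simp_all add: fun_mat_def)

lemma transpose_fun_mat: "symmetric_upto n A \<Longrightarrow> transpose_mat (fun_mat n A) = fun_mat n A"
  by (rule eq_matI) (auto simp: symmetric_upto_def)

lemma fun_mat_shifted:
  "fun_mat n (shifted A z) = map_mat complex_of_real (fun_mat n A) - z \<cdot>\<^sub>m 1\<^sub>m n"
  by (rule eq_matI) (auto simp: shifted_def)

text \<open>A kernel vector would be an eigenvector for the eigenvalue \<open>z\<close>, but a real
  symmetric matrix has only real eigenvalues.\<close>

lemma det_shifted_nonzero:
  assumes sym: "symmetric_upto n A" and z: "Im z \<noteq> 0"
  shows "Determinant.det (fun_mat n (shifted A z)) \<noteq> 0"
proof
  define B where "B = map_mat complex_of_real (fun_mat n A)"
  have B: "B \<in> carrier_mat n n" by (simp add: B_def)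
  assume "Determinant.det (fun_mat n (shifted A z)) = 0"
  then obtain v where v: "v \<in> carrier_vec n" "v \<noteq> 0\<^sub>v n" "fun_mat n (shifted A z) *\<^sub>v v = 0\<^sub>v n"
    by (auto simp: det_0_iff_vec_prod_zero_field[OF fun_mat_carrier])
  have "B *\<^sub>v v = z \<cdot>\<^sub>v v"
  proof (rule eq_vecI)
    fix i assume "i < dim_vec (z \<cdot>\<^sub>v v)"
    then have i: "i < n" using v by simp
    have "(fun_mat n (shifted A z) *\<^sub>v v) $ i = (\<Sum>k<n. shifted A z (Suc i) (Suc k) * v $ k)"
      using i v(1) by (simp add: scalar_prod_def lessThan_atLeast0)
    also have "\<dots> = (\<Sum>k<n. complex_of_real (A (Suc i) (Suc k)) * v $ k - (if i = k then z * v $ k else 0))"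
      by (intro sum.cong) (auto simp: shifted_def algebra_simps)
    also have "\<dots> = (B *\<^sub>v v) $ i - z * v $ i"
      using i v by (simp add: scalar_prod_def lessThan_atLeast0 B_def sum_subtractf)
    finally show "(B *\<^sub>v v) $ i = (z \<cdot>\<^sub>v v) $ i" using i v by simp
  qed (use v B in auto)
  then have "eigenvalue B z" using v B by (auto simp: eigenvalue_def eigenvector_def)
  then have "z \<in> \<real>"
    using symmetric_real_root_char_poly[OF fun_mat_carrier transpose_fun_mat[OF sym]]
      eigenvalue_root_char_poly[OF B] by (simp add: B_def)
  then show False using z by (simp add: complex_is_Real_iff)
qed

lemma sum_1_upto: "(\<Sum>k=1..n. f k) = (\<Sum>k<n. f (Suc k))" for f :: "nat \<Rightarrow> 'b :: comm_monoid_add"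
  by (metis One_nat_def sum.atLeast1_atMost_eq)

lemma resolvent_right_inverse:
  assumes sym: "symmetric_upto n A" and z: "Im z \<noteq> 0"
  shows "fun_mat n (shifted A z) * fun_mat n (resolvent n A z) = 1\<^sub>m n"
proof -
  define H where "H = fun_mat n (shifted A z)"
  have H: "H \<in> carrier_mat n n" by (simp add: H_def)
  have nz: "Determinant.det H \<noteq> 0" unfolding H_def by (rule det_shifted_nonzero[OF assms])
  have R: "fun_mat n (resolvent n A z) = inverse (Determinant.det H) \<cdot>\<^sub>m adj_mat H"
    using adj_mat(1)[OF H] by (intro eq_matI) (auto simp: resolvent_def H_def[symmetric] field_simps)
  have "H * fun_mat n (resolvent n A z) = inverse (Determinant.det H) \<cdot>\<^sub>m (H * adj_mat H)"
    unfolding R using H adj_mat(1)[OF H] by (intro mult_smult_distrib) auto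
  also have "\<dots> = 1\<^sub>m n" unfolding adj_mat(2)[OF H] using nz by (intro eq_matI) auto
  finally show ?thesis by (simp add: H_def)
qed

text \<open>The single algebraic input for symmetry, the Ward identity and the resolvent identity:
  each of them evaluates one double sum in two ways with this equation.\<close>

lemma resolvent_eq:
  assumes "symmetric_upto n A" "Im z \<noteq> 0" and ij: "i \<in> {1..n}" "j \<in> {1..n}"
  shows "(\<Sum>k=1..n. complex_of_real (A i k) * resolvent n A z k j)
           = z * resolvent n A z i j + (if i = j then 1 else 0)"
proof -
  obtain i' j' where i': "i = Suc i'" "j = Suc j'" "i' < n" "j' < n"
    using ij by (cases i; cases j) auto
  have "(fun_mat n (shifted A z) * fun_mat n (resolvent n A z)) $$ (i', j')
          = (\<Sum>k<n. shifted A z i (Suc k) * resolvent n A z (Suc k) j)"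
    using i' by (auto simp: scalar_prod_def lessThan_atLeast0)
  also have "\<dots> = (\<Sum>k=1..n. shifted A z i k * resolvent n A z k j)"
    by (rule sum_1_upto[symmetric])
  also have "\<dots> = (\<Sum>k=1..n. complex_of_real (A i k) * resolvent n A z k j)
                 - (\<Sum>k=1..n. (if i = k then z * resolvent n A z k j else 0))"
    unfolding sum_subtractf[symmetric] by (intro sum.cong) (auto simp: shifted_def algebra_simps)
  also have "(\<Sum>k=1..n. (if i = k then z * resolvent n A z k j else 0)) = z * resolvent n A z i j"
    using ij by simp
  finally show ?thesis using resolvent_right_inverse[OF assms(1,2)] i' by simp
qed

text \<open>In the basis of the Schur form the shifted matrix becomes the triangular
  \<open>U\<close> and the resolvent becomes its right inverse \<open>V\<close>, with the same
  trace. The diagonal of \<open>V\<close> consists of the reciprocals of the diagonal of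
  \<open>U\<close>.\<close>

lemma trace_resolvent:
  assumes sym: "symmetric_upto n A" and z: "Im z \<noteq> 0"
  shows "(\<Sum>i=1..n. resolvent n A z i i)
           = (\<Sum>i<n. 1 / (complex_of_real (eigenvalue_list (fun_mat n A) ! i) - z))"
proof -
  let ?c = "map_mat complex_of_real" and ?l = "eigenvalue_list (fun_mat n A)"
  define R where "R = fun_mat n (resolvent n A z)"
  have R: "R \<in> carrier_mat n n" by (simp add: R_def)
  obtain B P Q where B: "upper_triangular B" "diag_mat B = ?l"
    and c: "B \<in> carrier_mat n n" "P \<in> carrier_mat n n" "Q \<in> carrier_mat n n"
    and eq: "fun_mat n A = P * B * Q" "Q * P = 1\<^sub>m n" and w: "similar_mat_wit (fun_mat n A) B P Q"
    using real_schur_symmetric[OF fun_mat_carrier transpose_fun_mat[OF sym]] by metis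
  have PQ: "P * Q = 1\<^sub>m n" using similar_mat_witD2[OF fun_mat_carrier w] by auto
  have cP: "?c P \<in> carrier_mat n n" and cQ: "?c Q \<in> carrier_mat n n" and cB: "?c B \<in> carrier_mat n n"
    using c by auto
  have QP': "?c Q * ?c P = 1\<^sub>m n" and PQ': "?c P * ?c Q = 1\<^sub>m n"
    using c eq(2) PQ by (metis of_real_hom.mat_hom_mult of_real_hom.mat_hom_one)+
  define U where "U = ?c B - z \<cdot>\<^sub>m 1\<^sub>m n"
  define V where "V = ?c Q * R * ?c P"
  have U: "U \<in> carrier_mat n n" "upper_triangular U"
    using B c by (auto simp: U_def upper_triangular_def)
  have V: "V \<in> carrier_mat n n" using R cP cQ by (simp add: V_def)
  have "?c (P * B * Q) = ?c P * ?c B * ?c Q"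
    using c by (simp add: of_real_hom.mat_hom_mult[of _ n n _ n])
  then have H: "fun_mat n (shifted A z) = ?c P * ?c B * ?c Q - z \<cdot>\<^sub>m (?c P * ?c Q)"
    unfolding fun_mat_shifted eq(1) PQ' by simp
  have cQH: "?c Q * fun_mat n (shifted A z) = U * ?c Q"
  proof -
    have "?c Q * fun_mat n (shifted A z) = ?c Q * (?c P * ?c B * ?c Q) - ?c Q * (z \<cdot>\<^sub>m (?c P * ?c Q))"
      unfolding H using cP cB cQ by (intro mult_minus_distrib_mat[of _ n n _ n]) auto
    also have "?c Q * (?c P * ?c B * ?c Q) = ?c Q * ?c P * (?c B * ?c Q)"
      using cP cB cQ by (simp add: assoc_mult_mat[of _ n n _ n _ n])
    also have "\<dots> = ?c B * ?c Q" unfolding QP' using cB cQ by (simp add: left_mult_one_mat[of _ n n])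
    also have "?c Q * (z \<cdot>\<^sub>m (?c P * ?c Q)) = z \<cdot>\<^sub>m ?c Q"
      unfolding PQ' using cQ by (simp add: mult_smult_distrib[of _ n n _ n] right_mult_one_mat[of _ n n])
    also have "?c B * ?c Q - z \<cdot>\<^sub>m ?c Q = U * ?c Q"
      unfolding U_def using cB cQ by (simp add: minus_mult_distrib_mat[of _ n n _ _ n] left_mult_one_mat[of _ n n]
          mult_smult_assoc_mat[of _ n n _ n])
    finally show ?thesis .
  qed
  have "U * V = U * ?c Q * R * ?c P"
    unfolding V_def using U cQ R cP by (simp add: assoc_mult_mat[of _ n n _ n _ n])
  also have "\<dots> = ?c Q * (fun_mat n (shifted A z) * R) * ?c P"
    unfolding cQH[symmetric] using cQ R by (simp add: assoc_mult_mat[of _ n n _ n _ n])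
  also have "\<dots> = 1\<^sub>m n"
    unfolding R_def resolvent_right_inverse[OF assms] using cQ QP' by (simp add: right_mult_one_mat[of _ n n])
  finally have UV: "U * V = 1\<^sub>m n" .
  have nz: "U $$ (k, k) \<noteq> 0" if "k < n" for k
    using that c z by (auto simp: U_def complex_eq_iff)
  have "(\<Sum>i=1..n. resolvent n A z i i) = (\<Sum>i<n. R $$ (i, i))"
    unfolding sum_1_upto by (simp add: R_def)
  also have "R = R * ?c P * ?c Q"
    using R cP cQ PQ' by (simp add: assoc_mult_mat[of _ n n _ n _ n] right_mult_one_mat[of _ n n])
  also have "(\<Sum>i<n. (R * ?c P * ?c Q) $$ (i, i)) = (\<Sum>i<n. (?c Q * (R * ?c P)) $$ (i, i))"
    using R cP cQ by (intro trace_mult_commute) auto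
  also have "?c Q * (R * ?c P) = V"
    unfolding V_def using R cP cQ by (simp add: assoc_mult_mat[of _ n n _ n _ n])
  also have "(\<Sum>i<n. V $$ (i, i)) = (\<Sum>i<n. 1 / (complex_of_real (B $$ (i, i)) - z))"
    using upper_triangular_right_inverse_diag[OF U V UV _ nz] c
    by (intro sum.cong) (auto simp: U_def inverse_eq_divide)
  also have "\<dots> = (\<Sum>i<n. 1 / (complex_of_real (?l ! i) - z))"
    by (rule sum_diag_mat[OF B(2) c(1)])
  finally show ?thesis .
qed

text \<open>The entry (a, b) of the product of the transpose of \<open>G\<close>, of
  \<open>A\<close> and of \<open>G\<close> is computed by applying the resolvent equation to the
  right or to the left factor. The two results differ only in \<open>G b a\<close> versus
  \<open>G a b\<close>.\<close>

lemma resolvent_symmetric: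
  assumes s: "symmetric_upto n A" "Im z \<noteq> 0" and ij: "a \<in> {1..n}" "b \<in> {1..n}"
  shows "resolvent n A z a b = resolvent n A z b a"
proof -
  let ?G = "resolvent n A z"
  have "(\<Sum>i=1..n. ?G i a * (\<Sum>k=1..n. of_real (A i k) * ?G k b))
          = (\<Sum>k=1..n. (\<Sum>i=1..n. of_real (A k i) * ?G i a) * ?G k b)"
    unfolding sum_distrib_left sum_distrib_right
    using s(1) by (subst sum.swap, intro sum.cong) (auto simp: symmetric_upto_def algebra_simps)
  moreover have "(\<Sum>i=1..n. ?G i a * (\<Sum>k=1..n. of_real (A i k) * ?G k b))
      = (\<Sum>i=1..n. z * ?G i a * ?G i b + (if i = b then ?G i a else 0))"
    using resolvent_eq[OF s _ ij(2)] by (intro sum.cong) (auto simp: algebra_simps)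
  moreover have "(\<Sum>k=1..n. (\<Sum>i=1..n. of_real (A k i) * ?G i a) * ?G k b)
      = (\<Sum>i=1..n. z * ?G i a * ?G i b + (if i = a then ?G i b else 0))"
    using resolvent_eq[OF s _ ij(1)] by (intro sum.cong) (auto simp: algebra_simps)
  ultimately show ?thesis using ij by (simp add: sum.distrib)
qed

text \<open>The quadratic form \<open>T\<close> of the real symmetric \<open>A\<close> at column
  \<open>j\<close> of the resolvent is real. By the resolvent equation it equals \<open>z\<close>
  times the squared norm of the column plus \<open>cnj (G j j)\<close>; the claim is the vanishing
  of the imaginary part.\<close>

lemma resolvent_ward:
  assumes s: "symmetric_upto n A" "Im z \<noteq> 0" and j: "j \<in> {1..n}"
  shows "Im z * (\<Sum>k=1..n. (cmod (resolvent n A z k j))\<^sup>2) = Im (resolvent n A z j j)"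
proof -
  let ?G = "resolvent n A z"
  define T where "T = (\<Sum>i=1..n. cnj (?G i j) * (\<Sum>k=1..n. of_real (A i k) * ?G k j))"
  have "cnj T = (\<Sum>i=1..n. \<Sum>k=1..n. ?G i j * of_real (A i k) * cnj (?G k j))"
    unfolding T_def by (simp add: sum_distrib_left mult.assoc)
  also have "\<dots> = T"
    unfolding T_def sum_distrib_left
    using s(1) by (subst sum.swap, intro sum.cong) (auto simp: symmetric_upto_def algebra_simps)
  finally have "Im T = 0" by (simp add: complex_eq_iff)
  have "T = (\<Sum>i=1..n. z * complex_of_real ((cmod (?G i j))\<^sup>2) + (if i = j then cnj (?G j j) else 0))"
    unfolding T_def using resolvent_eq[OF s _ j]
    by (intro sum.cong) (auto simp: algebra_simps complex_norm_square simp del: of_real_power of_real_mult)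
  also have "\<dots> = z * complex_of_real (\<Sum>i=1..n. (cmod (?G i j))\<^sup>2) + cnj (?G j j)"
    using j by (simp add: sum.distrib sum_distrib_left)
  finally show ?thesis using \<open>Im T = 0\<close> by simp
qed

text \<open>The Ward identity bounds the squared norm of column \<open>j\<close> by
  \<open>cmod (G j j)\<close>, and the squared norm dominates the square of this same number. So
  \<open>cmod (G j j)\<close> is at most 1, and with it everything else.\<close>

lemma resolvent_bounds:
  assumes s: "symmetric_upto n A" "Im z \<ge> 1" and ij: "i \<in> {1..n}" "j \<in> {1..n}"
  shows "(\<Sum>k=1..n. (cmod (resolvent n A z k j))\<^sup>2) \<le> 1" "cmod (resolvent n A z i j) \<le> 1"
proof -
  let ?G = "resolvent n A z" and ?S = "\<Sum>k=1..n. (cmod (resolvent n A z k j))\<^sup>2"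
  have S0: "0 \<le> ?S" by (intro sum_nonneg) auto
  have "?S \<le> Im z * ?S" using s(2) S0 by (simp add: mult_le_cancel_right1)
  also have "\<dots> = Im (?G j j)" using s ij by (intro resolvent_ward) auto
  also have "\<dots> \<le> cmod (?G j j)" using abs_Im_le_cmod[of "?G j j"] by linarith
  finally have S: "?S \<le> cmod (?G j j)" .
  have le: "(cmod (?G i j))\<^sup>2 \<le> ?S" if "i \<in> {1..n}" for i
    using that by (intro member_le_sum) auto
  have "(cmod (?G j j))\<^sup>2 \<le> cmod (?G j j)" using S le[OF ij(2)] by simp
  then have "cmod (?G j j) \<le> 1"
    using norm_ge_zero[of "?G j j"] by (cases "?G j j = 0") (auto simp: power2_eq_square)
  with S show "?S \<le> 1" by simp
  then have "(cmod (?G i j))\<^sup>2 \<le> 1" using le[OF ij(1)] by simp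
  then show "cmod (?G i j) \<le> 1" by (simp add: power_le_one_iff abs_square_le_1)
qed

text \<open>Both \<open>G * A * H\<close> and \<open>G * A0 * H\<close> reduce by the resolvent
  equations to the same multiple of \<open>z\<close>, plus \<open>H a b\<close> and
  \<open>G a b\<close> respectively.\<close>

lemma resolvent_identity:
  assumes s: "symmetric_upto n A" "symmetric_upto n A0" "Im z \<noteq> 0"
    and ij: "a \<in> {1..n}" "b \<in> {1..n}"
  shows "resolvent n A z a b - resolvent n A0 z a b
     = - (\<Sum>k=1..n. \<Sum>l=1..n. resolvent n A z a k * of_real (A k l - A0 k l) * resolvent n A0 z l b)"
proof -
  let ?G = "resolvent n A z" and ?H = "resolvent n A0 z"
  have "(\<Sum>k=1..n. \<Sum>l=1..n. ?G a k * of_real (A k l) * ?H l b)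
      = (\<Sum>l=1..n. (\<Sum>k=1..n. of_real (A l k) * ?G k a) * ?H l b)"
    unfolding sum_distrib_left sum_distrib_right
    using s(1) resolvent_symmetric[OF s(1,3) ij(1)]
    by (subst sum.swap, intro sum.cong) (auto simp: symmetric_upto_def algebra_simps)
  also have "\<dots> = (\<Sum>l=1..n. z * ?G l a * ?H l b + (if l = a then ?H l b else 0))"
    using resolvent_eq[OF s(1,3) _ ij(1)] by (intro sum.cong) (auto simp: algebra_simps)
  also have "\<dots> = (\<Sum>l=1..n. z * ?G l a * ?H l b) + ?H a b"
    using ij by (simp add: sum.distrib)
  finally have 1: "(\<Sum>k=1..n. \<Sum>l=1..n. ?G a k * of_real (A k l) * ?H l b) = \<dots>" .
  have "(\<Sum>k=1..n. \<Sum>l=1..n. ?G a k * of_real (A0 k l) * ?H l b)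
      = (\<Sum>k=1..n. ?G a k * (\<Sum>l=1..n. of_real (A0 k l) * ?H l b))"
    by (simp add: sum_distrib_left mult.assoc)
  also have "\<dots> = (\<Sum>l=1..n. z * ?G l a * ?H l b + (if l = b then ?G a l else 0))"
    using resolvent_eq[OF s(2,3) _ ij(2)] resolvent_symmetric[OF s(1,3) ij(1)]
    by (intro sum.cong) (auto simp: algebra_simps)
  also have "\<dots> = (\<Sum>l=1..n. z * ?G l a * ?H l b) + ?G a b"
    using ij by (simp add: sum.distrib)
  finally have 2: "(\<Sum>k=1..n. \<Sum>l=1..n. ?G a k * of_real (A0 k l) * ?H l b) = \<dots>" .
  show ?thesis
    by (simp add: of_real_diff algebra_simps sum_subtractf) (use 1 2 in \<open>simp add: algebra_simps\<close>)
qed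

section \<open>Measurability of the resolvent\<close>

lemma borel_measurable_det:
  fixes H :: "'a \<Rightarrow> complex mat"
  assumes H: "\<And>x. H x \<in> carrier_mat n n"
    and m: "\<And>i j. i < n \<Longrightarrow> j < n \<Longrightarrow> (\<lambda>x. H x $$ (i, j)) \<in> borel_measurable N"
  shows "(\<lambda>x. Determinant.det (H x)) \<in> borel_measurable N"
proof -
  have "(\<lambda>x. \<Sum>p | p permutes {0..<n}. signof p * (\<Prod>i=0..<n. H x $$ (i, p i))) \<in> borel_measurable N"
    by (intro borel_measurable_sum borel_measurable_times borel_measurable_prod borel_measurable_const m)
       (auto dest: permutes_in_image)
  then show ?thesis by (simp add: det_def'[OF H])
qed

text \<open>The cofactor formula makes the resolvent a quotient of polynomials in the entries. The
  sigma-algebra \<open>N\<close> is left arbitrary: it is the full one for \<open>W\<close>, and the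
  one generated by all other entries once an entry has been set to 0.\<close>

lemma borel_measurable_resolvent:
  fixes A :: "'a \<Rightarrow> nat \<Rightarrow> nat \<Rightarrow> real"
  assumes m: "\<And>k l. k \<in> {1..n} \<Longrightarrow> l \<in> {1..n} \<Longrightarrow> (\<lambda>x. A x k l) \<in> borel_measurable N"
    and ij: "i \<in> {1..n}" "j \<in> {1..n}"
  shows "(\<lambda>x. resolvent n (A x) z i j) \<in> borel_measurable N"
proof -
  have H: "(\<lambda>x. fun_mat n (shifted (A x) z) $$ (i, j)) \<in> borel_measurable N" if "i < n" "j < n" for i j
    using that m by (auto simp: shifted_def)
  have adj: "adj_mat (fun_mat n B) $$ (i - 1, j - 1)
      = (- 1) ^ (j - 1 + (i - 1)) * Determinant.det (mat_delete (fun_mat n B) (j - 1) (i - 1))" for B :: "nat \<Rightarrow> nat \<Rightarrow> complex"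
    using ij by (auto simp: adj_mat_def cofactor_def)
  have "(\<lambda>x. Determinant.det (mat_delete (fun_mat n (shifted (A x) z)) (j - 1) (i - 1))) \<in> borel_measurable N"
    by (rule borel_measurable_det[of _ "n - 1"], simp add: mat_delete_def)
       (use H in \<open>auto simp: mat_delete_def\<close>)
  moreover have "(\<lambda>x. Determinant.det (fun_mat n (shifted (A x) z))) \<in> borel_measurable N"
    by (rule borel_measurable_det[of _ n]) (use H in auto)
  ultimately show ?thesis unfolding resolvent_def adj by simp
qed

section \<open>Second-order expansions\<close>

text \<open>\<open>f\<close>, \<open>f'\<close> are the value and the derivative at \<open>x\<close> of a function of one matrix entry, and \<open>f0\<close>, \<open>f0'\<close> those
  at 0. Recording only the resulting inequalities makes the class closed under products without calculus, and
  for the resolvent they follow from the resolvent identity.\<close>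

definition jet :: "real \<Rightarrow> real \<Rightarrow> complex \<Rightarrow> complex \<Rightarrow> complex \<Rightarrow> complex \<Rightarrow> bool" where
  "jet K x f f' f0 f0' \<longleftrightarrow> cmod f \<le> K \<and> cmod f' \<le> K \<and> cmod f0 \<le> K \<and> cmod f0' \<le> K \<and>
     cmod (f - f0) \<le> K * \<bar>x\<bar> \<and> cmod (f' - f0') \<le> K * \<bar>x\<bar> \<and>
     cmod (f - f0 - of_real x * f0') \<le> K * x\<^sup>2"

lemma jet_nonneg: "jet K x f f' f0 f0' \<Longrightarrow> 0 \<le> K"
  unfolding jet_def using norm_ge_zero order_trans by blast

lemma jet_const: "jet (cmod c) x c 0 c 0"
  by (simp add: jet_def)

lemma jet_mono: "jet K x f f' f0 f0' \<Longrightarrow> K \<le> L \<Longrightarrow> jet L x f f' f0 f0'"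
  unfolding jet_def by (meson order_trans mult_right_mono abs_ge_zero zero_le_power2)

lemma jet_cnj: "jet K x f f' f0 f0' \<Longrightarrow> jet K x (cnj f) (cnj f') (cnj f0) (cnj f0')"
proof -
  have "cmod (cnj f - cnj f0) = cmod (f - f0)" "cmod (cnj f' - cnj f0') = cmod (f' - f0')"
    "cmod (cnj f - cnj f0 - of_real x * cnj f0') = cmod (f - f0 - of_real x * f0')"
    by (metis complex_cnj_diff complex_mod_cnj complex_cnj_mult complex_cnj_complex_of_real)+
  then show "jet K x f f' f0 f0' \<Longrightarrow> jet K x (cnj f) (cnj f') (cnj f0) (cnj f0')"
    by (simp add: jet_def)
qed

lemma jet_add:
  assumes "jet K x f f' f0 f0'" "jet L x g g' g0 g0'"
  shows "jet (K + L) x (f + g) (f' + g') (f0 + g0) (f0' + g0')"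
proof -
  have "f + g - (f0 + g0) = (f - f0) + (g - g0)" "f' + g' - (f0' + g0') = (f' - f0') + (g' - g0')"
    "f + g - (f0 + g0) - of_real x * (f0' + g0')
       = (f - f0 - of_real x * f0') + (g - g0 - of_real x * g0')"
    by (auto simp: algebra_simps)
  with assms show ?thesis unfolding jet_def distrib_right
    by (metis norm_triangle_mono)
qed

text \<open>The factor 4 comes from the increment of the derivative, which splits into four terms of
  size \<open>K * L * \<bar>x\<bar>\<close>. The quadratic remainder produces only three such
  terms.\<close>

lemma jet_mult:
  assumes f: "jet K x f f' f0 f0'" and g: "jet L x g g' g0 g0'"
  shows "jet (4 * K * L) x (f * g) (f' * g + f * g') (f0 * g0) (f0' * g0 + f0 * g0')"
proof -
  note f' = f[unfolded jet_def] and g' = g[unfolded jet_def]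
  have K: "0 \<le> K" "0 \<le> L" using jet_nonneg f g by blast+
  have KL: "0 \<le> K * L" using K by simp
  have KLx: "0 \<le> K * L * \<bar>x\<bar>" using KL by simp
  have p: "cmod (a * b) \<le> A * B" if "cmod a \<le> A" "cmod b \<le> B" for a b A B
    unfolding norm_mult using that by (intro mult_mono) (auto intro: order_trans[OF norm_ge_zero])
  have t: "cmod (a + b) \<le> A + B" if "cmod a \<le> A" "cmod b \<le> B" for a b A B
    using that by (rule norm_triangle_mono)
  have 1: "cmod (f * g) \<le> K * L" "cmod (f0 * g0) \<le> K * L"
    "cmod (f' * g + f * g') \<le> K * L + K * L" "cmod (f0' * g0 + f0 * g0') \<le> K * L + K * L"
    using f' g' by (intro p t; simp)+
  have e: "f * g - f0 * g0 = (f - f0) * g + f0 * (g - g0)" for f g f0 g0 :: complex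
    by (simp add: algebra_simps)
  have 2: "cmod (f * g - f0 * g0) \<le> K * \<bar>x\<bar> * L + K * (L * \<bar>x\<bar>)"
    unfolding e using f' g' by (intro p t; simp)
  have "f' * g + f * g' - (f0' * g0 + f0 * g0')
      = ((f' - f0') * g + f0' * (g - g0)) + ((f - f0) * g' + f0 * (g' - g0'))"
    by (simp add: algebra_simps)
  also have "cmod \<dots> \<le> (K * \<bar>x\<bar> * L + K * (L * \<bar>x\<bar>)) + (K * \<bar>x\<bar> * L + K * (L * \<bar>x\<bar>))"
    using f' g' by (intro p t; simp)
  finally have 3: "cmod (f' * g + f * g' - (f0' * g0 + f0 * g0')) \<le> \<dots>" .
  have "f * g - f0 * g0 - of_real x * (f0' * g0 + f0 * g0')
      = ((f - f0 - of_real x * f0') * g0 + f0 * (g - g0 - of_real x * g0')) + (f - f0) * (g - g0)"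
    by (simp add: algebra_simps)
  also have "cmod \<dots> \<le> (K * x\<^sup>2 * L + K * (L * x\<^sup>2)) + (K * \<bar>x\<bar>) * (L * \<bar>x\<bar>)"
    using f' g' by (intro p t; simp)
  also have "\<dots> = 3 * (K * L * x\<^sup>2)" by (simp add: power2_eq_square algebra_simps)
  finally have 4: "cmod (f * g - f0 * g0 - of_real x * (f0' * g0 + f0 * g0')) \<le> 3 * (K * L * x\<^sup>2)" .
  have KLx2: "0 \<le> K * L * x\<^sup>2" using KL by simp
  show ?thesis
    unfolding jet_def using 1 2 3 4 KL KLx KLx2 by (simp add: mult_ac)
qed

text \<open>The constant grows with the total weight and not with the number of terms. With a row of
  variances as weights it stays bounded independently of n.\<close>

lemma jet_sum:
  assumes "\<And>k. k \<in> I \<Longrightarrow> jet K x (f k) (f' k) (f0 k) (f0' k)" and "\<And>k. k \<in> I \<Longrightarrow> 0 \<le> w k"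
  shows "jet (K * (\<Sum>k\<in>I. w k)) x (\<Sum>k\<in>I. complex_of_real (w k) * f k) (\<Sum>k\<in>I. complex_of_real (w k) * f' k)
    (\<Sum>k\<in>I. complex_of_real (w k) * f0 k) (\<Sum>k\<in>I. complex_of_real (w k) * f0' k)"
  using assms
proof (induction I rule: infinite_finite_induct)
  case (insert i I)
  have p: "cmod (of_real (w i) * a) \<le> K * w i * e" if "cmod a \<le> K * e" for a e
  proof -
    have "w i * cmod a \<le> w i * (K * e)" using that insert.prems(2)[of i] by (intro mult_left_mono) auto
    then show ?thesis using insert.prems(2)[of i] by (simp add: norm_mult mult_ac)
  qed
  have "jet K x (f i) (f' i) (f0 i) (f0' i)" using insert by simp
  then have "jet (K * w i) x (of_real (w i) * f i) (of_real (w i) * f' i) (of_real (w i) * f0 i) (of_real (w i) * f0' i)"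
    using p[of _ 1] p[of _ "\<bar>x\<bar>"] p[of _ "x\<^sup>2"] unfolding jet_def
    by (auto simp: right_diff_distrib[symmetric] mult.left_commute[of "of_real x"])
  then show ?case using insert by (simp add: distrib_left jet_add)
qed (simp_all add: jet_def)

text \<open>The perturbation lives on the positions (i, j) and (j, i), so the resolvent identity has
  two terms; for \<open>i = j\<close> the positions coincide and \<open>c\<close> removes the
  duplicate. With all entries bounded by 1, an entry moves by at most
  \<open>2 * \<bar>x\<bar>\<close>, and its derivative, made of two products, by at most
  \<open>8 * \<bar>x\<bar>\<close>, whence the constant.\<close>

lemma jet_resolvent:
  fixes A A0 :: "nat \<Rightarrow> nat \<Rightarrow> real"
  assumes s: "symmetric_upto n A" "symmetric_upto n A0" "Im z \<ge> 1"
    and ij: "i \<in> {1..n}" "j \<in> {1..n}" and ab: "a \<in> {1..n}" "b \<in> {1..n}"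
    and dif: "\<And>k l. k \<in> {1..n} \<Longrightarrow> l \<in> {1..n} \<Longrightarrow>
       A k l - A0 k l = (if k = i \<and> l = j \<or> k = j \<and> l = i then x else 0)"
  defines "G \<equiv> resolvent n A z" and "G0 \<equiv> resolvent n A0 z" and "c \<equiv> (if i = j then 0 else 1)"
  shows "jet 8 x (G a b) (- (G a i * G j b + c * (G a j * G i b)))
                 (G0 a b) (- (G0 a i * G0 j b + c * (G0 a j * G0 i b)))"
proof -
  have id: "G a b - G0 a b = - of_real x * (G a i * G0 j b + c * (G a j * G0 i b))"
    if ab: "a \<in> {1..n}" "b \<in> {1..n}" for a b
  proof -
    have "(\<Sum>k=1..n. \<Sum>l=1..n. G a k * of_real (A k l - A0 k l) * G0 l b)
      = (\<Sum>k=1..n. \<Sum>l=1..n. (if l = j then (if k = i then of_real x * (G a i * G0 j b) else 0) else 0)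
           + (if l = i then (if k = j then of_real x * (c * (G a j * G0 i b)) else 0) else 0))"
      by (intro sum.cong refl, subst dif) (auto simp: c_def)
    also have "\<dots> = of_real x * (G a i * G0 j b + c * (G a j * G0 i b))"
      using ij by (simp add: sum.distrib algebra_simps)
    finally show ?thesis
      using resolvent_identity[OF s(1,2) _ ab, of z] s(3) by (simp add: G_def G0_def)
  qed
  have c: "cmod c \<le> 1" by (simp add: c_def)
  have G: "cmod (G k l) \<le> 1" "cmod (G0 k l) \<le> 1" if "k \<in> {1..n}" "l \<in> {1..n}" for k l
    using resolvent_bounds[OF _ s(3) that] s by (auto simp: G_def G0_def)
  have p: "cmod (u * v) \<le> U * V" if "cmod u \<le> U" "cmod v \<le> V" for u v U V
    unfolding norm_mult using that by (intro mult_mono) (auto intro: order_trans[OF norm_ge_zero])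
  have t: "cmod (u + v) \<le> U + V" if "cmod u \<le> U" "cmod v \<le> V" for u v U V
    using that by (rule norm_triangle_mono)
  have b2: "cmod (G a i * G j b + c * (G a j * G i b)) \<le> 1 * 1 + 1 * (1 * 1)"
    "cmod (G0 a i * G0 j b + c * (G0 a j * G0 i b)) \<le> 1 * 1 + 1 * (1 * 1)"
    using ij ab c by (intro p t G; simp)+
  have d: "cmod (G k l - G0 k l) \<le> 2 * \<bar>x\<bar>" if "k \<in> {1..n}" "l \<in> {1..n}" for k l
  proof -
    have "cmod (G k i * G0 j l + c * (G k j * G0 i l)) \<le> 1 * 1 + 1 * (1 * 1)"
      using ij that c by (intro p t G; simp)+
    then have "\<bar>x\<bar> * cmod (G k i * G0 j l + c * (G k j * G0 i l)) \<le> \<bar>x\<bar> * 2"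
      by (intro mult_left_mono) auto
    then show ?thesis unfolding id[OF that] norm_mult norm_minus_cancel norm_of_real by simp
  qed
  have "- (G a i * G j b + c * (G a j * G i b)) - - (G0 a i * G0 j b + c * (G0 a j * G0 i b))
     = - (((G a i - G0 a i) * G j b + G0 a i * (G j b - G0 j b))
        + c * ((G a j - G0 a j) * G i b + G0 a j * (G i b - G0 i b)))"
    by (simp add: algebra_simps)
  also have "cmod \<dots> \<le> ((2 * \<bar>x\<bar>) * 1 + 1 * (2 * \<bar>x\<bar>)) + 1 * ((2 * \<bar>x\<bar>) * 1 + 1 * (2 * \<bar>x\<bar>))"
    unfolding norm_minus_cancel using ij ab c by (intro p t G d; simp)
  finally have 3: "cmod (- (G a i * G j b + c * (G a j * G i b)) - - (G0 a i * G0 j b + c * (G0 a j * G0 i b)))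
      \<le> 8 * \<bar>x\<bar>" by simp
  have "G a b - G0 a b - of_real x * - (G0 a i * G0 j b + c * (G0 a j * G0 i b))
     = - (of_real x * ((G a i - G0 a i) * G0 j b + c * ((G a j - G0 a j) * G0 i b)))"
    unfolding id[OF ab] by (simp add: algebra_simps)
  also have "cmod \<dots> \<le> \<bar>x\<bar> * ((2 * \<bar>x\<bar>) * 1 + 1 * ((2 * \<bar>x\<bar>) * 1))"
    unfolding norm_minus_cancel using ij ab c by (intro p t G d; simp)
  also have "\<dots> \<le> 8 * x\<^sup>2" by (simp add: power2_eq_square)
  finally have 4: "cmod (G a b - G0 a b - of_real x * - (G0 a i * G0 j b + c * (G0 a j * G0 i b))) \<le> 8 * x\<^sup>2" .
  show ?thesis
    unfolding jet_def norm_minus_cancel using G[OF ab] d[OF ab] b2 3 4 by auto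
qed

section \<open>Conditional expectation, truncation and the expansion of one entry\<close>

lemma integrable_complex_mult_bounded:
  fixes g :: "'a \<Rightarrow> complex" and Y :: "'a \<Rightarrow> real"
  assumes Y: "integrable M Y" and g: "g \<in> borel_measurable M" "\<And>\<omega>. cmod (g \<omega>) \<le> K"
  shows "integrable M (\<lambda>\<omega>. complex_of_real (Y \<omega>) * g \<omega>)"
proof (rule Bochner_Integration.integrable_bound[of _ "\<lambda>\<omega>. K * Y \<omega>"])
  show "AE \<omega> in M. norm (complex_of_real (Y \<omega>) * g \<omega>) \<le> norm (K * Y \<omega>)"
  proof (rule AE_I2)
    fix \<omega>
    have "cmod (g \<omega>) \<le> \<bar>K\<bar>" using g(2)[of \<omega>] by linarith
    then show "norm (complex_of_real (Y \<omega>) * g \<omega>) \<le> norm (K * Y \<omega>)"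
      by (simp add: norm_mult abs_mult mult.commute[of "\<bar>K\<bar>"] mult_left_mono)
  qed
qed (use Y g in \<open>auto intro!: borel_measurable_times borel_measurable_of_real\<close>)

text \<open>Since \<open>real_cond_exp\<close> concerns real variables, the real and imaginary parts
  of the bounded factor are treated separately and reassembled.\<close>

lemma (in sigma_finite_subalgebra) complex_cond_exp_intg:
  fixes g :: "'a \<Rightarrow> complex" and Y :: "'a \<Rightarrow> real"
  assumes Y: "integrable M Y" and g: "g \<in> borel_measurable F" "\<And>\<omega>. cmod (g \<omega>) \<le> K"
  shows "(\<integral>\<omega>. complex_of_real (Y \<omega>) * g \<omega> \<partial>M) = (\<integral>\<omega>. complex_of_real (real_cond_exp M F Y \<omega>) * g \<omega> \<partial>M)"
proof -
  have gM: "g \<in> borel_measurable M" by (rule measurable_from_subalg[OF subalg g(1)])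
  have C: "integrable M (real_cond_exp M F Y)" using real_cond_exp_int(1)[OF Y] .
  note i1 = integrable_complex_mult_bounded[OF Y gM g(2)]
  note i2 = integrable_complex_mult_bounded[OF C gM g(2)]
  have Re: "(\<integral>\<omega>. Re (g \<omega>) * real_cond_exp M F Y \<omega> \<partial>M) = (\<integral>\<omega>. Re (g \<omega>) * Y \<omega> \<partial>M)"
    using integrable_Re[OF i1] Y g(1) by (intro real_cond_exp_intg) (auto simp: mult.commute)
  have Im: "(\<integral>\<omega>. Im (g \<omega>) * real_cond_exp M F Y \<omega> \<partial>M) = (\<integral>\<omega>. Im (g \<omega>) * Y \<omega> \<partial>M)"
    using integrable_Im[OF i1] Y g(1) by (intro real_cond_exp_intg) (auto simp: mult.commute)
  show ?thesis
  proof (rule complex_eqI)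
    show "Re (\<integral>\<omega>. complex_of_real (Y \<omega>) * g \<omega> \<partial>M) = Re (\<integral>\<omega>. complex_of_real (real_cond_exp M F Y \<omega>) * g \<omega> \<partial>M)"
      using Re unfolding integral_Re[OF i1, symmetric] integral_Re[OF i2, symmetric] by (simp add: mult.commute)
    show "Im (\<integral>\<omega>. complex_of_real (Y \<omega>) * g \<omega> \<partial>M) = Im (\<integral>\<omega>. complex_of_real (real_cond_exp M F Y \<omega>) * g \<omega> \<partial>M)"
      using Im unfolding integral_Im[OF i1, symmetric] integral_Im[OF i2, symmetric] by (simp add: mult.commute)
  qed
qed

text \<open>Below the threshold the higher-order bound gains a factor \<open>\<tau>\<close>; above
  it the cruder first-order bounds are used and the loss is charged to the tail indicator, which the
  Lindeberg condition controls after integration.\<close>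

lemma jet_remainder_bound:
  assumes "jet K x f f' f0 f0'" and "0 < \<tau>" "\<tau> \<le> 1"
  shows "cmod (of_real x * (f - f0 - of_real x * f0')) \<le> K * (\<tau> * x\<^sup>2 + 2 * (x\<^sup>2 * indicator {\<tau>..} \<bar>x\<bar>))"
    and "cmod (f' - f0') \<le> K * (\<tau> + 2 * indicator {\<tau>..} \<bar>x\<bar>)"
proof -
  note j = assms(1)[unfolded jet_def]
  have K: "0 \<le> K" using jet_nonneg assms by blast
  have n: "cmod (of_real x * (f - f0 - of_real x * f0')) = \<bar>x\<bar> * cmod (f - f0 - of_real x * f0')"
    by (simp add: norm_mult)
  show "cmod (of_real x * (f - f0 - of_real x * f0')) \<le> K * (\<tau> * x\<^sup>2 + 2 * (x\<^sup>2 * indicator {\<tau>..} \<bar>x\<bar>))"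
  proof (cases "\<tau> \<le> \<bar>x\<bar>")
    case True
    have "cmod (f - f0 - of_real x * f0') \<le> cmod (f - f0) + \<bar>x\<bar> * cmod f0'"
      by (metis norm_triangle_ineq4 norm_mult norm_of_real)
    also have "\<dots> \<le> K * \<bar>x\<bar> + \<bar>x\<bar> * K" using j by (intro add_mono mult_left_mono) auto
    finally have "\<bar>x\<bar> * cmod (f - f0 - of_real x * f0') \<le> \<bar>x\<bar> * (2 * K * \<bar>x\<bar>)"
      by (intro mult_left_mono) auto
    also have "\<dots> = K * (2 * x\<^sup>2)" by (simp add: power2_eq_square)
    also have "\<dots> \<le> K * (\<tau> * x\<^sup>2 + 2 * x\<^sup>2)" using K assms by (intro mult_left_mono) auto
    finally show ?thesis using True n by simp
  next
    case False
    have "\<bar>x\<bar> * cmod (f - f0 - of_real x * f0') \<le> \<tau> * (K * x\<^sup>2)"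
      using False j by (intro mult_mono) auto
    then show ?thesis using False n by (simp add: mult_ac)
  qed
  show "cmod (f' - f0') \<le> K * (\<tau> + 2 * indicator {\<tau>..} \<bar>x\<bar>)"
  proof (cases "\<tau> \<le> \<bar>x\<bar>")
    case True
    have "cmod (f' - f0') \<le> K + K" using j by (meson norm_triangle_ineq4 add_mono order_trans)
    also have "\<dots> \<le> K * (\<tau> + 2)" using K assms by (simp add: algebra_simps)
    finally show ?thesis using True by simp
  next
    case False
    have "cmod (f' - f0') \<le> K * \<bar>x\<bar>" using j by simp
    also have "\<dots> \<le> K * \<tau>" using False K by (intro mult_left_mono) auto
    finally show ?thesis using False by simp
  qed
qed

lemma (in prob_space) integral_norm_bound_complex:
  fixes f :: "'a \<Rightarrow> complex"
  assumes "f \<in> borel_measurable M" "integrable M g" "\<And>\<omega>. cmod (f \<omega>) \<le> g \<omega>"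
  shows "integrable M f" "cmod (\<integral>\<omega>. f \<omega> \<partial>M) \<le> (\<integral>\<omega>. g \<omega> \<partial>M)"
proof -
  show i: "integrable M f"
    using assms by (intro Bochner_Integration.integrable_bound[OF assms(2,1)] AE_I2)
      (metis abs_of_nonneg norm_ge_zero order_trans real_norm_def)
  have "cmod (\<integral>\<omega>. f \<omega> \<partial>M) \<le> (\<integral>\<omega>. cmod (f \<omega>) \<partial>M)" by (rule integral_norm_bound)
  also have "\<dots> \<le> (\<integral>\<omega>. g \<omega> \<partial>M)" using i assms by (intro integral_mono) auto
  finally show "cmod (\<integral>\<omega>. f \<omega> \<partial>M) \<le> (\<integral>\<omega>. g \<omega> \<partial>M)" .
qed

text \<open>Everything follows from splitting at the level \<open>t\<close>: the part of the second
  moment below it is at most the square of \<open>t\<close>, the part above it is \<open>l\<close>,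
  and \<open>l\<close> also bounds the tail probability as in Chebyshev's inequality.\<close>

lemma (in prob_space) truncated_second_moment:
  fixes Y :: "'a \<Rightarrow> real"
  assumes Y: "Y \<in> borel_measurable M" "integrable M (\<lambda>\<omega>. (Y \<omega>)\<^sup>2)" and t: "0 \<le> t"
  defines "l \<equiv> (\<integral>\<omega>. \<bar>Y \<omega>\<bar>\<^sup>2 * indicator {\<omega>. \<bar>Y \<omega>\<bar> \<ge> t} \<omega> \<partial>M)"
  shows "integrable M (\<lambda>\<omega>. (Y \<omega>)\<^sup>2 * indicator {t..} \<bar>Y \<omega>\<bar>)" and "l = (\<integral>\<omega>. (Y \<omega>)\<^sup>2 * indicator {t..} \<bar>Y \<omega>\<bar> \<partial>M)"
    and "0 \<le> l" and "(\<integral>\<omega>. (Y \<omega>)\<^sup>2 \<partial>M) \<le> t\<^sup>2 + l"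
    and "t\<^sup>2 * (\<integral>\<omega>. indicator {t..} \<bar>Y \<omega>\<bar> \<partial>M) \<le> l"
    and "integrable M (\<lambda>\<omega>. indicator {t..} \<bar>Y \<omega>\<bar> :: real)"
proof -
  have m: "(\<lambda>\<omega>. indicator {t..} \<bar>Y \<omega>\<bar> :: real) \<in> borel_measurable M"
    using Y(1) by measurable
  show i: "integrable M (\<lambda>\<omega>. (Y \<omega>)\<^sup>2 * indicator {t..} \<bar>Y \<omega>\<bar>)"
    using Y m by (intro Bochner_Integration.integrable_bound[OF Y(2)] AE_I2) (auto simp: indicator_def)
  show l: "l = (\<integral>\<omega>. (Y \<omega>)\<^sup>2 * indicator {t..} \<bar>Y \<omega>\<bar> \<partial>M)"
    unfolding l_def by (intro Bochner_Integration.integral_cong) (auto simp: indicator_def)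
  show "0 \<le> l" unfolding l by (intro integral_nonneg_AE AE_I2) auto
  show i2: "integrable M (\<lambda>\<omega>. indicator {t..} \<bar>Y \<omega>\<bar> :: real)"
    using m by (intro integrable_const_bound[of _ 1] AE_I2) (auto simp: indicator_def)
  have "(\<integral>\<omega>. (Y \<omega>)\<^sup>2 \<partial>M) \<le> (\<integral>\<omega>. t\<^sup>2 + (Y \<omega>)\<^sup>2 * indicator {t..} \<bar>Y \<omega>\<bar> \<partial>M)"
  proof (rule integral_mono)
    fix \<omega>
    have "(Y \<omega>)\<^sup>2 \<le> t\<^sup>2" if "\<bar>Y \<omega>\<bar> < t" using that t by (intro abs_le_square_iff[THEN iffD1]) auto
    then show "(Y \<omega>)\<^sup>2 \<le> t\<^sup>2 + (Y \<omega>)\<^sup>2 * indicator {t..} \<bar>Y \<omega>\<bar>"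
      by (auto simp: indicator_def)
  qed (use Y i in auto)
  then show "(\<integral>\<omega>. (Y \<omega>)\<^sup>2 \<partial>M) \<le> t\<^sup>2 + l" using i unfolding l by (simp add: prob_space)
  have "(\<integral>\<omega>. t\<^sup>2 * indicator {t..} \<bar>Y \<omega>\<bar> \<partial>M) \<le> l" unfolding l
  proof (rule integral_mono)
    fix \<omega>
    have "t\<^sup>2 \<le> (Y \<omega>)\<^sup>2" if "t \<le> \<bar>Y \<omega>\<bar>" using that t by (intro abs_le_square_iff[THEN iffD1]) auto
    then show "t\<^sup>2 * indicator {t..} \<bar>Y \<omega>\<bar> \<le> (Y \<omega>)\<^sup>2 * indicator {t..} \<bar>Y \<omega>\<bar>"
      by (auto simp: indicator_def)
  qed (use i i2 in auto)
  then show "t\<^sup>2 * (\<integral>\<omega>. indicator {t..} \<bar>Y \<omega>\<bar> \<partial>M) \<le> l" using i2 by simp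
qed

text \<open>With \<open>x = Y / sqrt N\<close>, write \<open>x * f\<close> as \<open>x * f0\<close>,
  plus the square of \<open>x\<close> times \<open>f0'\<close>, plus a remainder \<open>r\<close>.
  The first term integrates to 0 by the conditional mean; in the second the square is replaced by
  its conditional expectation and then by \<open>s\<close>, at cost \<open>\<beta>\<close>. Finally
  \<open>f0'\<close> is replaced by \<open>f'\<close>, so that the later cancellation takes place
  between entries of one and the same resolvent. The coefficient 6 is 2 from \<open>r\<close> plus 4
  from this last replacement.\<close>

lemma (in prob_space) second_order_expansion:
  fixes Y :: "'a \<Rightarrow> real" and f f' f0 f0' :: "'a \<Rightarrow> complex"
  assumes F: "subalgebra M F"
    and Y: "Y \<in> borel_measurable M" "integrable M (\<lambda>\<omega>. (Y \<omega>)\<^sup>2)"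
    and Y0: "AE \<omega> in M. real_cond_exp M F Y \<omega> = 0"
    and m: "f \<in> borel_measurable M" "f' \<in> borel_measurable M" "f0 \<in> borel_measurable F" "f0' \<in> borel_measurable F"
    and N: "0 < N" and \<tau>: "0 < \<tau>" "\<tau> \<le> 1"
    and jet: "\<And>\<omega>. jet K (Y \<omega> / sqrt N) (f \<omega>) (f' \<omega>) (f0 \<omega>) (f0' \<omega>)"
    and s_def: "s = (\<integral>\<omega>. (Y \<omega>)\<^sup>2 \<partial>M)"
    and \<beta>_def: "\<beta> = (\<integral>\<omega>. \<bar>real_cond_exp M F (\<lambda>\<omega>. (Y \<omega>)\<^sup>2) \<omega> - s\<bar> \<partial>M)"
    and l_def: "l = (\<integral>\<omega>. \<bar>Y \<omega>\<bar>\<^sup>2 * indicator {\<omega>. \<bar>Y \<omega>\<bar> \<ge> \<tau> * sqrt N} \<omega> \<partial>M)"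
  shows "cmod ((\<integral>\<omega>. of_real (Y \<omega> / sqrt N) * f \<omega> \<partial>M) - of_real (s / N) * (\<integral>\<omega>. f' \<omega> \<partial>M))
     \<le> K / N * (\<beta> + 2 * \<tau> * s + 6 * l)"
proof -
  interpret finite_measure_subalgebra M F by unfold_locales (rule F)
  have K: "0 \<le> K" using jet jet_nonneg by blast
  have Kf: "cmod (f \<omega>) \<le> K" "cmod (f' \<omega>) \<le> K" "cmod (f0 \<omega>) \<le> K" "cmod (f0' \<omega>) \<le> K" for \<omega>
    using jet[of \<omega>] by (auto simp: jet_def)
  define x where "x = (\<lambda>\<omega>. Y \<omega> / sqrt N)"
  define C where "C = real_cond_exp M F (\<lambda>\<omega>. (Y \<omega>)\<^sup>2)"
  have iY: "integrable M Y" using square_integrable_imp_integrable[OF Y] by simp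
  have x2: "(x \<omega>)\<^sup>2 = (Y \<omega>)\<^sup>2 / N" for \<omega> using N by (simp add: x_def power_divide)
  have mM: "f0 \<in> borel_measurable M" "f0' \<in> borel_measurable M"
    using m measurable_from_subalg[OF F] by blast+
  have mx: "x \<in> borel_measurable M" using Y by (simp add: x_def)
  have ix: "integrable M x" "integrable M (\<lambda>\<omega>. (x \<omega>)\<^sup>2)" using iY Y unfolding x2 by (auto simp: x_def)
  have iC: "integrable M C" unfolding C_def using real_cond_exp_int[OF Y(2)] by simp
  have s0: "0 \<le> s" unfolding s_def by (intro integral_nonneg_AE AE_I2) auto
  have ind: "indicator {\<tau>..} \<bar>x \<omega>\<bar> = (indicator {\<tau> * sqrt N..} \<bar>Y \<omega>\<bar> :: real)" for \<omega>
    using N by (auto simp: indicator_def x_def field_simps)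
  have t: "0 \<le> \<tau> * sqrt N" using \<tau> N by simp
  note tr = truncated_second_moment[OF Y t, folded l_def]
  have ifs: "integrable M f'" "integrable M f0'"
    using Kf m mM by (auto intro!: integrable_const_bound[of _ K])
  define r where "r = (\<lambda>\<omega>. of_real (x \<omega>) * (f \<omega> - f0 \<omega> - of_real (x \<omega>) * f0' \<omega>))"
  have mr: "r \<in> borel_measurable M" unfolding r_def using mx m mM by measurable
  have r: "integrable M r" "cmod (\<integral>\<omega>. r \<omega> \<partial>M) \<le> K / N * (\<tau> * s + 2 * l)"
  proof -
    have b: "cmod (r \<omega>) \<le> K / N * (\<tau> * (Y \<omega>)\<^sup>2 + 2 * ((Y \<omega>)\<^sup>2 * indicator {\<tau> * sqrt N..} \<bar>Y \<omega>\<bar>))" for \<omega>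
      using jet_remainder_bound(1)[OF jet \<tau>, of \<omega>, folded x_def[THEN fun_cong]]
      unfolding r_def ind x2 by (simp only: times_divide_eq_left times_divide_eq_right add_divide_distrib distrib_left mult.assoc)
    have i: "integrable M (\<lambda>\<omega>. K / N * (\<tau> * (Y \<omega>)\<^sup>2 + 2 * ((Y \<omega>)\<^sup>2 * indicator {\<tau> * sqrt N..} \<bar>Y \<omega>\<bar>)))"
      using tr(1) Y by simp
    show "integrable M r" by (rule integral_norm_bound_complex[OF mr i b])
    have "cmod (\<integral>\<omega>. r \<omega> \<partial>M) \<le> (\<integral>\<omega>. K / N * (\<tau> * (Y \<omega>)\<^sup>2 + 2 * ((Y \<omega>)\<^sup>2 * indicator {\<tau> * sqrt N..} \<bar>Y \<omega>\<bar>)) \<partial>M)"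
      by (rule integral_norm_bound_complex[OF mr i b])
    also have "\<dots> = K / N * (\<tau> * s + 2 * l)"
      using tr(1) Y by (simp add: tr(2) s_def)
    finally show "cmod (\<integral>\<omega>. r \<omega> \<partial>M) \<le> \<dots>" .
  qed
  have d: "s / N * (cmod (\<integral>\<omega>. f' \<omega> - f0' \<omega> \<partial>M)) \<le> K / N * (\<tau> * s + 4 * l)"
  proof -
    define p :: real where "p = (\<integral>\<omega>. indicator {\<tau> * sqrt N..} \<bar>Y \<omega>\<bar> \<partial>M)"
    have p: "0 \<le> p" "p \<le> 1"
    proof -
      show "0 \<le> p" unfolding p_def by (intro integral_nonneg_AE AE_I2) auto
      have "p \<le> (\<integral>\<omega>. 1 \<partial>M)" unfolding p_def using tr(6) by (intro integral_mono) (auto simp: indicator_def)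
      then show "p \<le> 1" by (simp add: prob_space)
    qed
    have "cmod (\<integral>\<omega>. f' \<omega> - f0' \<omega> \<partial>M) \<le> (\<integral>\<omega>. K * (\<tau> + 2 * indicator {\<tau> * sqrt N..} \<bar>Y \<omega>\<bar>) \<partial>M)"
      using jet_remainder_bound(2)[OF jet \<tau>, folded x_def[THEN fun_cong]] m mM tr(6)
      unfolding ind by (intro integral_norm_bound_complex) auto
    also have "\<dots> = K * (\<tau> + 2 * p)" using tr(6) by (simp add: prob_space p_def)
    finally have "s * cmod (\<integral>\<omega>. f' \<omega> - f0' \<omega> \<partial>M) \<le> s * (K * (\<tau> + 2 * p))"
      using s0 by (rule mult_left_mono)
    also have "\<dots> = K * (\<tau> * s + 2 * (s * p))" by (simp add: algebra_simps)
    \<comment> \<open>Neither the variance \<open>s\<close> nor the tail probability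
      \<open>p\<close> has to be small. But \<open>s\<close> is at most the squared threshold plus
      \<open>l\<close>, the squared threshold times \<open>p\<close> is at most \<open>l\<close>,
      and \<open>p\<close> is at most 1.\<close>
    also have "s * p \<le> ((\<tau> * sqrt N)\<^sup>2 + l) * p" using tr(4) p by (intro mult_right_mono) (auto simp: s_def)
    also have "\<dots> \<le> l + l"
      using tr(5) p tr(3) mult_left_mono[OF p(2) tr(3)] by (simp add: distrib_right p_def)
    finally have "s * cmod (\<integral>\<omega>. f' \<omega> - f0' \<omega> \<partial>M) \<le> K * (\<tau> * s + 4 * l)"
      using K by (simp add: mult_left_mono)
    then show ?thesis using N by (simp add: field_simps)
  qed
  have e1: "(\<integral>\<omega>. of_real (x \<omega>) * f0 \<omega> \<partial>M) = 0"
  proof -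
    have "(\<integral>\<omega>. complex_of_real (Y \<omega>) * f0 \<omega> \<partial>M) = (\<integral>\<omega>. complex_of_real (real_cond_exp M F Y \<omega>) * f0 \<omega> \<partial>M)"
      by (rule complex_cond_exp_intg[OF iY m(3) Kf(3)])
    also have "\<dots> = (\<integral>\<omega>. 0 \<partial>M)" using Y0 mM by (intro integral_cong_AE) auto
    finally have "(\<integral>\<omega>. complex_of_real (Y \<omega>) * f0 \<omega> \<partial>M) = 0" by simp
    then show ?thesis by (simp add: x_def)
  qed
  have e2: "cmod ((\<integral>\<omega>. of_real ((x \<omega>)\<^sup>2) * f0' \<omega> \<partial>M) - of_real (s / N) * (\<integral>\<omega>. f0' \<omega> \<partial>M)) \<le> K / N * \<beta>"
  proof -
    have i: "integrable M (\<lambda>\<omega>. complex_of_real (C \<omega>) * f0' \<omega>)"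
      by (rule integrable_complex_mult_bounded[OF iC mM(2) Kf(4)])
    have "(\<integral>\<omega>. of_real ((x \<omega>)\<^sup>2) * f0' \<omega> \<partial>M) = (\<integral>\<omega>. of_real ((Y \<omega>)\<^sup>2) * f0' \<omega> \<partial>M) / of_real N"
      unfolding x2 by simp
    also have "(\<integral>\<omega>. of_real ((Y \<omega>)\<^sup>2) * f0' \<omega> \<partial>M) = (\<integral>\<omega>. of_real (C \<omega>) * f0' \<omega> \<partial>M)"
      unfolding C_def by (rule complex_cond_exp_intg[OF Y(2) m(4) Kf(4)])
    finally have eq: "(\<integral>\<omega>. of_real ((x \<omega>)\<^sup>2) * f0' \<omega> \<partial>M) - of_real (s / N) * (\<integral>\<omega>. f0' \<omega> \<partial>M)
       = (\<integral>\<omega>. of_real (C \<omega> - s) * f0' \<omega> \<partial>M) / of_real N"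
      using i ifs N by (simp add: left_diff_distrib diff_divide_distrib)
    have "cmod (\<integral>\<omega>. of_real (C \<omega> - s) * f0' \<omega> \<partial>M) \<le> (\<integral>\<omega>. K * \<bar>C \<omega> - s\<bar> \<partial>M)"
    proof (rule integral_norm_bound_complex)
      show "cmod (of_real (C \<omega> - s) * f0' \<omega>) \<le> K * \<bar>C \<omega> - s\<bar>" for \<omega>
        using Kf(4)[of \<omega>] by (simp only: norm_mult norm_of_real mult.commute[of K]) (simp add: mult_left_mono)
    qed (use iC mM in auto)
    then have "cmod (\<integral>\<omega>. of_real (C \<omega> - s) * f0' \<omega> \<partial>M) \<le> K * \<beta>"
      by (simp add: \<beta>_def C_def)
    then show ?thesis unfolding eq norm_divide using N by (simp add: divide_right_mono)
  qed
  have i1: "integrable M (\<lambda>\<omega>. complex_of_real (x \<omega>) * f0 \<omega>)"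
    by (rule integrable_complex_mult_bounded[OF ix(1) mM(1) Kf(3)])
  have i2: "integrable M (\<lambda>\<omega>. complex_of_real ((x \<omega>)\<^sup>2) * f0' \<omega>)"
    by (rule integrable_complex_mult_bounded[OF ix(2) mM(2) Kf(4)])
  have "(\<integral>\<omega>. of_real (x \<omega>) * f \<omega> \<partial>M)
      = (\<integral>\<omega>. of_real (x \<omega>) * f0 \<omega> + of_real ((x \<omega>)\<^sup>2) * f0' \<omega> + r \<omega> \<partial>M)"
    by (intro Bochner_Integration.integral_cong) (auto simp: r_def power2_eq_square algebra_simps)
  also have "\<dots> = (\<integral>\<omega>. of_real ((x \<omega>)\<^sup>2) * f0' \<omega> \<partial>M) + (\<integral>\<omega>. r \<omega> \<partial>M)"
    using i1 i2 r(1) e1 by simp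
  finally have "(\<integral>\<omega>. of_real (x \<omega>) * f \<omega> \<partial>M) - of_real (s / N) * (\<integral>\<omega>. f' \<omega> \<partial>M)
    = ((\<integral>\<omega>. of_real ((x \<omega>)\<^sup>2) * f0' \<omega> \<partial>M) - of_real (s / N) * (\<integral>\<omega>. f0' \<omega> \<partial>M))
      + (\<integral>\<omega>. r \<omega> \<partial>M) - of_real (s / N) * (\<integral>\<omega>. f' \<omega> - f0' \<omega> \<partial>M)"
    using ifs by (simp add: algebra_simps)
  also have "cmod \<dots> \<le> K / N * \<beta> + K / N * (\<tau> * s + 2 * l) + K / N * (\<tau> * s + 4 * l)"
  proof -
    have "cmod (of_real (s / N) * (\<integral>\<omega>. f' \<omega> - f0' \<omega> \<partial>M)) \<le> K / N * (\<tau> * s + 4 * l)"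
      using d s0 N unfolding norm_mult norm_of_real by simp
    then show ?thesis using e2 r(2) by (smt (verit) norm_triangle_ineq norm_triangle_ineq4)
  qed
  also have "\<dots> = K / N * (\<beta> + 2 * \<tau> * s + 6 * l)" by (simp add: algebra_simps)
  finally show ?thesis by (simp add: x_def)
qed

section \<open>The self-consistent equation\<close>

text \<open>The derivative of the entry \<open>G a b\<close> of a resolvent when the entries \<open>(i, j)\<close> and \<open>(j, i)\<close> of the matrix move
  together.\<close>

definition dres :: "(nat \<Rightarrow> nat \<Rightarrow> complex) \<Rightarrow> nat \<Rightarrow> nat \<Rightarrow> nat \<Rightarrow> nat \<Rightarrow> complex" where
  "dres G i j a b = - (G a i * G j b + (if i = j then 0 else 1) * (G a j * G i b))"

definition defect :: "nat \<Rightarrow> complex \<Rightarrow> (nat \<Rightarrow> nat \<Rightarrow> real) \<Rightarrow> (nat \<Rightarrow> nat \<Rightarrow> complex) \<Rightarrow> nat \<Rightarrow> complex" where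
  "defect n z S G i = 1 + z * G i i + G i i * (\<Sum>k=1..n. of_real (S i k) * G k k)"

definition ddefect :: "nat \<Rightarrow> complex \<Rightarrow> (nat \<Rightarrow> nat \<Rightarrow> real) \<Rightarrow> (nat \<Rightarrow> nat \<Rightarrow> complex) \<Rightarrow> nat \<Rightarrow> nat \<Rightarrow> complex" where
  "ddefect n z S G i j = z * dres G i j i i + (dres G i j i i * (\<Sum>k=1..n. of_real (S i k) * G k k)
     + G i i * (\<Sum>k=1..n. of_real (S i k) * dres G i j k k))"

text \<open>The jet constants of the three summands of \<open>defect\<close>: the constant 1, then
  \<open>4 * cmod z * 8\<close> and \<open>4 * 8 * (8 * C)\<close> from the product rule, where 8
  belongs to a resolvent entry and \<open>8 * C\<close> to a weighted row sum.\<close>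

definition defect_const :: "complex \<Rightarrow> real \<Rightarrow> real" where
  "defect_const z C = 1 + 32 * cmod z + 256 * C"

text \<open>The second claim concerns the function that multiplies \<open>W i j\<close> when
  \<open>D i * cnj (D i)\<close> is expanded; its extra factor is \<open>4 * 8\<close>.\<close>

lemma jet_defect:
  fixes A A0 :: "nat \<Rightarrow> nat \<Rightarrow> real"
  assumes s: "symmetric_upto n A" "symmetric_upto n A0" "Im z \<ge> 1"
    and ij: "i \<in> {1..n}" "j \<in> {1..n}"
    and dif: "\<And>k l. k \<in> {1..n} \<Longrightarrow> l \<in> {1..n} \<Longrightarrow>
       A k l - A0 k l = (if k = i \<and> l = j \<or> k = j \<and> l = i then x else 0)"
    and S: "\<And>k. 0 \<le> S i k" "(\<Sum>k=1..n. S i k) \<le> C"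
  defines "G \<equiv> resolvent n A z" and "G0 \<equiv> resolvent n A0 z"
  shows "jet (defect_const z C) x (defect n z S G i) (ddefect n z S G i j) (defect n z S G0 i) (ddefect n z S G0 i j)"
    and "jet (32 * defect_const z C) x (G i j * cnj (defect n z S G i))
       (dres G i j i j * cnj (defect n z S G i) + G i j * cnj (ddefect n z S G i j))
       (G0 i j * cnj (defect n z S G0 i))
       (dres G0 i j i j * cnj (defect n z S G0 i) + G0 i j * cnj (ddefect n z S G0 i j))"
proof -
  have J: "jet 8 x (G a b) (dres G i j a b) (G0 a b) (dres G0 i j a b)" if "a \<in> {1..n}" "b \<in> {1..n}" for a b
    using jet_resolvent[OF s ij that dif] by (simp add: G_def G0_def dres_def)
  have T: "jet (8 * C) x (\<Sum>k=1..n. of_real (S i k) * G k k) (\<Sum>k=1..n. of_real (S i k) * dres G i j k k)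
     (\<Sum>k=1..n. of_real (S i k) * G0 k k) (\<Sum>k=1..n. of_real (S i k) * dres G0 i j k k)"
    by (rule jet_mono[OF jet_sum]) (use J S in auto)
  have Z: "jet (4 * cmod z * 8) x (z * G i i) (0 * G i i + z * dres G i j i i) (z * G0 i i) (0 * G0 i i + z * dres G0 i j i i)"
    by (rule jet_mult[OF jet_const J[OF ij(1) ij(1)]])
  have P: "jet (4 * 8 * (8 * C)) x (G i i * (\<Sum>k=1..n. of_real (S i k) * G k k))
     (dres G i j i i * (\<Sum>k=1..n. of_real (S i k) * G k k) + G i i * (\<Sum>k=1..n. of_real (S i k) * dres G i j k k))
     (G0 i i * (\<Sum>k=1..n. of_real (S i k) * G0 k k))
     (dres G0 i j i i * (\<Sum>k=1..n. of_real (S i k) * G0 k k) + G0 i i * (\<Sum>k=1..n. of_real (S i k) * dres G0 i j k k))"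
    by (rule jet_mult[OF J[OF ij(1) ij(1)] T])
  show D: "jet (defect_const z C) x (defect n z S G i) (ddefect n z S G i j) (defect n z S G0 i) (ddefect n z S G0 i j)"
    using jet_add[OF jet_add[OF jet_const[of 1] Z] P]
    by (simp add: defect_const_def defect_def ddefect_def)
  show "jet (32 * defect_const z C) x (G i j * cnj (defect n z S G i))
       (dres G i j i j * cnj (defect n z S G i) + G i j * cnj (ddefect n z S G i j))
       (G0 i j * cnj (defect n z S G0 i))
       (dres G0 i j i j * cnj (defect n z S G0 i) + G0 i j * cnj (ddefect n z S G0 i j))"
    using jet_mult[OF J[OF ij] jet_cnj[OF D]] by simp
qed

lemma borel_measurable_cnj:
  assumes "f \<in> borel_measurable N"
  shows "(\<lambda>\<omega>. cnj (f \<omega>)) \<in> borel_measurable N"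
  using measurable_compose[OF assms borel_measurable_continuous_onI[of cnj]] continuous_on_cnj[OF continuous_on_id]
  by simp

section \<open>The array, its resolvent and the second moment of the defects\<close>

locale martingale_array = prob_space M for M :: "'a measure" +
  fixes X :: "nat \<Rightarrow> nat \<Rightarrow> 'a \<Rightarrow> real" and \<sigma> :: "nat \<Rightarrow> nat \<Rightarrow> real"
  assumes rv: "\<And>j k. 1 \<le> j \<Longrightarrow> j \<le> k \<Longrightarrow> X j k \<in> borel_measurable M"
    and sq_integrable: "\<And>j k. 1 \<le> j \<Longrightarrow> j \<le> k \<Longrightarrow> integrable M (\<lambda>\<omega>. (X j k \<omega>)\<^sup>2)"
    and var: "\<And>j k. 1 \<le> j \<Longrightarrow> j \<le> k \<Longrightarrow> (\<integral>\<omega>. (X j k \<omega>)\<^sup>2 \<partial>M) = (\<sigma> j k)\<^sup>2"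
    and X_symm: "\<And>j k. 1 \<le> j \<Longrightarrow> j < k \<Longrightarrow> X k j = X j k"
    and sigma_symm: "\<And>j k. 1 \<le> j \<Longrightarrow> j < k \<Longrightarrow> \<sigma> k j = \<sigma> j k"
    and cond_mean: "\<And>n i j. 1 \<le> i \<Longrightarrow> i \<le> j \<Longrightarrow> j \<le> n \<Longrightarrow>
              AE \<omega> in M. real_cond_exp M (sigma_without M X n i j) (X i j) \<omega> = 0"
begin

definition W :: "nat \<Rightarrow> 'a \<Rightarrow> nat \<Rightarrow> nat \<Rightarrow> real" where
  "W n \<omega> i j = X i j \<omega> / sqrt (real n)"

text \<open>Both mirror positions are cleared so that the matrix stays symmetric and its resolvent
  obeys the same bounds.\<close>

definition W0 :: "nat \<Rightarrow> nat \<Rightarrow> nat \<Rightarrow> 'a \<Rightarrow> nat \<Rightarrow> nat \<Rightarrow> real" where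
  "W0 n p q \<omega> i j = (if i = p \<and> j = q \<or> i = q \<and> j = p then 0 else W n \<omega> i j)"

definition S :: "nat \<Rightarrow> nat \<Rightarrow> nat \<Rightarrow> real" where
  "S n i j = (\<sigma> i j)\<^sup>2 / real n"

abbreviation G :: "nat \<Rightarrow> complex \<Rightarrow> 'a \<Rightarrow> nat \<Rightarrow> nat \<Rightarrow> complex" where
  "G n z \<omega> \<equiv> resolvent n (W n \<omega>) z"

abbreviation D :: "nat \<Rightarrow> complex \<Rightarrow> 'a \<Rightarrow> nat \<Rightarrow> complex" where
  "D n z \<omega> i \<equiv> defect n z (S n) (G n z \<omega>) i"

definition cond_var_dev :: "nat \<Rightarrow> nat \<Rightarrow> nat \<Rightarrow> real" where
  "cond_var_dev n i j =
     (\<integral>\<omega>. \<bar>real_cond_exp M (sigma_without M X n i j) (\<lambda>\<omega>. (X i j \<omega>)\<^sup>2) \<omega> - (\<sigma> i j)\<^sup>2\<bar> \<partial>M)"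

definition tail_moment :: "nat \<Rightarrow> real \<Rightarrow> nat \<Rightarrow> nat \<Rightarrow> real" where
  "tail_moment n \<tau> i j = (\<integral>\<omega>. \<bar>X i j \<omega>\<bar>\<^sup>2 * indicator {\<omega>. \<bar>X i j \<omega>\<bar> \<ge> \<tau> * sqrt (real n)} \<omega> \<partial>M)"

lemma X_commute: "1 \<le> i \<Longrightarrow> 1 \<le> j \<Longrightarrow> X i j = X j i"
  using X_symm by (cases i j rule: linorder_cases) auto

lemma sigma_commute: "1 \<le> i \<Longrightarrow> 1 \<le> j \<Longrightarrow> \<sigma> i j = \<sigma> j i"
  using sigma_symm by (cases i j rule: linorder_cases) auto

lemma X_measurable: "1 \<le> i \<Longrightarrow> 1 \<le> j \<Longrightarrow> X i j \<in> borel_measurable M"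
  using rv[of i j] rv[of j i] X_commute[of i j] by (cases "i \<le> j") auto

lemma X_sq_integrable: "1 \<le> i \<Longrightarrow> 1 \<le> j \<Longrightarrow> integrable M (\<lambda>\<omega>. (X i j \<omega>)\<^sup>2)"
  using sq_integrable[of i j] sq_integrable[of j i] X_commute[of i j] by (cases "i \<le> j") auto

lemma X_variance: "1 \<le> i \<Longrightarrow> 1 \<le> j \<Longrightarrow> (\<integral>\<omega>. (X i j \<omega>)\<^sup>2 \<partial>M) = (\<sigma> i j)\<^sup>2"
  using var[of i j] var[of j i] X_commute[of i j] sigma_commute[of i j] by (cases "i \<le> j") auto

lemma sigma_without_commute: "sigma_without M X n i j = sigma_without M X n j i"
  by (simp add: sigma_without_def min.commute max.commute)

lemma X_cond_mean:
  assumes "i \<in> {1..n}" "j \<in> {1..n}"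
  shows "AE \<omega> in M. real_cond_exp M (sigma_without M X n i j) (X i j) \<omega> = 0"
proof (cases "i \<le> j")
  case False
  then show ?thesis
    using cond_mean[of j i n] assms X_commute[of i j] by (simp add: sigma_without_commute[of n i j])
qed (use cond_mean assms in auto)

lemma W_symmetric: "symmetric_upto n (W n \<omega>)"
  using X_commute by (auto simp: symmetric_upto_def W_def)

lemma W0_symmetric: "symmetric_upto n (W0 n p q \<omega>)"
  using W_symmetric[of n \<omega>] by (auto simp: symmetric_upto_def W0_def)

lemma G_measurable:
  assumes "i \<in> {1..n}" "j \<in> {1..n}"
  shows "(\<lambda>\<omega>. G n z \<omega> i j) \<in> borel_measurable M"
  by (rule borel_measurable_resolvent[OF _ assms]) (use X_measurable in \<open>auto simp: W_def\<close>)

lemma X_measurable_sigma_without: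
  assumes "1 \<le> k" "k \<le> l" "l \<le> n" "(k, l) \<noteq> (min p q, max p q)"
  shows "X k l \<in> borel_measurable (sigma_without M X n p q)"
proof (rule measurableI)
  fix B :: "real set" assume B: "B \<in> sets borel"
  show "X k l -` B \<inter> space (sigma_without M X n p q) \<in> sets (sigma_without M X n p q)"
    unfolding sigma_without_def space_measure_of_conv
    by (subst sets_measure_of) (use assms B in \<open>auto intro!: sigma_sets.Basic\<close>)
qed simp

text \<open>After clearing, only entries that generate \<open>sigma_without\<close> remain. The
  passage through \<open>min\<close> and \<open>max\<close> is needed because the generators are
  entries of the upper triangle.\<close>

lemma G0_measurable:
  assumes "i \<in> {1..n}" "j \<in> {1..n}" and pq: "p \<in> {1..n}" "q \<in> {1..n}"
  shows "(\<lambda>\<omega>. resolvent n (W0 n p q \<omega>) z i j) \<in> borel_measurable (sigma_without M X n p q)"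
proof (rule borel_measurable_resolvent[OF _ assms(1,2)])
  fix k l assume kl: "k \<in> {1..n}" "l \<in> {1..n}"
  show "(\<lambda>\<omega>. W0 n p q \<omega> k l) \<in> borel_measurable (sigma_without M X n p q)"
  proof (cases "k = p \<and> l = q \<or> k = q \<and> l = p")
    case False
    have "X (min k l) (max k l) \<in> borel_measurable (sigma_without M X n p q)"
      using False kl pq by (intro X_measurable_sigma_without) (auto simp: min_def max_def split: if_splits)
    moreover have "X (min k l) (max k l) = X k l"
      using kl X_commute by (auto simp: min_def max_def)
    ultimately have "(\<lambda>\<omega>. X k l \<omega> / sqrt n) \<in> borel_measurable (sigma_without M X n p q)" by simp
    moreover have "(\<lambda>\<omega>. W0 n p q \<omega> k l) = (\<lambda>\<omega>. X k l \<omega> / sqrt n)"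
      using False by (auto simp: W0_def W_def)
    ultimately show ?thesis by simp
  qed (simp add: W0_def)
qed

lemma borel_measurable_defects:
  assumes "\<And>a b. a \<in> {1..n} \<Longrightarrow> b \<in> {1..n} \<Longrightarrow> (\<lambda>\<omega>. H \<omega> a b) \<in> borel_measurable N"
    and "i \<in> {1..n}" "j \<in> {1..n}"
  shows "(\<lambda>\<omega>. defect n z T (H \<omega>) i) \<in> borel_measurable N"
    "(\<lambda>\<omega>. ddefect n z T (H \<omega>) i j) \<in> borel_measurable N"
    "(\<lambda>\<omega>. dres (H \<omega>) i j i j) \<in> borel_measurable N"
  unfolding defect_def ddefect_def dres_def
  using assms by (auto intro!: borel_measurable_add borel_measurable_times borel_measurable_sum borel_measurable_uminus)

lemma defect_expansion:
  assumes z: "Im z \<ge> 1" and i: "i \<in> {1..n}"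
  shows "D n z \<omega> i = (\<Sum>j=1..n. of_real (W n \<omega> i j) * G n z \<omega> i j + of_real (S n i j) * (G n z \<omega> i i * G n z \<omega> j j))"
proof -
  have "(\<Sum>j=1..n. of_real (W n \<omega> i j) * G n z \<omega> i j) = (\<Sum>k=1..n. of_real (W n \<omega> i k) * G n z \<omega> k i)"
    using resolvent_symmetric[OF W_symmetric _ i, of z] z by (intro sum.cong) auto
  also have "\<dots> = z * G n z \<omega> i i + 1"
    using resolvent_eq[OF W_symmetric _ i i, of z] z by simp
  finally show ?thesis
    by (simp add: defect_def sum.distrib sum_distrib_left mult_ac)
qed

text \<open>Each \<open>W i j\<close> multiplies the function \<open>f j\<close> of the matrix, to
  which \<open>second_order_expansion\<close> applies with derivative \<open>f' j\<close>. This
  derivative and the counterterm of \<open>D i\<close> both carry the weight \<open>S n i j\<close>;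
  their sum is \<open>h j\<close>.\<close>

lemma defect_second_moment:
  assumes z: "Im z \<ge> 1" and i: "i \<in> {1..n}" and C: "(\<Sum>k=1..n. S n i k) \<le> C" and \<tau>: "0 < \<tau>" "\<tau> \<le> 1"
  shows "(\<integral>\<omega>. (cmod (D n z \<omega> i))\<^sup>2 \<partial>M) \<le>
     (\<Sum>j=1..n. 32 * defect_const z C / n * (cond_var_dev n i j + 2 * \<tau> * (\<sigma> i j)\<^sup>2 + 6 * tail_moment n \<tau> i j)
        + S n i j * (2 * defect_const z C * (\<integral>\<omega>. cmod (G n z \<omega> i j) \<partial>M)))"
proof -
  define K where "K = defect_const z C"
  have n: "0 < real n" using i by auto
  have S0: "0 \<le> S n k l" for k l by (simp add: S_def)
  define f where "f = (\<lambda>j \<omega>. G n z \<omega> i j * cnj (D n z \<omega> i))"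
  define f' where "f' = (\<lambda>j \<omega>. dres (G n z \<omega>) i j i j * cnj (D n z \<omega> i)
     + G n z \<omega> i j * cnj (ddefect n z (S n) (G n z \<omega>) i j))"
  define h where "h = (\<lambda>j \<omega>. f' j \<omega> + G n z \<omega> i i * G n z \<omega> j j * cnj (D n z \<omega> i))"
  have dif: "W n \<omega> k l - W0 n i j \<omega> k l = (if k = i \<and> l = j \<or> k = j \<and> l = i then X i j \<omega> / sqrt n else 0)"
    if "j \<in> {1..n}" "k \<in> {1..n}" "l \<in> {1..n}" for \<omega> j k l
    using that i X_commute by (auto simp: W0_def W_def)
  have J1: "jet K (X i j \<omega> / sqrt n) (D n z \<omega> i) (ddefect n z (S n) (G n z \<omega>) i j)
      (defect n z (S n) (resolvent n (W0 n i j \<omega>) z) i) (ddefect n z (S n) (resolvent n (W0 n i j \<omega>) z) i j)"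
    and J2: "jet (32 * K) (X i j \<omega> / sqrt n) (f j \<omega>) (f' j \<omega>)
       (resolvent n (W0 n i j \<omega>) z i j * cnj (defect n z (S n) (resolvent n (W0 n i j \<omega>) z) i))
       (dres (resolvent n (W0 n i j \<omega>) z) i j i j * cnj (defect n z (S n) (resolvent n (W0 n i j \<omega>) z) i)
        + resolvent n (W0 n i j \<omega>) z i j * cnj (ddefect n z (S n) (resolvent n (W0 n i j \<omega>) z) i j))"
    if j: "j \<in> {1..n}" for j \<omega>
    unfolding K_def f_def f'_def
    using jet_defect[where A = "W n \<omega>" and ?A0.0 = "W0 n i j \<omega>" and x = "X i j \<omega> / sqrt n" and S = "S n" and C = C,
        OF W_symmetric W0_symmetric z i j dif[OF j] S0 C] by blast+
  note mG = G_measurable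
  note mD = borel_measurable_defects[where H = "G n z", OF mG i]
  have mf: "f j \<in> borel_measurable M" "f' j \<in> borel_measurable M" "h j \<in> borel_measurable M" if "j \<in> {1..n}" for j
    unfolding f_def f'_def h_def using mG[OF i] mG mD i that
    by (auto intro!: borel_measurable_times borel_measurable_add borel_measurable_cnj)
  have bD: "cmod (D n z \<omega> i) \<le> K" "cmod (ddefect n z (S n) (G n z \<omega>) i j) \<le> K" if "j \<in> {1..n}" for j \<omega>
    using J1[OF that, of \<omega>] by (auto simp: jet_def)
  have bG: "cmod (G n z \<omega> a b) \<le> 1" if "a \<in> {1..n}" "b \<in> {1..n}" for a b \<omega>
    using resolvent_bounds(2)[OF W_symmetric z that] .
  have bf: "cmod (f j \<omega>) \<le> 32 * K" "cmod (f' j \<omega>) \<le> 32 * K" if "j \<in> {1..n}" for j \<omega>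
    using J2[OF that, of \<omega>] by (auto simp: jet_def)
  have if': "integrable M (f' j)" if "j \<in> {1..n}" for j
    using bf(2)[OF that] mf(2)[OF that] by (intro integrable_const_bound[of _ "32 * K"]) auto
  \<comment> \<open>In \<open>h j\<close> the product \<open>G i i * G j j\<close> cancels, and every remaining term contains the off-diagonal factor
    \<open>G i j\<close>, which is small on average.\<close>
  have bh: "cmod (h j \<omega>) \<le> 2 * K * cmod (G n z \<omega> i j)" if j: "j \<in> {1..n}" for j \<omega>
  proof -
    define c :: complex where "c = (if i = j then 0 else 1)"
    define u where "u = cnj (D n z \<omega> i)"
    define v where "v = cnj (ddefect n z (S n) (G n z \<omega>) i j)"
    define g where "g = (\<lambda>a b. G n z \<omega> a b)"
    have uv: "cmod u \<le> K" "cmod v \<le> K" using bD[OF j, of \<omega>] by (simp_all add: u_def v_def)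
    have "h j \<omega> = - (g i i * g j j + c * (g i j * g i j)) * u + g i j * v + g i i * g j j * u"
      unfolding h_def f'_def dres_def c_def u_def v_def g_def by (rule refl)
    also have "\<dots> = g i j * (v - c * g i j * u)" by (simp add: algebra_simps)
    finally have h: "h j \<omega> = g i j * (v - c * g i j * u)" .
    have "cmod c * cmod (g i j) \<le> 1 * 1" using bG[OF i j] by (intro mult_mono) (auto simp: c_def g_def)
    then have "cmod (c * g i j * u) \<le> 1 * K"
      unfolding norm_mult using uv(1) by (intro mult_mono) auto
    then have "cmod (v - c * g i j * u) \<le> K + K"
      using uv(2) norm_triangle_ineq4[of v "c * g i j * u"] by linarith
    then have "cmod (g i j) * cmod (v - c * g i j * u) \<le> cmod (g i j) * (K + K)"
      by (rule mult_left_mono) simp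
    then show ?thesis unfolding h norm_mult by (simp add: g_def mult_ac)
  qed
  have iG: "integrable M (\<lambda>\<omega>. cmod (G n z \<omega> i j))" if "j \<in> {1..n}" for j
    using mG[OF i that] bG[OF i that] by (intro integrable_const_bound[of _ 1]) auto
  have H: "integrable M (h j)" "cmod (\<integral>\<omega>. h j \<omega> \<partial>M) \<le> 2 * K * (\<integral>\<omega>. cmod (G n z \<omega> i j) \<partial>M)" if j: "j \<in> {1..n}" for j
  proof -
    have "integrable M (\<lambda>\<omega>. 2 * K * cmod (G n z \<omega> i j))" using iG[OF j] by simp
    note * = integral_norm_bound_complex[OF mf(3)[OF j] this bh[OF j]]
    show "integrable M (h j)" using *(1) .
    show "cmod (\<integral>\<omega>. h j \<omega> \<partial>M) \<le> 2 * K * (\<integral>\<omega>. cmod (G n z \<omega> i j) \<partial>M)" using *(2) by simp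
  qed
  have iWf: "integrable M (\<lambda>\<omega>. of_real (X i j \<omega> / sqrt n) * f j \<omega>)" if j: "j \<in> {1..n}" for j
  proof -
    have "integrable M (X i j)"
      using square_integrable_imp_integrable[OF X_measurable X_sq_integrable] i j by simp
    then show ?thesis
      using mf(1)[OF j] bf(1)[OF j] by (intro integrable_complex_mult_bounded) auto
  qed
  have E: "cmod ((\<integral>\<omega>. of_real (X i j \<omega> / sqrt n) * f j \<omega> \<partial>M) - of_real (S n i j) * (\<integral>\<omega>. f' j \<omega> \<partial>M))
    \<le> 32 * K / n * (cond_var_dev n i j + 2 * \<tau> * (\<sigma> i j)\<^sup>2 + 6 * tail_moment n \<tau> i j)" if j: "j \<in> {1..n}" for j
  proof -
    have ij: "1 \<le> i" "1 \<le> j" using i j by auto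
    note m0 = G0_measurable[OF _ _ i j, of _ _ z]
    note d0 = borel_measurable_defects[OF m0 i j]
    let ?R = "\<lambda>\<omega>. resolvent n (W0 n i j \<omega>) z"
    have m: "(\<lambda>\<omega>. ?R \<omega> i j * cnj (defect n z (S n) (?R \<omega>) i)) \<in> borel_measurable (sigma_without M X n i j)"
      "(\<lambda>\<omega>. dres (?R \<omega>) i j i j * cnj (defect n z (S n) (?R \<omega>) i) + ?R \<omega> i j * cnj (ddefect n z (S n) (?R \<omega>) i j))
         \<in> borel_measurable (sigma_without M X n i j)"
      using m0[OF i j] d0 by (auto intro!: borel_measurable_times borel_measurable_add borel_measurable_cnj)
    have F: "subalgebra M (sigma_without M X n i j)" by (rule subalgebra_sigma_without) (rule rv)
    show ?thesis
      using second_order_expansion[OF F X_measurable[OF ij] X_sq_integrable[OF ij]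
          X_cond_mean[OF i j] mf(1,2)[OF j] m n \<tau> J2[OF j] X_variance[OF ij, symmetric] refl refl]
      unfolding cond_var_dev_def tail_moment_def S_def .
  qed
  \<comment> \<open>Here \<open>S n i j * f' j\<close> is subtracted and added: the bracket is
    exactly what \<open>E\<close> estimates, and the added term joins the counterterm in
    \<open>h j\<close>.\<close>
  have "complex_of_real (\<integral>\<omega>. (cmod (D n z \<omega> i))\<^sup>2 \<partial>M)
      = (\<integral>\<omega>. (\<Sum>j=1..n. (of_real (X i j \<omega> / sqrt n) * f j \<omega> - of_real (S n i j) * f' j \<omega>) + of_real (S n i j) * h j \<omega>) \<partial>M)"
    unfolding integral_complex_of_real[symmetric]
  proof (intro Bochner_Integration.integral_cong refl)
    fix \<omega>
    have "complex_of_real ((cmod (D n z \<omega> i))\<^sup>2) = D n z \<omega> i * cnj (D n z \<omega> i)"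
      by (rule complex_norm_square)
    also have "\<dots> = (\<Sum>j=1..n. of_real (W n \<omega> i j) * G n z \<omega> i j + of_real (S n i j) * (G n z \<omega> i i * G n z \<omega> j j)) * cnj (D n z \<omega> i)"
      by (subst defect_expansion[OF z i]) simp
    also have "\<dots> = (\<Sum>j=1..n. (of_real (X i j \<omega> / sqrt n) * f j \<omega> - of_real (S n i j) * f' j \<omega>) + of_real (S n i j) * h j \<omega>)"
      unfolding sum_distrib_right by (intro sum.cong refl) (simp add: f_def h_def W_def algebra_simps)
    finally show "complex_of_real ((cmod (D n z \<omega> i))\<^sup>2) = \<dots>" .
  qed
  also have "\<dots> = (\<Sum>j=1..n. ((\<integral>\<omega>. of_real (X i j \<omega> / sqrt n) * f j \<omega> \<partial>M) - of_real (S n i j) * (\<integral>\<omega>. f' j \<omega> \<partial>M))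
       + of_real (S n i j) * (\<integral>\<omega>. h j \<omega> \<partial>M))"
  proof -
    have i: "integrable M (\<lambda>\<omega>. of_real (X i j \<omega> / sqrt n) * f j \<omega> - of_real (S n i j) * f' j \<omega>)"
      "integrable M (\<lambda>\<omega>. complex_of_real (S n i j) * h j \<omega>)" if "j \<in> {1..n}" for j
      using iWf[OF that] if'[OF that] H(1)[OF that] by simp_all
    show ?thesis
      by (subst Bochner_Integration.integral_sum, use i in simp, rule sum.cong[OF refl],
          subst Bochner_Integration.integral_add, use i in simp, use i in simp)
        (subst Bochner_Integration.integral_diff[OF iWf], simp, use if' in simp, simp)
  qed
  finally have eq: "complex_of_real (\<integral>\<omega>. (cmod (D n z \<omega> i))\<^sup>2 \<partial>M) = \<dots>" .
  have "(\<integral>\<omega>. (cmod (D n z \<omega> i))\<^sup>2 \<partial>M) \<le> cmod (complex_of_real (\<integral>\<omega>. (cmod (D n z \<omega> i))\<^sup>2 \<partial>M))"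
    by simp
  also have "\<dots> \<le> (\<Sum>j=1..n. 32 * K / n * (cond_var_dev n i j + 2 * \<tau> * (\<sigma> i j)\<^sup>2 + 6 * tail_moment n \<tau> i j)
        + S n i j * (2 * K * (\<integral>\<omega>. cmod (G n z \<omega> i j) \<partial>M)))"
    unfolding eq
  proof (intro order_trans[OF norm_sum] sum_mono order_trans[OF norm_triangle_ineq] add_mono E)
    fix j assume j: "j \<in> {1..n}"
    show "cmod (of_real (S n i j) * (\<integral>\<omega>. h j \<omega> \<partial>M)) \<le> S n i j * (2 * K * (\<integral>\<omega>. cmod (G n z \<omega> i j) \<partial>M))"
      unfolding norm_mult norm_of_real
      using H(2)[OF j] S0[of i j] by (simp add: mult_left_mono)
  qed
  finally show ?thesis by (simp add: K_def)
qed

end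

section \<open>Averaging the defects over all rows\<close>

context martingale_array
begin

text \<open>This is how the Lindeberg condition yields smallness of the variances: no single one is
  assumed small compared with n, but their excess over \<open>\<tau>\<^sup>2 * n\<close> is small on
  average.\<close>

lemma variance_le_tail:
  assumes "i \<in> {1..n}" "j \<in> {1..n}" "0 < \<tau>"
  shows "(\<sigma> i j)\<^sup>2 \<le> \<tau>\<^sup>2 * n + tail_moment n \<tau> i j" "0 \<le> tail_moment n \<tau> i j"
proof -
  have ij: "1 \<le> i" "1 \<le> j" using assms by auto
  have t: "0 \<le> \<tau> * sqrt n" using assms by simp
  note * = truncated_second_moment[OF X_measurable[OF ij] X_sq_integrable[OF ij] t]
  show "(\<sigma> i j)\<^sup>2 \<le> \<tau>\<^sup>2 * n + tail_moment n \<tau> i j" "0 \<le> tail_moment n \<tau> i j"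
    using *(3,4) X_variance[OF ij] by (simp_all add: tail_moment_def power_mult_distrib)
qed

lemma lindeberg_fraction_eq:
  "lindeberg_fraction M X n \<tau> = 1 / (real n)\<^sup>2 * (\<Sum>i=1..n. \<Sum>j=1..n. tail_moment n \<tau> i j)"
  by (simp add: lindeberg_fraction_def tail_moment_def)

text \<open>With \<open>g\<close> the modulus of an entry,
  \<open>g \<le> \<tau> + g\<^sup>2 / \<tau>\<close>. The first part is summed with the row sums of
  \<open>S\<close>. In the second, \<open>S n i j\<close> is bounded by
  \<open>\<tau>\<^sup>2\<close> plus a tail; the squares sum to at most 1 per column by the Ward
  bound, and \<open>g \<le> 1\<close> handles the tail.\<close>

lemma weighted_resolvent_sum:
  assumes z: "Im z \<ge> 1" and n: "0 < n" and C: "\<And>i. i \<in> {1..n} \<Longrightarrow> (\<Sum>k=1..n. S n i k) \<le> C" and \<tau>: "0 < \<tau>"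
  shows "(\<Sum>i=1..n. \<Sum>j=1..n. S n i j * cmod (G n z \<omega> i j))
     \<le> n * (\<tau> * C + \<tau> + lindeberg_fraction M X n \<tau> / \<tau>)"
proof -
  have "(\<Sum>i=1..n. \<Sum>j=1..n. S n i j * cmod (G n z \<omega> i j))
     \<le> (\<Sum>i=1..n. \<Sum>j=1..n. \<tau> * S n i j + \<tau> * (cmod (G n z \<omega> i j))\<^sup>2 + tail_moment n \<tau> i j / (n * \<tau>))"
  proof (intro sum_mono)
    fix i j assume ij: "i \<in> {1..n}" "j \<in> {1..n}"
    define g where "g = cmod (G n z \<omega> i j)"
    have g: "0 \<le> g" "g \<le> 1" using resolvent_bounds(2)[OF W_symmetric z ij] by (auto simp: g_def)
    have S0: "0 \<le> S n i j" by (simp add: S_def)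
    note v = variance_le_tail[OF ij \<tau>]
    \<comment> \<open>Expands to the sum of both squares minus \<open>g * \<tau>\<close>, which is
      the wanted inequality after division by \<open>\<tau>\<close>.\<close>
    have "0 \<le> (g - \<tau>)\<^sup>2 + g * \<tau>" using g \<tau> by simp
    then have "g * \<tau> \<le> \<tau>\<^sup>2 + g\<^sup>2" by (simp add: power2_eq_square algebra_simps)
    then have "g \<le> \<tau> + g\<^sup>2 / \<tau>" using \<tau> by (simp add: field_simps power2_eq_square)
    then have 1: "S n i j * g \<le> S n i j * (\<tau> + g\<^sup>2 / \<tau>)" using S0 by (rule mult_left_mono)
    have "S n i j \<le> \<tau>\<^sup>2 + tail_moment n \<tau> i j / n" using v n by (simp add: S_def field_simps)
    then have "S n i j * g\<^sup>2 \<le> (\<tau>\<^sup>2 + tail_moment n \<tau> i j / n) * g\<^sup>2" by (rule mult_right_mono) simp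
    also have "\<dots> \<le> \<tau>\<^sup>2 * g\<^sup>2 + tail_moment n \<tau> i j / n"
      using v(2) g mult_left_le[of "g\<^sup>2" "tail_moment n \<tau> i j / n"] by (simp add: distrib_right power_le_one)
    finally have "S n i j * g\<^sup>2 / \<tau> \<le> (\<tau>\<^sup>2 * g\<^sup>2 + tail_moment n \<tau> i j / n) / \<tau>" using \<tau> by (simp add: divide_right_mono)
    also have "\<dots> = \<tau> * g\<^sup>2 + tail_moment n \<tau> i j / (n * \<tau>)" using \<tau> by (simp add: add_divide_distrib power2_eq_square)
    finally show "S n i j * g \<le> \<tau> * S n i j + \<tau> * g\<^sup>2 + tail_moment n \<tau> i j / (n * \<tau>)"
      using 1 by (simp add: distrib_left mult.commute)
  qed
  also have "\<dots> = \<tau> * (\<Sum>i=1..n. \<Sum>j=1..n. S n i j) + \<tau> * (\<Sum>i=1..n. \<Sum>j=1..n. (cmod (G n z \<omega> i j))\<^sup>2)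
      + (\<Sum>i=1..n. \<Sum>j=1..n. tail_moment n \<tau> i j) / (n * \<tau>)"
    by (simp only: sum.distrib sum_distrib_left sum_divide_distrib)
  also have "\<dots> \<le> \<tau> * (n * C) + \<tau> * (n * 1) + (\<Sum>i=1..n. \<Sum>j=1..n. tail_moment n \<tau> i j) / (n * \<tau>)"
  proof -
    have "(\<Sum>i=1..n. \<Sum>j=1..n. S n i j) \<le> n * C"
      using sum_bounded_above[of "{1..n}" "\<lambda>i. \<Sum>j=1..n. S n i j" C] C by simp
    moreover have "(\<Sum>i=1..n. \<Sum>j=1..n. (cmod (G n z \<omega> i j))\<^sup>2) \<le> n * 1"
      using sum_bounded_above[of "{1..n}" "\<lambda>j. \<Sum>i=1..n. (cmod (G n z \<omega> i j))\<^sup>2" 1]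
        resolvent_bounds(1)[OF W_symmetric z] by (subst sum.swap) simp
    ultimately show ?thesis using \<tau> by (intro add_mono mult_left_mono) auto
  qed
  also have "\<dots> = n * (\<tau> * C + \<tau> + lindeberg_fraction M X n \<tau> / \<tau>)"
    using n by (simp add: lindeberg_fraction_eq field_simps power2_eq_square)
  finally show ?thesis .
qed

lemma average_defect_bound:
  assumes z: "Im z \<ge> 1" and n: "0 < n" and C: "\<And>i. i \<in> {1..n} \<Longrightarrow> (\<Sum>k=1..n. S n i k) \<le> C" and \<tau>: "0 < \<tau>" "\<tau> \<le> 1"
  shows "1 / n * (\<Sum>i=1..n. \<integral>\<omega>. (cmod (D n z \<omega> i))\<^sup>2 \<partial>M)
     \<le> 32 * defect_const z C * (1 / (real n)\<^sup>2 * (\<Sum>i=1..n. \<Sum>j=1..n. cond_var_dev n i j) + 2 * \<tau> * C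
             + 6 * lindeberg_fraction M X n \<tau>)
        + 2 * defect_const z C * (\<tau> * C + \<tau> + lindeberg_fraction M X n \<tau> / \<tau>)"
proof -
  define K where "K = defect_const z C"
  have S0: "0 \<le> S n k l" for k l by (simp add: S_def)
  have C0: "0 \<le> C" using C[of 1] n sum_nonneg[of "{1..n}" "S n 1"] S0 by force
  have K0: "0 \<le> K" using C0 by (simp add: K_def defect_const_def)
  define A where "A = (\<Sum>i=1..n. \<Sum>j=1..n. cond_var_dev n i j)"
  define B where "B = (\<Sum>i=1..n. \<Sum>j=1..n. S n i j)"
  define L where "L = (\<Sum>i=1..n. \<Sum>j=1..n. tail_moment n \<tau> i j)"
  define Q where "Q = (\<Sum>i=1..n. \<Sum>j=1..n. S n i j * (\<integral>\<omega>. cmod (G n z \<omega> i j) \<partial>M))"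
  have iG: "integrable M (\<lambda>\<omega>. cmod (G n z \<omega> i j))" if "i \<in> {1..n}" "j \<in> {1..n}" for i j
    using G_measurable[OF that] resolvent_bounds(2)[OF W_symmetric z that]
    by (intro integrable_const_bound[of _ 1]) auto
  have "Q = (\<integral>\<omega>. (\<Sum>i=1..n. \<Sum>j=1..n. S n i j * cmod (G n z \<omega> i j)) \<partial>M)"
    unfolding Q_def using iG
    by (subst Bochner_Integration.integral_sum, force intro!: Bochner_Integration.integrable_sum, intro sum.cong refl,
        subst Bochner_Integration.integral_sum) auto
  also have "\<dots> \<le> (\<integral>\<omega>. n * (\<tau> * C + \<tau> + lindeberg_fraction M X n \<tau> / \<tau>) \<partial>M)"
    using iG by (intro integral_mono weighted_resolvent_sum z n C \<tau>(1)) (auto intro!: Bochner_Integration.integrable_sum)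
  finally have Q: "Q \<le> n * (\<tau> * C + \<tau> + lindeberg_fraction M X n \<tau> / \<tau>)" by (simp add: prob_space)
  have B: "B \<le> n * C" unfolding B_def using sum_bounded_above[of "{1..n}" "\<lambda>i. \<Sum>j=1..n. S n i j" C] C by simp
  have "(\<Sum>i=1..n. \<integral>\<omega>. (cmod (D n z \<omega> i))\<^sup>2 \<partial>M)
     \<le> (\<Sum>i=1..n. \<Sum>j=1..n. 32 * K / n * (cond_var_dev n i j + 2 * \<tau> * (\<sigma> i j)\<^sup>2 + 6 * tail_moment n \<tau> i j)
        + S n i j * (2 * K * (\<integral>\<omega>. cmod (G n z \<omega> i j) \<partial>M)))"
    unfolding K_def by (intro sum_mono defect_second_moment z C \<tau>)
  also have "\<dots> = (\<Sum>i=1..n. \<Sum>j=1..n. 32 * K / n * cond_var_dev n i j + 64 * K * \<tau> * S n i j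
        + 192 * K / n * tail_moment n \<tau> i j + 2 * K * (S n i j * (\<integral>\<omega>. cmod (G n z \<omega> i j) \<partial>M)))"
    using n by (intro sum.cong refl) (simp add: S_def field_simps)
  also have "\<dots> = 32 * K / n * A + 64 * K * \<tau> * B + 192 * K / n * L + 2 * K * Q"
    by (simp only: sum.distrib sum_distrib_left[symmetric] A_def B_def L_def Q_def)
  also have "\<dots> \<le> 32 * K / n * A + 64 * K * \<tau> * (n * C) + 192 * K / n * L
       + 2 * K * (n * (\<tau> * C + \<tau> + lindeberg_fraction M X n \<tau> / \<tau>))"
    using K0 \<tau> B Q by (intro add_mono mult_left_mono order_refl) auto
  finally have "1 / n * (\<Sum>i=1..n. \<integral>\<omega>. (cmod (D n z \<omega> i))\<^sup>2 \<partial>M) \<le> 1 / n * \<dots>"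
    by (rule mult_left_mono) simp
  also have "\<dots> = 32 * K * (1 / (real n)\<^sup>2 * A + 2 * \<tau> * C + 6 * lindeberg_fraction M X n \<tau>)
        + 2 * K * (\<tau> * C + \<tau> + lindeberg_fraction M X n \<tau> / \<tau>)"
    unfolding lindeberg_fraction_eq L_def[symmetric] using n \<tau> by (simp add: field_simps power2_eq_square)
  finally show ?thesis by (simp add: K_def A_def)
qed

text \<open>Order of limits: n tends to infinity for a fixed truncation level \<open>\<tau>\<close>,
  which leaves a multiple of \<open>\<tau>\<close>; then \<open>\<tau>\<close> is chosen small. The
  term \<open>L / \<tau>\<close> is harmless because \<open>\<tau>\<close> does not depend on
  n.\<close>

lemma average_defect_tendsto_0:
  assumes z: "Im z \<ge> 1" and C: "\<And>n i. i \<in> {1..n} \<Longrightarrow> (\<Sum>k=1..n. S n i k) \<le> C"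
    and b: "(\<lambda>n. 1 / (real n)\<^sup>2 * (\<Sum>i=1..n. \<Sum>j=1..n. cond_var_dev n i j)) \<longlonglongrightarrow> 0"
    and c: "\<And>\<tau>. \<tau> > 0 \<Longrightarrow> (\<lambda>n. lindeberg_fraction M X n \<tau>) \<longlonglongrightarrow> 0"
  shows "(\<lambda>n. 1 / n * (\<Sum>i=1..n. \<integral>\<omega>. (cmod (D n z \<omega> i))\<^sup>2 \<partial>M)) \<longlonglongrightarrow> 0"
proof (rule LIMSEQ_I)
  fix r :: real assume r: "0 < r"
  define K where "K = defect_const z C"
  have S0: "0 \<le> S n k l" for n k l by (simp add: S_def)
  have C0: "0 \<le> C" using C[of 1 1] S0[of 1 1 1] by simp
  have K0: "0 \<le> K" using C0 by (simp add: K_def defect_const_def)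
  \<comment> \<open>The coefficient of \<open>\<tau>\<close> that survives in
    \<open>average_defect_bound\<close> when both averaged hypotheses have reached 0.\<close>
  define Q where "Q = 64 * K * C + 2 * K * C + 2 * K"
  have Q0: "0 \<le> Q" using K0 C0 by (simp add: Q_def)
  define \<tau> where "\<tau> = min 1 (r / (2 * (Q + 1)))"
  have \<tau>: "0 < \<tau>" "\<tau> \<le> 1" using r Q0 by (auto simp: \<tau>_def)
  have "Q * \<tau> \<le> Q * (r / (2 * (Q + 1)))" using Q0 by (intro mult_left_mono) (auto simp: \<tau>_def)
  also have "\<dots> < r" using Q0 r by (simp add: field_simps add_strict_increasing)
  finally have Q\<tau>: "Q * \<tau> < r" .
  let ?b = "\<lambda>n. 1 / (real n)\<^sup>2 * (\<Sum>i=1..n. \<Sum>j=1..n. cond_var_dev n i j)" and ?L = "\<lambda>n. lindeberg_fraction M X n \<tau>"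
  have "(\<lambda>n. 32 * K * (?b n + 2 * \<tau> * C + 6 * ?L n) + 2 * K * (\<tau> * C + \<tau> + ?L n / \<tau>))
      \<longlonglongrightarrow> 32 * K * (0 + 2 * \<tau> * C + 6 * 0) + 2 * K * (\<tau> * C + \<tau> + 0 / \<tau>)"
    using \<tau> by (intro tendsto_intros b c) auto
  also have "32 * K * (0 + 2 * \<tau> * C + 6 * 0) + 2 * K * (\<tau> * C + \<tau> + 0 / \<tau>) = Q * \<tau>"
    by (simp add: Q_def algebra_simps)
  finally have "\<forall>\<^sub>F n in sequentially. 32 * K * (?b n + 2 * \<tau> * C + 6 * ?L n) + 2 * K * (\<tau> * C + \<tau> + ?L n / \<tau>) < r"
    using Q\<tau> by (rule order_tendstoD)
  then obtain N where N: "\<And>n. n \<ge> N \<Longrightarrow> 32 * K * (?b n + 2 * \<tau> * C + 6 * ?L n) + 2 * K * (\<tau> * C + \<tau> + ?L n / \<tau>) < r"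
    by (auto simp: eventually_sequentially)
  show "\<exists>no. \<forall>n\<ge>no. norm (1 / n * (\<Sum>i=1..n. \<integral>\<omega>. (cmod (D n z \<omega> i))\<^sup>2 \<partial>M) - 0) < r"
  proof (intro exI allI impI)
    fix n assume n: "max 1 N \<le> n"
    have "0 \<le> 1 / n * (\<Sum>i=1..n. \<integral>\<omega>. (cmod (D n z \<omega> i))\<^sup>2 \<partial>M)"
      by (intro mult_nonneg_nonneg sum_nonneg integral_nonneg_AE AE_I2) auto
    moreover have "1 / n * (\<Sum>i=1..n. \<integral>\<omega>. (cmod (D n z \<omega> i))\<^sup>2 \<partial>M) < r"
      using average_defect_bound[OF z _ C \<tau>, of n] N[of n] n by (auto simp: K_def)
    ultimately show "norm (1 / n * (\<Sum>i=1..n. \<integral>\<omega>. (cmod (D n z \<omega> i))\<^sup>2 \<partial>M) - 0) < r" by simp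
  qed
qed

end

text \<open>Subtracting the equation for \<open>m\<close> from that for \<open>G i i\<close>
  isolates \<open>(z + T i) * (G i i - m)\<close>. The factor \<open>z + T i\<close> has modulus at
  least \<open>C + 1\<close>, whereas the coupling through \<open>S\<close> has l1 norm at most
  \<open>C\<close>. The bound \<open>2 * C + 1\<close> on \<open>Im z\<close> is chosen to leave a
  gap of exactly 1 between the two.\<close>

lemma self_consistent_stability:
  fixes G :: "nat \<Rightarrow> nat \<Rightarrow> complex" and S :: "nat \<Rightarrow> nat \<Rightarrow> real"
  assumes G: "\<And>i. i \<in> {1..n} \<Longrightarrow> cmod (G i i) \<le> 1"
    and S: "\<And>i j. 0 \<le> S i j" "\<And>i j. i \<in> {1..n} \<Longrightarrow> j \<in> {1..n} \<Longrightarrow> S i j = S j i"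
    and C: "\<And>i. i \<in> {1..n} \<Longrightarrow> (\<Sum>k=1..n. S i k) \<le> C"
    and z: "Im z \<ge> 2 * C + 1" and m: "cmod m \<le> 1" "m\<^sup>2 + z * m + 1 = 0"
  shows "(\<Sum>i=1..n. cmod (G i i - m)) \<le> (\<Sum>i=1..n. cmod (defect n z S G i)) + (\<Sum>i=1..n. \<bar>(\<Sum>k=1..n. S i k) - 1\<bar>)"
proof -
  define T where "T = (\<lambda>i. \<Sum>k=1..n. of_real (S i k) * G k k)"
  define b where "b = (\<lambda>i. \<Sum>k=1..n. S i k)"
  define e where "e = (\<lambda>i. cmod (G i i - m))"
  have row: "(C + 1) * e i \<le> cmod (defect n z S G i) + (\<Sum>k=1..n. S i k * e k) + \<bar>b i - 1\<bar>" if i: "i \<in> {1..n}" for i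
  proof -
    have "cmod (T i) \<le> (\<Sum>k=1..n. S i k * 1)"
      unfolding T_def by (intro order_trans[OF norm_sum] sum_mono) (use G S in \<open>auto simp: norm_mult intro!: mult_left_le\<close>)
    also have "\<dots> \<le> C" using C[OF i] by simp
    finally have T: "cmod (T i) \<le> C" .
    \<comment> \<open>The imaginary part alone gives the lower bound: \<open>T i\<close> can lower
      \<open>Im z\<close> by at most \<open>C\<close>.\<close>
    have "2 * C + 1 - C \<le> Im z - cmod (T i)" using z T by simp
    also have "\<dots> \<le> Im (z + T i)" using abs_Im_le_cmod[of "T i"] by simp
    also have "\<dots> \<le> cmod (z + T i)" using abs_Im_le_cmod[of "z + T i"] by linarith
    finally have lo: "C + 1 \<le> cmod (z + T i)" by simp
    have Tm: "T i - m * of_real (b i) = (\<Sum>k=1..n. of_real (S i k) * (G k k - m))"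
      by (simp add: T_def b_def sum_distrib_left sum_subtractf algebra_simps)
    have "(z + T i) * (G i i - m) = defect n z S G i - (m\<^sup>2 + z * m + 1) - m * (T i - m * of_real (b i)) - m\<^sup>2 * of_real (b i - 1)"
    proof -
      have "defect n z S G i = 1 + z * G i i + G i i * T i" by (simp add: defect_def T_def)
      then show ?thesis by (simp add: algebra_simps power2_eq_square)
    qed
    also have "\<dots> = defect n z S G i - m * (T i - m * of_real (b i)) - m\<^sup>2 * of_real (b i - 1)"
      using m by simp
    finally have "cmod (z + T i) * e i = cmod (defect n z S G i - m * (T i - m * of_real (b i)) - m\<^sup>2 * of_real (b i - 1))"
      unfolding e_def norm_mult[symmetric] by simp
    also have "\<dots> \<le> cmod (defect n z S G i) + cmod (m * (T i - m * of_real (b i))) + cmod (m\<^sup>2 * of_real (b i - 1))"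
      by (meson norm_triangle_ineq4 order_trans add_mono order_refl)
    also have "cmod (m * (T i - m * of_real (b i))) \<le> 1 * (\<Sum>k=1..n. S i k * e k)"
      unfolding norm_mult
    proof (intro mult_mono)
      show "cmod (T i - m * of_real (b i)) \<le> (\<Sum>k=1..n. S i k * e k)"
        unfolding Tm by (intro order_trans[OF norm_sum] sum_mono) (use S in \<open>auto simp: norm_mult e_def\<close>)
    qed (use m in auto)
    also have "cmod (m\<^sup>2 * of_real (b i - 1)) \<le> 1 * \<bar>b i - 1\<bar>"
      unfolding norm_mult norm_of_real norm_power using m by (intro mult_right_mono power_le_one) auto
    finally have "cmod (z + T i) * e i \<le> cmod (defect n z S G i) + (\<Sum>k=1..n. S i k * e k) + \<bar>b i - 1\<bar>" by simp
    moreover have "(C + 1) * e i \<le> cmod (z + T i) * e i" using lo by (intro mult_right_mono) (auto simp: e_def)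
    ultimately show ?thesis by simp
  qed
  have "(C + 1) * (\<Sum>i=1..n. e i) \<le> (\<Sum>i=1..n. cmod (defect n z S G i) + (\<Sum>k=1..n. S i k * e k) + \<bar>b i - 1\<bar>)"
    unfolding sum_distrib_left by (intro sum_mono row)
  also have "\<dots> = (\<Sum>i=1..n. cmod (defect n z S G i)) + (\<Sum>i=1..n. \<Sum>k=1..n. S i k * e k) + (\<Sum>i=1..n. \<bar>b i - 1\<bar>)"
    by (simp add: sum.distrib)
  \<comment> \<open>Summing over rows makes column sums of \<open>S\<close> appear; by symmetry they
    are row sums and hence at most \<open>C\<close>.\<close>
  also have "(\<Sum>i=1..n. \<Sum>k=1..n. S i k * e k) = (\<Sum>k=1..n. (\<Sum>i=1..n. S k i) * e k)"
    unfolding sum_distrib_right using S(2) by (subst sum.swap) (intro sum.cong refl, auto)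
  also have "\<dots> \<le> (\<Sum>k=1..n. C * e k)"
    using C by (intro sum_mono mult_right_mono) (auto simp: e_def)
  finally show ?thesis by (simp add: sum_distrib_left[symmetric] e_def b_def distrib_right)
qed

section \<open>Measurability of the eigenvalues\<close>

text \<open>Expresses an order statistic through the counting function, so that measurability passes
  from symmetric sums over all eigenvalues to each single eigenvalue.\<close>

lemma sorted_nth_le_iff_card:
  fixes xs :: "real list"
  assumes "sorted xs" "i < length xs"
  shows "xs ! i \<le> x \<longleftrightarrow> Suc i \<le> card {j. j < length xs \<and> xs ! j \<le> x}"
proof
  assume "xs ! i \<le> x"
  then have "{..i} \<subseteq> {j. j < length xs \<and> xs ! j \<le> x}"
    using assms by (auto intro: order_trans[OF sorted_nth_mono])
  then have "card {..i} \<le> card {j. j < length xs \<and> xs ! j \<le> x}" by (intro card_mono) auto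
  then show "Suc i \<le> card {j. j < length xs \<and> xs ! j \<le> x}" by simp
next
  assume c: "Suc i \<le> card {j. j < length xs \<and> xs ! j \<le> x}"
  show "xs ! i \<le> x"
  proof (rule ccontr)
    assume "\<not> xs ! i \<le> x"
    then have "{j. j < length xs \<and> xs ! j \<le> x} \<subseteq> {..<i}"
      using sorted_nth_mono[OF assms(1), of i] by (auto simp: not_le[symmetric] intro: order_trans) (meson not_le order_trans)
    then have "card {j. j < length xs \<and> xs ! j \<le> x} \<le> card {..<i}" by (intro card_mono) auto
    then show False using c by simp
  qed
qed

context martingale_array
begin

text \<open>The value 0 from n onwards makes every coordinate a random variable, which the product
  with a measure on all natural numbers requires.\<close>

definition eig :: "nat \<Rightarrow> 'a \<Rightarrow> nat \<Rightarrow> real" where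
  "eig n \<omega> i = (if i < n then eigenvalue_list (fun_mat n (W n \<omega>)) ! i else 0)"

lemma length_eig_list: "length (eigenvalue_list (fun_mat n (W n \<omega>))) = n"
  by (rule length_eigenvalue_list[OF fun_mat_carrier transpose_fun_mat[OF W_symmetric]])

lemma fun_mat_W: "fun_mat n (W n \<omega>) = (1 / sqrt (real n)) \<cdot>\<^sub>m array_matrix X n \<omega>"
  by (rule eq_matI) (auto simp: W_def array_matrix_def)

lemma empirical_spectral_cdf_eig:
  "empirical_spectral_cdf X n x \<omega> = 1 / real n * (\<Sum>i<n. indicator {..x} (eig n \<omega> i))"
  by (simp add: empirical_spectral_cdf_def fun_mat_W[symmetric] eig_def)

lemma mat_pow_measurable:
  "i < n \<Longrightarrow> j < n \<Longrightarrow> (\<lambda>\<omega>. (fun_mat n (W n \<omega>) ^\<^sub>m k) $$ (i, j)) \<in> borel_measurable M"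
proof (induction k arbitrary: i j)
  case (Suc k)
  have c: "fun_mat n (W n \<omega>) ^\<^sub>m k \<in> carrier_mat n n" for \<omega> by simp
  have "(fun_mat n (W n \<omega>) ^\<^sub>m Suc k) $$ (i, j) = (\<Sum>l<n. (fun_mat n (W n \<omega>) ^\<^sub>m k) $$ (i, l) * (X (Suc l) (Suc j) \<omega> / sqrt n))" for \<omega>
    using Suc.prems c[of \<omega>] by (simp add: scalar_prod_def lessThan_atLeast0 W_def)
  moreover have "(\<lambda>\<omega>. \<Sum>l<n. (fun_mat n (W n \<omega>) ^\<^sub>m k) $$ (i, l) * (X (Suc l) (Suc j) \<omega> / sqrt n)) \<in> borel_measurable M"
    using Suc X_measurable by (intro borel_measurable_sum borel_measurable_times borel_measurable_divide) auto
  ultimately show ?case by simp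
qed simp

lemma power_sum_measurable: "(\<lambda>\<omega>. \<Sum>i<n. eig n \<omega> i ^ k) \<in> borel_measurable M"
proof -
  have "(\<Sum>i<n. eig n \<omega> i ^ k) = (\<Sum>i<n. (fun_mat n (W n \<omega>) ^\<^sub>m k) $$ (i, i))" for \<omega>
    using trace_pow_eigenvalue_list[OF fun_mat_carrier transpose_fun_mat[OF W_symmetric]] by (simp add: eig_def)
  then show ?thesis using mat_pow_measurable by simp
qed

text \<open>Measurability is only evident for the power sums of the eigenvalues, which are traces of powers; the
  Weierstrass theorem extends it to continuous functions.\<close>

lemma continuous_sum_measurable:
  fixes f :: "real \<Rightarrow> real"
  assumes f: "continuous_on UNIV f"
  shows "(\<lambda>\<omega>. \<Sum>i<n. f (eig n \<omega> i)) \<in> borel_measurable M"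
proof -
  \<comment> \<open>The interval grows while the error shrinks, so the polynomials converge
    pointwise on the whole line: a fixed \<open>x\<close> lies in the interval as soon as
    \<open>m\<close> is at least \<open>\<bar>x\<bar>\<close>.\<close>
  have "\<exists>p. real_polynomial_function p \<and> (\<forall>x\<in>{- real m..real m}. \<bar>f x - p x\<bar> < 1 / Suc m)" for m
    by (rule Stone_Weierstrass_real_polynomial_function[of "{- real m..real m}" f "1 / Suc m"])
      (auto intro: continuous_on_subset[OF f])
  then obtain p where p: "\<And>m. real_polynomial_function (p m)"
    "\<And>m x. x \<in> {- real m..real m} \<Longrightarrow> \<bar>f x - p m x\<bar> < 1 / Suc m" by metis
  have lim: "(\<lambda>m. p m x) \<longlonglongrightarrow> f x" for x
  proof (rule LIMSEQ_I)
    fix r :: real assume "0 < r"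
    then obtain N where N: "1 / Suc N < r" using nat_approx_posE by blast
    show "\<exists>no. \<forall>n\<ge>no. norm (p n x - f x) < r"
    proof (intro exI allI impI)
      fix m assume m: "max N (nat \<lceil>\<bar>x\<bar>\<rceil>) \<le> m"
      then have "\<bar>x\<bar> \<le> m" by linarith
      then have "\<bar>f x - p m x\<bar> < 1 / Suc m" by (intro p(2)) auto
      also have "\<dots> \<le> 1 / Suc N" using m by (intro divide_left_mono) auto
      finally show "norm (p m x - f x) < r" using N by (simp add: abs_minus_commute)
    qed
  qed
  show ?thesis
  proof (rule borel_measurable_LIMSEQ_real)
    show "(\<lambda>m. \<Sum>i<n. p m (eig n \<omega> i)) \<longlonglongrightarrow> (\<Sum>i<n. f (eig n \<omega> i))" for \<omega>
      by (intro tendsto_sum lim)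
    show "(\<lambda>\<omega>. \<Sum>i<n. p m (eig n \<omega> i)) \<in> borel_measurable M" for m
    proof -
      obtain a d where "p m = (\<lambda>x. \<Sum>k\<le>d. a k * x ^ k)"
        using p(1)[of m] unfolding real_polynomial_function_iff_sum by blast
      then have "(\<Sum>i<n. p m (eig n \<omega> i)) = (\<Sum>k\<le>d. a k * (\<Sum>i<n. eig n \<omega> i ^ k))" for \<omega>
        by (simp add: sum_distrib_left) (rule sum.swap)
      then show ?thesis using power_sum_measurable by simp
    qed
  qed
qed

text \<open>The indicator is the pointwise limit of continuous ramps that fall from 1 at
  \<open>x\<close> to 0 at distance \<open>1 / m\<close> to its right.\<close>

lemma eigenvalue_count_measurable:
  "(\<lambda>\<omega>. \<Sum>i<n. indicator {..x} (eig n \<omega> i) :: real) \<in> borel_measurable M"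
proof (rule borel_measurable_LIMSEQ_real)
  fix \<omega>
  show "(\<lambda>m. \<Sum>i<n. max 0 (min 1 (1 - real m * (eig n \<omega> i - x)))) \<longlonglongrightarrow> (\<Sum>i<n. indicator {..x} (eig n \<omega> i))"
  proof (intro tendsto_sum)
    fix i
    show "(\<lambda>m. max 0 (min 1 (1 - real m * (eig n \<omega> i - x)))) \<longlonglongrightarrow> indicator {..x} (eig n \<omega> i)"
    proof (cases "eig n \<omega> i \<le> x")
      case True
      then have "1 - real m * (eig n \<omega> i - x) \<ge> 1" for m by (simp add: mult_nonneg_nonpos)
      then show ?thesis using True by simp
    next
      case False
      obtain N :: nat where N: "1 / (eig n \<omega> i - x) < N" using reals_Archimedean2 by blast
      have "max 0 (min 1 (1 - real m * (eig n \<omega> i - x))) = 0" if "m \<ge> N" for m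
      proof -
        have "1 / (eig n \<omega> i - x) \<le> m" using N that by linarith
        then show ?thesis using False by (simp add: field_simps max_def min_def)
      qed
      then have "\<forall>\<^sub>F m in sequentially. max 0 (min 1 (1 - real m * (eig n \<omega> i - x))) = 0"
        by (auto simp: eventually_sequentially)
      then show ?thesis using False by (simp add: tendsto_eventually)
    qed
  qed
  show "(\<lambda>\<omega>. \<Sum>i<n. max 0 (min 1 (1 - real m * (eig n \<omega> i - x)))) \<in> borel_measurable M" for m
    by (rule continuous_sum_measurable) (intro continuous_intros)
qed

lemma eig_measurable: "(\<lambda>\<omega>. eig n \<omega> i) \<in> borel_measurable M"
proof (cases "i < n")
  case True
  show ?thesis
  proof (rule borel_measurableI_le)
    fix x
    have "eig n \<omega> i \<le> x \<longleftrightarrow> real (Suc i) \<le> (\<Sum>j<n. indicator {..x} (eig n \<omega> j))" for \<omega>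
    proof -
      let ?xs = "eigenvalue_list (fun_mat n (W n \<omega>))"
      have "(\<Sum>j<n. indicator {..x} (eig n \<omega> j)) = real (card {j. j < length ?xs \<and> ?xs ! j \<le> x})"
        by (simp add: indicator_def sum.If_cases eig_def length_eig_list of_nat_sum[symmetric] Int_def conj_commute
            cong: conj_cong)
      moreover have "sorted ?xs" by (simp add: eigenvalue_list_def)
      ultimately show ?thesis
        using sorted_nth_le_iff_card[of ?xs i x] True by (simp only: of_nat_le_iff length_eig_list) (simp add: eig_def)
    qed
    then have "{\<omega> \<in> space M. eig n \<omega> i \<le> x} = {\<omega> \<in> space M. real (Suc i) \<le> (\<Sum>j<n. indicator {..x} (eig n \<omega> j))}"
      by simp
    also have "\<dots> \<in> sets M" using eigenvalue_count_measurable by measurable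
    finally show "{\<omega> \<in> space M. eig n \<omega> i \<le> x} \<in> sets M" .
  qed
qed (simp add: eig_def)

text \<open>The trace of the square is the squared Frobenius norm. Its expectation is the sum of the
  normalized variances, which is the source of tightness.\<close>

lemma sum_eig_squares:
  "(\<Sum>i<n. (eig n \<omega> i)\<^sup>2) = (\<Sum>i=1..n. \<Sum>j=1..n. (W n \<omega> i j)\<^sup>2)"
proof -
  have "(\<Sum>i<n. (eig n \<omega> i)\<^sup>2) = (\<Sum>i<n. (fun_mat n (W n \<omega>) ^\<^sub>m 2) $$ (i, i))"
    using trace_pow_eigenvalue_list[OF fun_mat_carrier transpose_fun_mat[OF W_symmetric], of n \<omega> 2] by (simp add: eig_def)
  also have "\<dots> = (\<Sum>i<n. \<Sum>j<n. (W n \<omega> (Suc i) (Suc j))\<^sup>2)"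
  proof (intro sum.cong refl)
    fix i assume "i \<in> {..<n}"
    then show "(fun_mat n (W n \<omega>) ^\<^sub>m 2) $$ (i, i) = (\<Sum>j<n. (W n \<omega> (Suc i) (Suc j))\<^sup>2)"
      using W_symmetric[of n \<omega>]
      by (auto simp: numeral_2_eq_2 scalar_prod_def lessThan_atLeast0 symmetric_upto_def intro!: sum.cong)
  qed
  finally show ?thesis unfolding sum_1_upto .
qed

lemma sum_stieltjes_eig:
  assumes "Im z \<ge> 1"
  shows "(\<Sum>i<n. 1 / (complex_of_real (eig n \<omega> i) - z)) = (\<Sum>i=1..n. G n z \<omega> i i)"
  using trace_resolvent[OF W_symmetric, of z n \<omega>] assms by (simp add: eig_def)

end

section \<open>Stieltjes inversion\<close>

text \<open>With this sign the transform of an empirical spectral distribution is the normalized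
  trace of the resolvent, and it maps the upper half plane into points of nonnegative imaginary
  part.\<close>

definition stieltjes :: "real measure \<Rightarrow> complex \<Rightarrow> complex" where
  "stieltjes \<nu> z = (\<integral>x. 1 / (complex_of_real x - z) \<partial>\<nu>)"

lemma norm_stieltjes_kernel:
  assumes "0 < c" "c \<le> Im z"
  shows "cmod (1 / (complex_of_real x - z)) \<le> 1 / c"
proof -
  have "c \<le> cmod (complex_of_real x - z)"
    using assms abs_Im_le_cmod[of "complex_of_real x - z"] by simp
  then show ?thesis using assms by (simp add: norm_divide frac_le)
qed

lemma stieltjes_kernel_nonzero: "Im z > 0 \<Longrightarrow> complex_of_real x - z \<noteq> 0"
  by (auto simp: complex_eq_iff)

context real_distribution
begin

lemma integrable_stieltjes_kernel:
  assumes "Im z > 0"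
  shows "integrable M (\<lambda>x. 1 / (complex_of_real x - z))"
  using norm_stieltjes_kernel[OF assms order_refl]
  by (intro integrable_const_bound[of _ "1 / Im z"]) auto

text \<open>Differentiation under the integral with an exact error: the difference quotient of the
  kernel minus its derivative is \<open>z - z0\<close> times a product of three kernels. Each of
  them is at most \<open>1 / v\<close> as long as \<open>Im z\<close> stays above \<open>v\<close>,
  half the height of \<open>z0\<close>.\<close>

lemma stieltjes_holomorphic: "stieltjes M holomorphic_on {z. Im z > 0}"
proof -
  have "(stieltjes M has_field_derivative (\<integral>x. (1 / (complex_of_real x - z0))\<^sup>2 \<partial>M)) (at z0)"
    if z0: "Im z0 > 0" for z0
  proof -
    define v where "v = Im z0 / 2"
    have v: "0 < v" "v \<le> Im z0" using z0 by (auto simp: v_def)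
    define d where "d = (\<integral>x. (1 / (complex_of_real x - z0))\<^sup>2 \<partial>M)"
    let ?k = "\<lambda>z x. 1 / (complex_of_real x - z)"
    have i2: "integrable M (\<lambda>x. (?k z0 x)\<^sup>2)"
      using norm_stieltjes_kernel[OF v]
      by (intro integrable_const_bound[of _ "(1 / v)\<^sup>2"]) (auto simp: norm_power intro!: AE_I2 power_mono)
    have bound: "cmod ((stieltjes M z - stieltjes M z0) / (z - z0) - d) \<le> (1 / v) ^ 3 * cmod (z - z0)"
      if z: "v \<le> Im z" "z \<noteq> z0" for z
    proof -
      have Imz: "0 < Im z" using v z by linarith
      note i = integrable_stieltjes_kernel[OF Imz] integrable_stieltjes_kernel[OF z0]
      have "(stieltjes M z - stieltjes M z0) / (z - z0) - d
          = (\<integral>x. (?k z x - ?k z0 x) / (z - z0) - (?k z0 x)\<^sup>2 \<partial>M)"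
        unfolding stieltjes_def d_def using i i2 by simp
      also have "\<dots> = (\<integral>x. (z - z0) * (?k z x * (?k z0 x)\<^sup>2) \<partial>M)"
      proof (intro Bochner_Integration.integral_cong refl)
        fix x
        have nz: "complex_of_real x - z \<noteq> 0" "complex_of_real x - z0 \<noteq> 0" "z - z0 \<noteq> 0"
          using stieltjes_kernel_nonzero Imz z0 z by auto
        define p where "p = complex_of_real x - z"
        define q where "q = complex_of_real x - z0"
        have pq: "z - z0 = q - p" by (simp add: p_def q_def)
        show "(?k z x - ?k z0 x) / (z - z0) - (?k z0 x)\<^sup>2 = (z - z0) * (?k z x * (?k z0 x)\<^sup>2)"
          using nz unfolding p_def[symmetric] q_def[symmetric] pq
          by (simp add: field_simps power2_eq_square)
      qed
      also have "cmod \<dots> \<le> (\<integral>x. cmod ((z - z0) * (?k z x * (?k z0 x)\<^sup>2)) \<partial>M)"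
        by (rule integral_norm_bound)
      also have "\<dots> \<le> (\<integral>x. cmod (z - z0) * (1 / v) ^ 3 \<partial>M)"
      proof (rule integral_mono')
        fix x
        have "cmod (?k z x) * (cmod (?k z0 x))\<^sup>2 \<le> (1 / v) * (1 / v)\<^sup>2"
          using norm_stieltjes_kernel[OF v, of x] norm_stieltjes_kernel[OF v(1) z(1), of x] v
          by (intro mult_mono power_mono) auto
        then have "cmod (z - z0) * (cmod (?k z x) * (cmod (?k z0 x))\<^sup>2) \<le> cmod (z - z0) * (1 / v) ^ 3"
          by (intro mult_left_mono) (simp_all add: power3_eq_cube power2_eq_square)
        then show "cmod ((z - z0) * (?k z x * (?k z0 x)\<^sup>2)) \<le> cmod (z - z0) * (1 / v) ^ 3"
          by (simp only: norm_mult norm_power)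
      qed (use v in auto)
      finally show ?thesis using prob_space by (simp add: mult.commute)
    qed
    have "\<forall>\<^sub>F z in at z0. v < Im z"
      using v z0 by (intro order_tendstoD(1)[of Im "Im z0"] tendsto_Im tendsto_ident_at) (simp add: v_def)
    then have ev: "\<forall>\<^sub>F z in at z0. cmod ((stieltjes M z - stieltjes M z0) / (z - z0) - d) \<le> (1 / v) ^ 3 * cmod (z - z0)"
      using eventually_neq_at_within[of z0 z0 UNIV] by eventually_elim (use bound in auto)
    have "((\<lambda>z. (1 / v) ^ 3 * cmod (z - z0)) \<longlongrightarrow> (1 / v) ^ 3 * cmod (z0 - z0)) (at z0)"
      by (intro tendsto_intros)
    then have "((\<lambda>z. (stieltjes M z - stieltjes M z0) / (z - z0) - d) \<longlongrightarrow> 0) (at z0)"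
      by (intro Lim_null_comparison[OF ev]) simp
    then show ?thesis unfolding has_field_derivative_iff d_def[symmetric] by (rule Lim_null[THEN iffD2])
  qed
  then show ?thesis by (auto simp: holomorphic_on_def field_differentiable_def intro: has_field_derivative_at_within)
qed

lemma Im_stieltjes:
  assumes "0 < v"
  shows "Im (stieltjes M (Complex u v)) = (\<integral>x. v / ((x - u)\<^sup>2 + v\<^sup>2) \<partial>M)"
proof -
  have "Im (stieltjes M (Complex u v)) = (\<integral>x. Im (1 / (complex_of_real x - Complex u v)) \<partial>M)"
    unfolding stieltjes_def by (rule integral_Im[symmetric]) (rule integrable_stieltjes_kernel, use assms in simp)
  also have "\<dots> = (\<integral>x. v / ((x - u)\<^sup>2 + v\<^sup>2) \<partial>M)"
    by (intro Bochner_Integration.integral_cong refl) (simp add: Im_divide)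
  finally show ?thesis .
qed

lemma Im_stieltjes_pos: "0 < v \<Longrightarrow> 0 \<le> Im (stieltjes M (Complex u v))"
  unfolding Im_stieltjes by (intro integral_nonneg_AE AE_I2) auto

text \<open>The left side is holomorphic on the connected upper half plane and vanishes on an open
  half plane inside it; \<open>max 0 v0\<close> ensures this inclusion also for negative
  \<open>v0\<close>.\<close>

lemma stieltjes_quadratic_extend:
  assumes "\<And>z. Im z \<ge> v0 \<Longrightarrow> (stieltjes M z)\<^sup>2 + z * stieltjes M z + 1 = 0" and z: "Im z > 0"
  shows "(stieltjes M z)\<^sup>2 + z * stieltjes M z + 1 = 0"
proof (rule analytic_continuation_open[of "{z. Im z > max 0 v0}" "{z. Im z > 0}"
      "\<lambda>z. (stieltjes M z)\<^sup>2 + z * stieltjes M z + 1" "\<lambda>_. 0"])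
  show "open {z. Im z > max 0 v0}" "open {z. Im z > 0}" by (rule open_halfspace_Im_gt)+
  have "Complex 0 (max 0 v0 + 1) \<in> {z. Im z > max 0 v0}" by (auto simp: max_def)
  then show "{z. Im z > max 0 v0} \<noteq> {}" by blast
  show "connected {z. Im z > 0}" by (simp add: convex_connected convex_halfspace_Im_gt)
  show "(\<lambda>z. (stieltjes M z)\<^sup>2 + z * stieltjes M z + 1) holomorphic_on {z. Im z > 0}"
    by (intro holomorphic_intros stieltjes_holomorphic)
qed (use assms in auto)

end

text \<open>If \<open>Im w \<ge> 0\<close> then
  \<open>Im w = sqrt ((cmod (w\<^sup>2) - Re (w\<^sup>2)) / 2)\<close>. This describes the imaginary
  part of the relevant root without choosing a branch of the complex square root, and the formula is
  continuous across the real axis.\<close>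

definition semicircle_Im :: "complex \<Rightarrow> real" where
  "semicircle_Im z = (sqrt ((cmod (z\<^sup>2 - 4) - Re (z\<^sup>2 - 4)) / 2) - Im z) / 2"

text \<open>\<open>2 * s + z\<close> is a square root of \<open>z\<^sup>2 - 4\<close>, and its imaginary part is positive.\<close>

lemma semicircle_Im_eq:
  assumes "s\<^sup>2 + z * s + 1 = 0" "Im s \<ge> 0" "Im z > 0"
  shows "Im s = semicircle_Im z"
proof -
  define w where "w = 2 * s + z"
  have "w\<^sup>2 = 4 * (s\<^sup>2 + z * s + 1) + (z\<^sup>2 - 4)" by (simp add: w_def power2_eq_square algebra_simps)
  then have w2: "w\<^sup>2 = z\<^sup>2 - 4" using assms by simp
  have "cmod (w\<^sup>2) - Re (w\<^sup>2) = 2 * (Im w)\<^sup>2"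
  proof -
    have "cmod (w\<^sup>2) = (Re w)\<^sup>2 + (Im w)\<^sup>2" by (simp add: norm_power cmod_power2)
    moreover have "Re (w\<^sup>2) = (Re w)\<^sup>2 - (Im w)\<^sup>2" by (simp add: power2_eq_square)
    ultimately show ?thesis by simp
  qed
  then have "sqrt ((cmod (z\<^sup>2 - 4) - Re (z\<^sup>2 - 4)) / 2) = \<bar>Im w\<bar>" unfolding w2 by simp
  moreover have "Im w = 2 * Im s + Im z" by (simp add: w_def)
  ultimately show ?thesis using assms by (simp add: semicircle_Im_def)
qed

text \<open>On the real axis \<open>\<bar>u\<^sup>2 - 4\<bar> - (u\<^sup>2 - 4)\<close> is
  \<open>2 * (4 - u\<^sup>2)\<close> inside the interval from -2 to 2 and 0 outside: the boundary
  value of the formula is the density times \<open>pi\<close>.\<close>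

lemma semicircle_Im_real: "semicircle_Im (complex_of_real u) = pi * semicircle_density u"
proof -
  have "(complex_of_real u)\<^sup>2 - 4 = complex_of_real (u\<^sup>2 - 4)" by simp
  then have c: "cmod ((complex_of_real u)\<^sup>2 - 4) = \<bar>u\<^sup>2 - 4\<bar>" "Re ((complex_of_real u)\<^sup>2 - 4) = u\<^sup>2 - 4"
    by (metis norm_of_real, metis Re_complex_of_real)
  have "\<bar>u\<bar> \<le> 2 \<longleftrightarrow> u\<^sup>2 \<le> 4" using abs_le_square_iff[of u 2] by simp
  then show ?thesis unfolding semicircle_Im_def c semicircle_density_def
    by (auto simp: indicator_def field_simps)
qed


text \<open>Deliberately crude; it supplies the dominating constant for the limit \<open>v\<close>
  to 0 on a bounded interval.\<close>

lemma semicircle_Im_bounds: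
  assumes "u \<in> {a..b}" "0 \<le> v" "v \<le> 1"
  shows "\<bar>semicircle_Im (Complex u v)\<bar> \<le> (\<bar>a\<bar> + \<bar>b\<bar> + 1)\<^sup>2 + 5"
proof -
  let ?z = "Complex u v" and ?c = "\<bar>a\<bar> + \<bar>b\<bar> + 1"
  have "cmod ?z \<le> \<bar>u\<bar> + \<bar>v\<bar>" using cmod_le[of ?z] by simp
  also have "\<dots> \<le> ?c" using assms by auto
  finally have "cmod (?z\<^sup>2) \<le> ?c\<^sup>2" unfolding norm_power by (intro power_mono) auto
  then have q: "cmod (?z\<^sup>2 - 4) \<le> ?c\<^sup>2 + 4" using norm_triangle_ineq4[of "?z\<^sup>2" 4] by simp
  have "(cmod (?z\<^sup>2 - 4) - Re (?z\<^sup>2 - 4)) / 2 \<le> cmod (?z\<^sup>2 - 4)"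
    using abs_Re_le_cmod[of "?z\<^sup>2 - 4"] by (simp add: field_simps abs_if split: if_splits)
  \<comment> \<open>Squaring a number that is at least 1 only enlarges it; the square is then undone
    by the root.\<close>
  also have "\<dots> \<le> (?c\<^sup>2 + 4)\<^sup>2"
    using q self_le_power[of "?c\<^sup>2 + 4" 2] by (smt (verit) zero_le_power2 pos2)
  finally have "sqrt ((cmod (?z\<^sup>2 - 4) - Re (?z\<^sup>2 - 4)) / 2) \<le> ?c\<^sup>2 + 4"
    by (intro real_le_lsqrt) auto
  moreover have "0 \<le> sqrt ((cmod (?z\<^sup>2 - 4) - Re (?z\<^sup>2 - 4)) / 2)"
    using abs_Re_le_cmod[of "?z\<^sup>2 - 4"] by simp
  moreover have "semicircle_Im ?z = (sqrt ((cmod (?z\<^sup>2 - 4) - Re (?z\<^sup>2 - 4)) / 2) - v) / 2"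
    by (simp add: semicircle_Im_def)
  moreover have "\<bar>(r - v) / 2\<bar> \<le> c + 5" if "0 \<le> r" "r \<le> c + 4" for r c
    using assms(2,3) that by (simp add: abs_le_iff)
  ultimately show ?thesis by metis
qed

lemma continuous_semicircle_Im: "continuous_on UNIV semicircle_Im"
  unfolding semicircle_Im_def by (intro continuous_intros) simp_all

lemma cauchy_kernel_integral:
  assumes "a \<le> b" "0 < v"
  shows "(\<integral>u. indicator {a..b} u * (v / ((x - u)\<^sup>2 + v\<^sup>2)) \<partial>lborel) = arctan ((b - x) / v) - arctan ((a - x) / v)"
proof -
  have "(\<integral>u. (v / ((x - u)\<^sup>2 + v\<^sup>2)) * indicator {a..b} u \<partial>lborel) = arctan ((b - x) / v) - arctan ((a - x) / v)"
  proof (rule integral_FTC_Icc_real[where F = "\<lambda>u. arctan ((u - x) / v)"])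
    fix u
    have "((\<lambda>u. arctan ((u - x) / v)) has_real_derivative (1 / v) * inverse (1 + ((u - x) / v)\<^sup>2)) (at u)"
      by (rule derivative_eq_intros refl | use assms in simp)+
    also have "(1 / v) * inverse (1 + ((u - x) / v)\<^sup>2) = v / ((x - u)\<^sup>2 + v\<^sup>2)"
    proof -
      have "0 < (x - u)\<^sup>2 + v\<^sup>2" using assms by (simp add: add_nonneg_pos)
      moreover have "1 + ((u - x) / v)\<^sup>2 = ((x - u)\<^sup>2 + v\<^sup>2) / v\<^sup>2"
        using assms by (simp add: power_divide field_simps power2_commute[of u x])
      ultimately show ?thesis using assms by (simp add: field_simps power2_eq_square)
    qed
    finally show "((\<lambda>u. arctan ((u - x) / v)) has_real_derivative v / ((x - u)\<^sup>2 + v\<^sup>2)) (at u)" .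
    show "isCont (\<lambda>u. v / ((x - u)\<^sup>2 + v\<^sup>2)) u"
      using assms by (intro continuous_intros) (auto simp: add_nonneg_eq_0_iff)
  qed (use assms in auto)
  then show ?thesis by (simp add: mult.commute)
qed

text \<open>At \<open>y = 0\<close> the limit is 0, halfway between the one-sided values. Writing it
  with \<open>sgn\<close> lets the inversion formula hold before atoms have been excluded.\<close>

lemma arctan_scaled_tendsto:
  "(\<lambda>k. arctan (y / (1 / real (Suc k)))) \<longlonglongrightarrow> pi / 2 * sgn y"
proof -
  have S: "filterlim (\<lambda>k. real (Suc k)) at_top sequentially"
    by (rule filterlim_compose[OF filterlim_real_sequentially filterlim_Suc])
  consider "y > 0" | "y = 0" | "y < 0" by linarith
  then show ?thesis
  proof cases
    case 1
    have "filterlim (\<lambda>k. y * real (Suc k)) at_top sequentially"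
      by (rule filterlim_tendsto_pos_mult_at_top[OF tendsto_const 1 S])
    from filterlim_compose[OF tendsto_arctan_at_top this] show ?thesis using 1 by simp
  next
    case 3
    have "filterlim (\<lambda>k. y * real (Suc k)) at_bot sequentially"
      by (rule filterlim_tendsto_neg_mult_at_bot[OF tendsto_const 3 S])
    from filterlim_compose[OF tendsto_arctan_at_bot this] show ?thesis using 3 by simp
  qed simp
qed

context real_distribution
begin

text \<open>Fubini for the Cauchy kernel, which is bounded by \<open>1 / v\<close> and supported on
  a set of finite product measure; the inner integral is an arctangent.\<close>

lemma stieltjes_inversion_finite:
  assumes ab: "a \<le> b" and v: "0 < v"
  shows "(\<integral>u. indicator {a..b} u * Im (stieltjes M (Complex u v)) \<partial>lborel)
     = (\<integral>x. arctan ((b - x) / v) - arctan ((a - x) / v) \<partial>M)"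
proof -
  interpret P: pair_sigma_finite lborel M by unfold_locales
  let ?f = "\<lambda>u x. indicator {a..b} u * (v / ((x - u)\<^sup>2 + v\<^sup>2))"
  have m: "(\<lambda>(u, x). ?f u x) \<in> borel_measurable (lborel \<Otimes>\<^sub>M M)"
    by measurable
  have "integrable (lborel \<Otimes>\<^sub>M M) (\<lambda>p. indicator ({a..b} \<times> UNIV) p *\<^sub>R (case p of (u, x) \<Rightarrow> ?f u x))"
  proof (rule integrableI_bounded_set_indicator[OF _ m])
    show A: "{a..b} \<times> UNIV \<in> sets (lborel \<Otimes>\<^sub>M M)" by simp
    have "emeasure (lborel \<Otimes>\<^sub>M M) ({a..b} \<times> UNIV) = emeasure lborel {a..b} * emeasure M UNIV"
      by (rule emeasure_pair_measure_Times) auto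
    also have "\<dots> < \<infinity>" using ab emeasure_space_1 by simp
    finally show "emeasure (lborel \<Otimes>\<^sub>M M) ({a..b} \<times> UNIV) < \<infinity>" .
    have "v / ((x - u)\<^sup>2 + v\<^sup>2) \<le> 1 / v" for u x
    proof -
      have "v / ((x - u)\<^sup>2 + v\<^sup>2) \<le> v / v\<^sup>2" using v by (intro divide_left_mono) (auto simp: add_nonneg_pos)
      then show ?thesis using v by (simp add: power2_eq_square)
    qed
    then show "AE p\<in>{a..b} \<times> UNIV in lborel \<Otimes>\<^sub>M M. norm (case p of (u, x) \<Rightarrow> ?f u x) \<le> 1 / v"
      using v by (intro AE_I2) (auto simp: indicator_def abs_mult)
  qed
  also have "(\<lambda>p. indicator ({a..b} \<times> UNIV) p *\<^sub>R (case p of (u, x) \<Rightarrow> ?f u x)) = (\<lambda>(u, x). ?f u x)"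
    by (auto simp: indicator_def fun_eq_iff)
  finally have i: "integrable (lborel \<Otimes>\<^sub>M M) (\<lambda>(u, x). ?f u x)" .
  have "(\<integral>u. indicator {a..b} u * Im (stieltjes M (Complex u v)) \<partial>lborel) = (\<integral>u. (\<integral>x. ?f u x \<partial>M) \<partial>lborel)"
    unfolding Im_stieltjes[OF v] Bochner_Integration.integral_mult_right_zero ..
  also have "\<dots> = (\<integral>x. (\<integral>u. ?f u x \<partial>lborel) \<partial>M)" by (rule P.Fubini_integral[OF i, symmetric])
  finally show ?thesis unfolding cauchy_kernel_integral[OF ab v] .
qed

end

lemma semicircle_density_bounds: "0 \<le> semicircle_density x" "semicircle_density x \<le> 1"
proof -
  have "x\<^sup>2 \<le> 4" if "\<bar>x\<bar> \<le> 2" using that abs_le_square_iff[of x 2] by simp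
  then show "0 \<le> semicircle_density x" by (auto simp: semicircle_density_def indicator_def)
  have "sqrt (4 - x\<^sup>2) \<le> 2" by (rule real_le_lsqrt) auto
  moreover have "2 \<le> 2 * pi" using pi_gt3 by simp
  ultimately have "sqrt (4 - x\<^sup>2) \<le> 2 * pi" by linarith
  then show "semicircle_density x \<le> 1" by (simp add: semicircle_density_def indicator_def)
qed

section \<open>Identification of the limit law\<close>

context real_distribution
begin

text \<open>The integral of the imaginary part over the interval at height \<open>v k\<close> has
  two limits: the boundary values of \<open>semicircle_Im\<close>, and by Fubini the
  \<open>sgn\<close> differences. For \<open>a < b\<close> the latter are 2 inside, 1 at the
  endpoints and 0 outside.\<close>

lemma semicircle_sgn_integral:
  assumes eq: "\<And>z. Im z > 0 \<Longrightarrow> (stieltjes M z)\<^sup>2 + z * stieltjes M z + 1 = 0" and ab: "a \<le> b"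
  shows "(\<integral>x. sgn (b - x) - sgn (a - x) \<partial>M) = 2 * (LBINT u:{a..b}. semicircle_density u)"
proof -
  define v where "v = (\<lambda>k. 1 / real (Suc k))"
  have v: "0 < v k" "v k \<le> 1" for k by (simp_all add: v_def)
  have vlim: "v \<longlonglongrightarrow> 0" unfolding v_def by (rule LIMSEQ_Suc[OF lim_1_over_n])
  define B where "B = (\<bar>a\<bar> + \<bar>b\<bar> + 1)\<^sup>2 + 5"
  have "(\<lambda>k. \<integral>u. indicator {a..b} u * semicircle_Im (Complex u (v k)) \<partial>lborel)
      \<longlonglongrightarrow> (\<integral>u. indicator {a..b} u * semicircle_Im (Complex u 0) \<partial>lborel)"
  proof (rule integral_dominated_convergence[where w = "\<lambda>u. indicator {a..b} u * B"])
    have m: "(\<lambda>u. semicircle_Im (Complex u t)) \<in> borel_measurable borel" for t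
      unfolding Complex_eq by (intro borel_measurable_continuous_onI continuous_on_compose2[OF continuous_semicircle_Im] continuous_intros) auto
    show "(\<lambda>u. indicator {a..b} u * semicircle_Im (Complex u 0)) \<in> borel_measurable lborel"
      "(\<lambda>u. indicator {a..b} u * semicircle_Im (Complex u (v k))) \<in> borel_measurable lborel" for k
      using m by auto
    have "integrable lborel (indicator {a..b} :: real \<Rightarrow> real)" using ab by (intro integrable_real_indicator) auto
    then show "integrable lborel (\<lambda>u. indicator {a..b} u * B)" by simp
    have "(\<lambda>k. semicircle_Im (Complex u (v k))) \<longlonglongrightarrow> semicircle_Im (Complex u 0)" for u
    proof (rule isCont_tendsto_compose[of _ semicircle_Im])
      show "isCont semicircle_Im (Complex u 0)" using continuous_semicircle_Im by (simp add: continuous_on_eq_continuous_at)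
      show "(\<lambda>k. Complex u (v k)) \<longlonglongrightarrow> Complex u 0" using vlim by (intro tendsto_intros)
    qed
    then show "AE u in lborel. (\<lambda>k. indicator {a..b} u * semicircle_Im (Complex u (v k)))
       \<longlonglongrightarrow> indicator {a..b} u * semicircle_Im (Complex u 0)" by (intro AE_I2 tendsto_mult tendsto_const)
    show "AE u in lborel. norm (indicator {a..b} u * semicircle_Im (Complex u (v k))) \<le> indicator {a..b} u * B" for k
      using semicircle_Im_bounds[of _ a b "v k"] v[of k] by (intro AE_I2) (auto simp: indicator_def B_def less_imp_le)
  qed
  also have "(\<lambda>k. \<integral>u. indicator {a..b} u * semicircle_Im (Complex u (v k)) \<partial>lborel)
     = (\<lambda>k. \<integral>x. arctan ((b - x) / v k) - arctan ((a - x) / v k) \<partial>M)"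
  proof
    fix k
    have "Im (stieltjes M (Complex u (v k))) = semicircle_Im (Complex u (v k))" for u
      by (rule semicircle_Im_eq[OF eq]) (use v[of k] Im_stieltjes_pos[of "v k"] in auto)
    then show "(\<integral>u. indicator {a..b} u * semicircle_Im (Complex u (v k)) \<partial>lborel) = (\<integral>x. arctan ((b - x) / v k) - arctan ((a - x) / v k) \<partial>M)"
      using stieltjes_inversion_finite[OF ab v(1)[of k]] by simp
  qed
  also have "(\<integral>u. indicator {a..b} u * semicircle_Im (Complex u 0) \<partial>lborel) = pi * (LBINT u:{a..b}. semicircle_density u)"
    unfolding set_lebesgue_integral_def complex_of_real_def[symmetric] semicircle_Im_real
    by (simp add: mult.left_commute)
  finally have 1: "(\<lambda>k. \<integral>x. arctan ((b - x) / v k) - arctan ((a - x) / v k) \<partial>M) \<longlonglongrightarrow> pi * (LBINT u:{a..b}. semicircle_density u)" .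
  have 2: "(\<lambda>k. \<integral>x. arctan ((b - x) / v k) - arctan ((a - x) / v k) \<partial>M) \<longlonglongrightarrow> (\<integral>x. pi / 2 * sgn (b - x) - pi / 2 * sgn (a - x) \<partial>M)"
  proof (rule integral_dominated_convergence[where w = "\<lambda>_. pi"])
    show "AE x in M. (\<lambda>k. arctan ((b - x) / v k) - arctan ((a - x) / v k)) \<longlonglongrightarrow> pi / 2 * sgn (b - x) - pi / 2 * sgn (a - x)"
      unfolding v_def by (intro AE_I2 tendsto_diff arctan_scaled_tendsto)
    show "AE x in M. norm (arctan ((b - x) / v k) - arctan ((a - x) / v k)) \<le> pi" for k
    proof (rule AE_I2)
      fix x
      show "norm (arctan ((b - x) / v k) - arctan ((a - x) / v k)) \<le> pi"
        using arctan_bounded[of "(b - x) / v k"] arctan_bounded[of "(a - x) / v k"] by (simp add: abs_le_iff)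
    qed
  qed auto
  have "(\<integral>x. pi / 2 * sgn (b - x) - pi / 2 * sgn (a - x) \<partial>M) = pi / 2 * (\<integral>x. sgn (b - x) - sgn (a - x) \<partial>M)"
    unfolding right_diff_distrib[symmetric] by (rule integral_mult_right_zero)
  with LIMSEQ_unique[OF 1 2] have "pi * (LBINT u:{a..b}. semicircle_density u) = pi / 2 * (\<integral>x. sgn (b - x) - sgn (a - x) \<partial>M)"
    by simp
  then have "pi * (2 * (LBINT u:{a..b}. semicircle_density u)) = pi * (\<integral>x. sgn (b - x) - sgn (a - x) \<partial>M)"
    by simp
  then show ?thesis by (metis mult_left_cancel pi_neq_zero)
qed


text \<open>Atoms are excluded first: the inversion formula on an interval of length
  \<open>e\<close>, with density at most 1, bounds each of them by \<open>2 * e\<close>. Then the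
  \<open>sgn\<close> integrals become differences of the distribution function, and the left
  endpoint is sent to minus infinity.\<close>

lemma cdf_eq_semicircle_cdf:
  assumes eq: "\<And>z. Im z > 0 \<Longrightarrow> (stieltjes M z)\<^sup>2 + z * stieltjes M z + 1 = 0"
  shows "cdf M x = semicircle_cdf x" "isCont (cdf M) x"
proof -
  have isgn: "integrable M (\<lambda>x. sgn (b - x))" for b :: real
    by (rule integrable_const_bound[of _ 1]) (auto simp: abs_sgn_eq)
  have atom: "prob {c} = 0" for c
  proof -
    have le: "prob {c} \<le> 2 * e" if e: "0 < e" for e
    proof -
      have "prob {c} = (\<integral>x. indicator {c} x \<partial>M)" by simp
      also have "\<dots> \<le> (\<integral>x. sgn (c + e - x) - sgn (c - x) \<partial>M)"
      proof (rule integral_mono)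
        show "integrable M (indicator {c} :: real \<Rightarrow> real)"
          by (intro integrable_real_indicator) (auto simp: emeasure_eq_measure)
        show "integrable M (\<lambda>x. sgn (c + e - x) - sgn (c - x))" using isgn by simp
        \<comment> \<open>At \<open>x = c\<close> the right side is 1 because
          \<open>sgn 0 = 0\<close>; elsewhere it is nonnegative.\<close>
        show "indicator {c} x \<le> sgn (c + e - x) - sgn (c - x)" for x
          using e by (simp add: indicator_def sgn_if)
      qed
      also have "\<dots> = 2 * (LBINT u:{c..c + e}. semicircle_density u)"
        using e by (intro semicircle_sgn_integral eq) auto
      also have "(LBINT u:{c..c + e}. semicircle_density u) \<le> (\<integral>u. indicator {c..c + e} u \<partial>lborel)"
        unfolding set_lebesgue_integral_def
      proof (rule integral_mono')
        show "integrable lborel (indicator {c..c + e} :: real \<Rightarrow> real)"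
          using e by (intro integrable_real_indicator) auto
        show "indicator {c..c + e} u *\<^sub>R semicircle_density u \<le> indicator {c..c + e} u" for u
          using semicircle_density_bounds[of u] by (simp add: indicator_def)
      qed simp
      finally show ?thesis using e by simp
    qed
    have "prob {c} \<le> 0"
      by (rule field_le_epsilon) (use le[of "_ / 2"] in \<open>auto simp: field_simps\<close>)
    then show ?thesis by (simp add: measure_le_0_iff)
  qed
  then show "isCont (cdf M) x" by (simp add: isCont_cdf)
  have sgn_cdf: "(\<integral>x. sgn (b - x) \<partial>M) = 2 * cdf M b - 1" for b
  proof -
    have "AE x in M. x \<noteq> b"
    proof (rule AE_I[of _ _ "{b}"])
      show "emeasure M {b} = 0" using atom[of b] by (simp add: emeasure_eq_measure)
    qed auto
    then have "(\<integral>x. sgn (b - x) \<partial>M) = (\<integral>x. 2 * indicator {..b} x - 1 \<partial>M)"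
      by (intro integral_cong_AE) (auto simp: indicator_def sgn_if)
    also have "\<dots> = 2 * cdf M b - 1"
    proof -
      have "integrable M (indicator {..b} :: real \<Rightarrow> real)"
        by (intro integrable_real_indicator) (auto simp: emeasure_eq_measure)
      then show ?thesis using prob_space by (simp add: cdf_def)
    qed
    finally show ?thesis .
  qed
  have diff: "cdf M b - cdf M a = (LBINT u:{a..b}. semicircle_density u)" if "a \<le> b" for a b
    using semicircle_sgn_integral[OF eq that] isgn by (simp add: sgn_cdf)
  have "\<forall>\<^sub>F k in sequentially. cdf M x - cdf M (- real k) = semicircle_cdf x"
  proof (rule eventually_sequentiallyI)
    fix k assume k: "nat \<lceil>max 2 \<bar>x\<bar>\<rceil> \<le> k"
    then have k: "2 \<le> real k" "\<bar>x\<bar> \<le> real k" by linarith+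
    \<comment> \<open>The density vanishes below -2, so cutting off at \<open>- real k\<close>
      changes nothing once \<open>k\<close> is at least 2.\<close>
    have "indicator {- real k..x} u *\<^sub>R semicircle_density u = indicator {..x} u *\<^sub>R semicircle_density u" for u
      using k by (auto simp: indicator_def semicircle_density_def)
    then have "(LBINT u:{- real k..x}. semicircle_density u) = semicircle_cdf x"
      unfolding set_lebesgue_integral_def semicircle_cdf_def by presburger
    then show "cdf M x - cdf M (- real k) = semicircle_cdf x" using diff[of "- real k" x] k by linarith
  qed
  then have "(\<lambda>k. cdf M x - cdf M (- real k)) \<longlonglongrightarrow> semicircle_cdf x" by (rule tendsto_eventually)
  moreover have "(\<lambda>k. cdf M x - cdf M (- real k)) \<longlonglongrightarrow> cdf M x - 0"
    by (intro tendsto_intros cdf_lim_neg_infty)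
  ultimately show "cdf M x = semicircle_cdf x" using LIMSEQ_unique by fastforce
qed

end

section \<open>Convergence of the expected spectral measure\<close>

text \<open>Continuity provides points \<open>g j\<close> where \<open>H\<close> takes the values
  \<open>j / N\<close>. Convergence at these finitely many points, together with monotonicity
  between them, gives a uniform error of \<open>3 / N\<close>. The threshold \<open>n0\<close>
  allows meaningless initial terms such as the empty matrix.\<close>

lemma polya_uniform_convergence:
  fixes F :: "nat \<Rightarrow> real \<Rightarrow> real" and H :: "real \<Rightarrow> real"
  assumes mono: "\<And>n. n \<ge> n0 \<Longrightarrow> mono (F n)" and F01: "\<And>n x. n \<ge> n0 \<Longrightarrow> 0 \<le> F n x \<and> F n x \<le> 1"
    and H: "continuous_on UNIV H" "mono H" "(H \<longlongrightarrow> 0) at_bot" "(H \<longlongrightarrow> 1) at_top"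
    and lim: "\<And>x. (\<lambda>n. F n x) \<longlonglongrightarrow> H x"
  shows "(\<lambda>n. SUP x. \<bar>F n x - H x\<bar>) \<longlonglongrightarrow> 0"
proof (rule LIMSEQ_I)
  fix r :: real assume r: "0 < r"
  obtain N0 where "1 / Suc N0 < r / 4" using nat_approx_posE[of "r / 4"] r by auto
  define N where "N = Suc N0"
  have N: "0 < N" "1 / N < r / 4" using \<open>1 / Suc N0 < r / 4\<close> by (simp_all add: N_def)
  have H01: "0 \<le> H x \<and> H x \<le> 1" for x
    using LIMSEQ_le_const[OF lim[of x], of 0] LIMSEQ_le_const2[OF lim[of x], of 1] F01 by blast
  have "\<exists>x. H x = j / N" if j: "0 < j" "j < N" for j
  proof -
    have "0 < real j / N" "real j / N < 1" using j by auto
    then have "\<forall>\<^sub>F x in at_bot. H x < j / N" "\<forall>\<^sub>F x in at_top. H x > j / N"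
      using order_tendstoD[OF H(3)] order_tendstoD[OF H(4)] by blast+
    then obtain a b where a: "\<And>x. x \<le> a \<Longrightarrow> H x < j / N" and b: "\<And>x. x \<ge> b \<Longrightarrow> H x > j / N"
      by (auto simp: eventually_at_bot_linorder eventually_at_top_linorder)
    have "\<exists>x\<ge>min a b. x \<le> max a b \<and> H x = j / N"
      using a[of "min a b"] b[of "max a b"] H(1)
      by (intro IVT') (auto intro: continuous_on_subset less_imp_le)
    then show ?thesis by blast
  qed
  \<comment> \<open>The point \<open>g 0\<close> is unconstrained. It is merely one more point at
    which pointwise convergence is invoked.\<close>
  then obtain g where g: "\<And>j. 0 < j \<Longrightarrow> j < N \<Longrightarrow> H (g j) = j / N" by metis
  have "\<forall>\<^sub>F n in sequentially. \<forall>j\<in>{..<N}. \<bar>F n (g j) - H (g j)\<bar> < 1 / N"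
    unfolding eventually_ball_finite_distrib[OF finite_lessThan]
  proof
    fix j
    have "(\<lambda>n. F n (g j) - H (g j)) \<longlonglongrightarrow> 0" using lim[of "g j"] by (simp add: LIM_zero)
    then show "\<forall>\<^sub>F n in sequentially. \<bar>F n (g j) - H (g j)\<bar> < 1 / N"
      using N(1) by (auto dest!: tendstoD[where e = "1 / N"] simp: dist_real_def)
  qed
  then have ev: "\<forall>\<^sub>F n in sequentially. n \<ge> n0 \<and> (\<forall>j<N. \<bar>F n (g j) - H (g j)\<bar> < 1 / N)"
    using eventually_ge_at_top[of n0] by eventually_elim auto
  have bound: "\<bar>F n x - H x\<bar> \<le> 3 / N" if n: "n \<ge> n0" "\<And>j. j < N \<Longrightarrow> \<bar>F n (g j) - H (g j)\<bar> < 1 / N" for n x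
  proof -
    define j where "j = nat \<lfloor>N * H x\<rfloor>"
    have j: "real j \<le> N * H x" "N * H x < real j + 1" using H01[of x] by (simp_all add: j_def)
    then have j': "j / N \<le> H x" "H x < (j + 1) / N" using N by (simp_all add: field_simps)
    have "F n x \<le> H x + 2 / N"
    proof (cases "j + 1 < N")
      case True
      have "H x < H (g (j + 1))" using j' g[of "j + 1"] True by simp
      then have "x \<le> g (j + 1)" using H(2) by (meson monoD not_le leD less_imp_le)
      then have "F n x \<le> F n (g (j + 1))" using mono n by (simp add: monoD)
      also have "\<dots> \<le> (j + 1) / N + 1 / N" using n(2)[OF True] g[of "j + 1"] True by simp
      also have "\<dots> = j / N + 2 / N" by (simp add: add_divide_distrib)
      finally show ?thesis using j' by simp
    next
      case False
      then have "1 \<le> real (j + 1) / N" using N by simp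
      also have "\<dots> \<le> H x + 1 / N" using j' by (simp add: add_divide_distrib)
      finally have "1 \<le> H x + 1 / N" .
      moreover have "1 / real N \<le> 2 / N" by (simp add: divide_right_mono)
      ultimately show ?thesis using F01[OF n(1), of x] by linarith
    qed
    \<comment> \<open>From below the comparison point is \<open>g (j - 1)\<close>:
      \<open>H x\<close> may equal \<open>j / N\<close>, and then nothing orders \<open>x\<close>
      and \<open>g j\<close>. This step back costs the third \<open>1 / N\<close>. For
      \<open>j < 2\<close> no such point exists, but then \<open>H x < 2 / N\<close> and
      \<open>F n x \<ge> 0\<close> suffice.\<close>
    moreover have "H x - 3 / N \<le> F n x"
    proof (cases "2 \<le> j")
      case True
      have "real j \<le> N" using j(1) H01[of x] mult_left_le[of "H x" "real N"] by simp
      then have jN: "0 < j - 1" "j - 1 < N" using True by auto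
      have "H (g (j - 1)) < H x" proof -
        have "real (j - 1) / N < j / N" using True N by (intro divide_strict_right_mono) auto
        then show ?thesis using g[OF jN] j'(1) by linarith
      qed
      then have "g (j - 1) \<le> x" using H(2) by (meson monoD not_le leD less_imp_le)
      then have "F n (g (j - 1)) \<le> F n x" using mono n by (simp add: monoD)
      moreover have "F n (g (j - 1)) \<ge> (j - 1) / N - 1 / N" using n(2)[OF jN(2)] g[OF jN] by simp
      moreover have "real (j - 1) / N = (j + 1) / N - 2 / N" using True by (simp add: of_nat_diff diff_divide_distrib add_divide_distrib)
      ultimately show ?thesis using j'(2) by (simp add: add_divide_distrib)
    next
      case False
      then have "H x < 2 / N" using j'(2) N by (intro less_le_trans[OF j'(2)] divide_right_mono) auto
      moreover have "2 / real N \<le> 3 / N" by (simp add: divide_right_mono)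
      ultimately show ?thesis using F01[OF n(1), of x] by linarith
    qed
    ultimately show ?thesis using N by (simp add: abs_le_iff field_simps)
  qed
  show "\<exists>no. \<forall>n\<ge>no. norm ((SUP x. \<bar>F n x - H x\<bar>) - 0) < r"
  proof -
    from ev obtain K where K: "\<And>n. n \<ge> K \<Longrightarrow> n \<ge> n0 \<and> (\<forall>j<N. \<bar>F n (g j) - H (g j)\<bar> < 1 / N)"
      by (auto simp: eventually_sequentially)
    have "norm ((SUP x. \<bar>F n x - H x\<bar>) - 0) < r" if "n \<ge> K" for n
    proof -
      have b: "\<bar>F n x - H x\<bar> \<le> 3 / N" for x using bound[of n x] K[OF that] by blast
      have "(SUP x. \<bar>F n x - H x\<bar>) \<le> 3 / N" by (rule cSUP_least) (use b in auto)
      also have "3 / N = 3 * (1 / real N)" by simp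
      also have "\<dots> < r" using N(2) r by linarith
      finally have "(SUP x. \<bar>F n x - H x\<bar>) < r" .
      moreover have "\<bar>F n 0 - H 0\<bar> \<le> (SUP x. \<bar>F n x - H x\<bar>)"
        using b by (intro cSUP_upper bdd_aboveI2) auto
      ultimately show ?thesis by simp
    qed
    then show ?thesis by blast
  qed
qed

text \<open>The product of the two roots is 1, so one of them has modulus at most 1.\<close>

lemma semicircle_root_exists:
  obtains m :: complex where "cmod m \<le> 1" "m\<^sup>2 + z * m + 1 = 0"
proof -
  define w where "w = csqrt (z\<^sup>2 - 4)"
  have w: "w\<^sup>2 = z\<^sup>2 - 4" by (simp add: w_def)
  define p where "p = (- z + w) / 2"
  define q where "q = (- z - w) / 2"
  have "p * q = (z\<^sup>2 - w\<^sup>2) / 4" by (simp add: p_def q_def field_simps power2_eq_square)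
  then have pq: "p * q = 1" unfolding w by simp
  have "p\<^sup>2 + z * p + 1 = (w\<^sup>2 - (z\<^sup>2 - 4)) / 4" "q\<^sup>2 + z * q + 1 = (w\<^sup>2 - (z\<^sup>2 - 4)) / 4"
    by (simp_all add: p_def q_def power2_eq_square field_simps)
  then have eq: "p\<^sup>2 + z * p + 1 = 0" "q\<^sup>2 + z * q + 1 = 0" unfolding w by simp_all
  have "cmod p * cmod q = 1" using pq by (metis norm_mult norm_one)
  then have "cmod p \<le> 1 \<or> cmod q \<le> 1"
    using less_1_mult[of "cmod p" "cmod q"] by linarith
  then show ?thesis
    using that[of p, OF _ eq(1)] that[of q, OF _ eq(2)] by (elim disjE)
qed

section \<open>The expected spectral measure: construction, tightness, Stieltjes transform\<close>

context martingale_array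
begin

text \<open>The law of an eigenvalue whose index is drawn uniformly and independently of the matrix;
  it is thus a probability measure whose integrals are averages by Fubini. Also for
  \<open>n = 0\<close> it is a distribution, though an unspecified one, so formulas about it assume
  \<open>0 < n\<close>.\<close>

definition spectral_measure :: "nat \<Rightarrow> real measure" where
  "spectral_measure n = distr (measure_pmf (pmf_of_set {..<n}) \<Otimes>\<^sub>M M) borel (\<lambda>(i, \<omega>). eig n \<omega> i)"

lemma eig_pair_measurable:
  "(\<lambda>(i, \<omega>). eig n \<omega> i) \<in> borel_measurable (measure_pmf (pmf_of_set {..<n}) \<Otimes>\<^sub>M M)"
proof -
  have "(\<lambda>(i, \<omega>). eig n \<omega> i) \<in> borel_measurable (count_space UNIV \<Otimes>\<^sub>M M)"
    by (rule measurable_pair_measure_countable1) (simp_all add: eig_measurable)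
  then show ?thesis
    by (subst measurable_cong_sets[OF sets_pair_measure_cong[OF sets_measure_pmf_count_space refl] refl])
qed

lemma pair_prob_space_pmf: "pair_prob_space (measure_pmf p) M"
  by (simp add: pair_prob_space_def pair_sigma_finite_def prob_space_imp_sigma_finite
      measure_pmf.prob_space_axioms prob_space_axioms)

lemma real_distribution_spectral_measure: "real_distribution (spectral_measure n)"
proof -
  have "prob_space (measure_pmf (pmf_of_set {..<n}) \<Otimes>\<^sub>M M)"
    by (intro prob_space_pair measure_pmf.prob_space_axioms prob_space_axioms)
  then have "prob_space (spectral_measure n)"
    unfolding spectral_measure_def by (rule prob_space.prob_space_distr) (rule eig_pair_measurable)
  then show ?thesis
    by (simp add: real_distribution_def real_distribution_axioms_def spectral_measure_def)
qed

lemma integral_spectral_measure: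
  fixes f :: "real \<Rightarrow> 'b :: {banach, second_countable_topology}"
  assumes n: "0 < n" and f: "f \<in> borel_measurable borel" "\<And>x. norm (f x) \<le> B"
  shows "integral\<^sup>L (spectral_measure n) f = (\<Sum>i<n. (1 / n) *\<^sub>R (\<integral>\<omega>. f (eig n \<omega> i) \<partial>M))"
proof -
  interpret P: pair_prob_space "measure_pmf (pmf_of_set {..<n})" M by (rule pair_prob_space_pmf)
  have ne: "{..<n} \<noteq> {}" using n by auto
  have m: "(\<lambda>p. f (case p of (i, \<omega>) \<Rightarrow> eig n \<omega> i)) \<in> borel_measurable (measure_pmf (pmf_of_set {..<n}) \<Otimes>\<^sub>M M)"
    using measurable_compose[OF eig_pair_measurable f(1)] .
  have i: "integrable (measure_pmf (pmf_of_set {..<n}) \<Otimes>\<^sub>M M) (\<lambda>p. f (case p of (i, \<omega>) \<Rightarrow> eig n \<omega> i))"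
    using m f(2) by (intro P.P.integrable_const_bound[of _ B]) auto
  have "integral\<^sup>L (spectral_measure n) f = (\<integral>p. f (case p of (i, \<omega>) \<Rightarrow> eig n \<omega> i) \<partial>(measure_pmf (pmf_of_set {..<n}) \<Otimes>\<^sub>M M))"
    unfolding spectral_measure_def by (rule integral_distr[OF eig_pair_measurable f(1)])
  also have "\<dots> = (\<integral>i. \<integral>\<omega>. f (eig n \<omega> i) \<partial>M \<partial>measure_pmf (pmf_of_set {..<n}))"
    using P.integral_fst'[OF i] by simp
  also have "\<dots> = (\<Sum>i<n. pmf (pmf_of_set {..<n}) i *\<^sub>R (\<integral>\<omega>. f (eig n \<omega> i) \<partial>M))"
    by (rule integral_measure_pmf) (simp_all add: set_pmf_of_set[OF ne finite_lessThan])
  also have "\<dots> = (\<Sum>i<n. (1 / n) *\<^sub>R (\<integral>\<omega>. f (eig n \<omega> i) \<partial>M))"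
    by (intro sum.cong refl) (simp add: pmf_of_set[OF ne finite_lessThan])
  finally show ?thesis .
qed

lemma integrable_indicator_eig:
  assumes "A \<in> sets borel"
  shows "integrable M (\<lambda>\<omega>. indicator A (eig n \<omega> i) :: real)"
  using measurable_compose[OF eig_measurable borel_measurable_indicator[OF assms]]
  by (intro integrable_const_bound[of _ 1]) auto

lemma measure_spectral_measure:
  assumes n: "0 < n" and A: "A \<in> sets borel"
  shows "measure (spectral_measure n) A = 1 / n * (\<Sum>i<n. \<integral>\<omega>. indicator A (eig n \<omega> i) \<partial>M)"
proof -
  interpret D: real_distribution "spectral_measure n" by (rule real_distribution_spectral_measure)
  have "measure (spectral_measure n) A = (\<integral>x. indicator A x \<partial>spectral_measure n)" using A by simp
  also have "\<dots> = (\<Sum>i<n. (1 / n) *\<^sub>R (\<integral>\<omega>. indicator A (eig n \<omega> i) \<partial>M))"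
    using A by (intro integral_spectral_measure[where B = 1] n) auto
  finally show ?thesis by (simp add: sum_distrib_left)
qed

lemma cdf_spectral_measure:
  assumes n: "0 < n"
  shows "cdf (spectral_measure n) x = expected_spectral_cdf M X n x"
  unfolding cdf_def measure_spectral_measure[OF n atMost_borel] expected_spectral_cdf_def empirical_spectral_cdf_eig
  using integrable_indicator_eig[of "{..x}" n] by simp

text \<open>Chebyshev's inequality: the second moment is \<open>1 / n\<close> times the expected
  squared Frobenius norm, that is the average row sum of \<open>S\<close>.\<close>

lemma spectral_measure_tail:
  assumes n: "0 < n" and C: "\<And>i. i \<in> {1..n} \<Longrightarrow> (\<Sum>k=1..n. S n i k) \<le> C" and R: "0 < R"
  shows "measure (spectral_measure n) {- R<..R} \<ge> 1 - C / R\<^sup>2"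
proof -
  interpret D: real_distribution "spectral_measure n" by (rule real_distribution_spectral_measure)
  let ?A = "- {- R<..R}"
  have iW: "integrable M (\<lambda>\<omega>. (W n \<omega> i j)\<^sup>2)" "(\<integral>\<omega>. (W n \<omega> i j)\<^sup>2 \<partial>M) = S n i j"
    if "i \<in> {1..n}" "j \<in> {1..n}" for i j
    using X_sq_integrable[of i j] X_variance[of i j] that by (auto simp: W_def S_def power_divide)
  have "measure (spectral_measure n) ?A = 1 / n * (\<integral>\<omega>. (\<Sum>i<n. indicator ?A (eig n \<omega> i)) \<partial>M)"
    using integrable_indicator_eig[of ?A n] by (subst measure_spectral_measure[OF n]) auto
  also have "\<dots> \<le> 1 / n * (\<integral>\<omega>. (\<Sum>i=1..n. \<Sum>j=1..n. (W n \<omega> i j)\<^sup>2) / R\<^sup>2 \<partial>M)"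
  proof (intro mult_left_mono integral_mono)
    show "integrable M (\<lambda>\<omega>. \<Sum>i<n. indicator ?A (eig n \<omega> i) :: real)"
      using integrable_indicator_eig[of ?A n] by auto
    show "integrable M (\<lambda>\<omega>. (\<Sum>i=1..n. \<Sum>j=1..n. (W n \<omega> i j)\<^sup>2) / R\<^sup>2)"
      using iW by (intro Bochner_Integration.integrable_divide Bochner_Integration.integrable_sum) auto
    fix \<omega>
    have "indicator ?A x \<le> x\<^sup>2 / R\<^sup>2" for x
    proof (cases "x \<in> ?A")
      case True
      then have "\<bar>R\<bar> \<le> \<bar>x\<bar>" using R by auto
      then have "R\<^sup>2 \<le> x\<^sup>2" by (simp add: abs_le_square_iff)
      then show ?thesis using True R by simp
    qed simp
    then have "(\<Sum>i<n. indicator ?A (eig n \<omega> i)) \<le> (\<Sum>i<n. (eig n \<omega> i)\<^sup>2 / R\<^sup>2)" by (intro sum_mono)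
    then show "(\<Sum>i<n. indicator ?A (eig n \<omega> i)) \<le> (\<Sum>i=1..n. \<Sum>j=1..n. (W n \<omega> i j)\<^sup>2) / R\<^sup>2"
      by (simp only: sum_divide_distrib[symmetric] sum_eig_squares)
  qed auto
  also have "(\<integral>\<omega>. (\<Sum>i=1..n. \<Sum>j=1..n. (W n \<omega> i j)\<^sup>2) / R\<^sup>2 \<partial>M) = (\<Sum>i=1..n. \<Sum>j=1..n. S n i j) / R\<^sup>2"
  proof -
    have "(\<integral>\<omega>. (\<Sum>i=1..n. \<Sum>j=1..n. (W n \<omega> i j)\<^sup>2) \<partial>M) = (\<Sum>i=1..n. \<Sum>j=1..n. S n i j)"
      using iW by (subst Bochner_Integration.integral_sum, force intro!: Bochner_Integration.integrable_sum,
          intro sum.cong refl, subst Bochner_Integration.integral_sum) auto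
    then show ?thesis by simp
  qed
  also have "1 / n * ((\<Sum>i=1..n. \<Sum>j=1..n. S n i j) / R\<^sup>2) \<le> 1 / n * (n * C / R\<^sup>2)"
    using sum_bounded_above[of "{1..n}" "\<lambda>i. \<Sum>j=1..n. S n i j" C] C
    by (intro mult_left_mono divide_right_mono) auto
  also have "\<dots> = C / R\<^sup>2" using n by simp
  finally have "measure (spectral_measure n) ?A \<le> C / R\<^sup>2" .
  moreover have "measure (spectral_measure n) ?A = 1 - measure (spectral_measure n) {- R<..R}"
    using D.prob_compl[of "{- R<..R}"] by (simp add: Compl_eq_Diff_UNIV)
  ultimately show ?thesis by simp
qed

lemma tight_spectral_measure:
  assumes C: "\<And>n i. i \<in> {1..n} \<Longrightarrow> (\<Sum>k=1..n. S n i k) \<le> C" "0 \<le> C"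
  shows "tight (\<lambda>k. spectral_measure (Suc k))"
  unfolding tight_def
proof (intro conjI allI impI)
  show "real_distribution (spectral_measure (Suc n))" for n by (rule real_distribution_spectral_measure)
  fix \<epsilon> :: real assume \<epsilon>: "0 < \<epsilon>"
  \<comment> \<open>Chosen so that \<open>\<epsilon> * R = C + \<epsilon>\<close> exceeds
    \<open>C\<close>, while \<open>R \<ge> 1\<close> lets \<open>R\<close> be replaced by its
    square.\<close>
  define R where "R = C / \<epsilon> + 1"
  have R: "1 \<le> R" using C \<epsilon> by (simp add: R_def)
  have "C < \<epsilon> * R" using \<epsilon> by (simp add: R_def field_simps)
  also have "\<dots> \<le> \<epsilon> * R\<^sup>2" using R \<epsilon> by (simp add: power2_eq_square)
  finally have "C / R\<^sup>2 < \<epsilon>" using R by (simp add: pos_divide_less_eq)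
  then have "measure (spectral_measure (Suc n)) {- R<..R} > 1 - \<epsilon>" for n
    using spectral_measure_tail[of "Suc n" C R] C R by force
  then show "\<exists>a b. a < b \<and> (\<forall>n. 1 - \<epsilon> < measure (spectral_measure (Suc n)) {a<..b})"
    using R by (intro exI[of _ "- R"] exI[of _ R]) auto
qed

lemma stieltjes_spectral_measure:
  assumes n: "0 < n" and z: "Im z \<ge> 1"
  shows "stieltjes (spectral_measure n) z = (\<integral>\<omega>. (\<Sum>i=1..n. G n z \<omega> i i) / n \<partial>M)"
proof -
  have "stieltjes (spectral_measure n) z = (\<Sum>i<n. (1 / n) *\<^sub>R (\<integral>\<omega>. 1 / (complex_of_real (eig n \<omega> i) - z) \<partial>M))"
    unfolding stieltjes_def using norm_stieltjes_kernel[of 1 z] z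
    by (intro integral_spectral_measure[where B = 1] n) auto
  also have "\<dots> = (\<integral>\<omega>. (\<Sum>i<n. 1 / (complex_of_real (eig n \<omega> i) - z)) / n \<partial>M)"
  proof -
    have "integrable M (\<lambda>\<omega>. 1 / (complex_of_real (eig n \<omega> i) - z))" for i
      using norm_stieltjes_kernel[of 1 z] z eig_measurable by (intro integrable_const_bound[of _ 1]) auto
    then show ?thesis
      unfolding integral_divide_zero by (subst Bochner_Integration.integral_sum) (auto simp: scaleR_conv_of_real sum_divide_distrib)
  qed
  finally show ?thesis using sum_stieltjes_eig[OF z] by simp
qed

text \<open>Used for integrability only; the size of the defects is governed by their averaged
  second moment.\<close>

lemma defect_norm_bound:
  assumes z: "Im z \<ge> 1" and i: "i \<in> {1..n}" and C: "(\<Sum>k=1..n. S n i k) \<le> C"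
  shows "cmod (D n z \<omega> i) \<le> 1 + cmod z + C"
proof -
  have G: "cmod (G n z \<omega> k k) \<le> 1" if "k \<in> {1..n}" for k
    using resolvent_bounds(2)[OF W_symmetric z that that] .
  have "cmod (\<Sum>k=1..n. of_real (S n i k) * G n z \<omega> k k) \<le> (\<Sum>k=1..n. S n i k)"
  proof (intro order_trans[OF norm_sum] sum_mono)
    fix k assume "k \<in> {1..n}"
    moreover have "0 \<le> S n i k" by (simp add: S_def)
    ultimately show "cmod (of_real (S n i k) * G n z \<omega> k k) \<le> S n i k"
      using G by (simp add: norm_mult mult_left_le)
  qed
  then have "cmod (G n z \<omega> i i) * cmod (\<Sum>k=1..n. of_real (S n i k) * G n z \<omega> k k) \<le> 1 * C"
    using G[OF i] C by (intro mult_mono) auto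
  moreover have "cmod z * cmod (G n z \<omega> i i) \<le> cmod z" using G[OF i] by (simp add: mult_left_le)
  ultimately show ?thesis
    unfolding defect_def norm_mult[symmetric]
    by (smt (verit, best) norm_triangle_ineq norm_one norm_mult)
qed

text \<open>Stability is linear in the defects whereas the available estimate is quadratic;
  \<open>x \<le> \<eta> + x\<^sup>2 / \<eta>\<close> converts one into the other pointwise, before
  expectations are taken.\<close>

lemma stieltjes_spectral_measure_tendsto:
  assumes C: "\<And>n i. i \<in> {1..n} \<Longrightarrow> (\<Sum>k=1..n. S n i k) \<le> C" "0 \<le> C"
    and b: "(\<lambda>n. 1 / (real n)\<^sup>2 * (\<Sum>i=1..n. \<Sum>j=1..n. cond_var_dev n i j)) \<longlonglongrightarrow> 0"
    and c: "\<And>\<tau>. \<tau> > 0 \<Longrightarrow> (\<lambda>n. lindeberg_fraction M X n \<tau>) \<longlonglongrightarrow> 0"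
    and d: "(\<lambda>n. 1 / real n * (\<Sum>i=1..n. \<bar>(\<Sum>k=1..n. S n i k) - 1\<bar>)) \<longlonglongrightarrow> 0"
    and z: "Im z \<ge> 2 * C + 1" and m: "cmod m \<le> 1" "m\<^sup>2 + z * m + 1 = 0"
  shows "(\<lambda>n. stieltjes (spectral_measure n) z) \<longlonglongrightarrow> m"
proof (rule LIMSEQ_I)
  have z1: "Im z \<ge> 1" using z C by simp
  fix r :: real assume r: "0 < r"
  let ?\<delta> = "\<lambda>n. 1 / n * (\<Sum>i=1..n. \<integral>\<omega>. (cmod (D n z \<omega> i))\<^sup>2 \<partial>M)"
  let ?d = "\<lambda>n. 1 / real n * (\<Sum>i=1..n. \<bar>(\<Sum>k=1..n. S n i k) - 1\<bar>)"
  \<comment> \<open>Half of the tolerance goes to the constant term; the other two terms tend to 0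
    with \<open>\<eta>\<close> fixed.\<close>
  define \<eta> where "\<eta> = r / 2"
  have \<eta>: "0 < \<eta>" using r by (simp add: \<eta>_def)
  have "(\<lambda>n. \<eta> + ?\<delta> n / \<eta> + ?d n) \<longlonglongrightarrow> \<eta> + 0 / \<eta> + 0"
    using \<eta> by (intro tendsto_add[OF tendsto_add[OF tendsto_const tendsto_divide[OF _ tendsto_const]] d]
        average_defect_tendsto_0[OF z1 C(1) b c]) auto
  then have "\<forall>\<^sub>F n in sequentially. \<eta> + ?\<delta> n / \<eta> + ?d n < r"
    by (rule order_tendstoD(2)) (use r in \<open>simp add: \<eta>_def\<close>)
  then obtain N where N: "\<And>n. n \<ge> N \<Longrightarrow> \<eta> + ?\<delta> n / \<eta> + ?d n < r"
    by (auto simp: eventually_sequentially)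
  have "norm (stieltjes (spectral_measure n) z - m) < r" if n: "n \<ge> max 1 N" for n
  proof -
    have n0: "0 < n" using n by auto
    have mD: "(\<lambda>\<omega>. D n z \<omega> i) \<in> borel_measurable M" if "i \<in> {1..n}" for i
      using borel_measurable_defects(1)[where H = "G n z", OF G_measurable that that] .
    have iD: "integrable M (\<lambda>\<omega>. (cmod (D n z \<omega> i))\<^sup>2)" if "i \<in> {1..n}" for i
      using mD[OF that] defect_norm_bound[OF z1 that C(1)[OF that]]
      by (intro integrable_const_bound[of _ "(1 + cmod z + C)\<^sup>2"]) (auto intro!: power_mono)
    have iG: "integrable M (\<lambda>\<omega>. G n z \<omega> i i)" if "i \<in> {1..n}" for i
      using G_measurable[OF that that] resolvent_bounds(2)[OF W_symmetric z1 that that]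
      by (intro integrable_const_bound[of _ 1]) auto
    let ?g = "\<lambda>\<omega>. 1 / n * (\<Sum>i=1..n. \<eta> + (cmod (D n z \<omega> i))\<^sup>2 / \<eta>) + ?d n"
    have ig: "integrable M ?g" using iD
      by (intro Bochner_Integration.integrable_add integrable_mult_right Bochner_Integration.integrable_sum integrable_const
          integrable_divide) auto
    have iS: "integrable M (\<lambda>\<omega>. (\<Sum>i=1..n. G n z \<omega> i i) / n)"
      using iG by (intro integrable_divide Bochner_Integration.integrable_sum) auto
    have pt: "cmod ((\<Sum>i=1..n. G n z \<omega> i i) / n - m) \<le> ?g \<omega>" for \<omega>
    proof -
      have "(\<Sum>i=1..n. G n z \<omega> i i) / n - m = (\<Sum>i=1..n. G n z \<omega> i i - m) / n"
        using n0 by (simp add: sum_subtractf diff_divide_distrib)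
      also have "cmod \<dots> = 1 / n * cmod (\<Sum>i=1..n. G n z \<omega> i i - m)" by (simp add: norm_divide)
      also have "\<dots> \<le> 1 / n * ((\<Sum>i=1..n. \<eta> + (cmod (D n z \<omega> i))\<^sup>2 / \<eta>) + (\<Sum>i=1..n. \<bar>(\<Sum>k=1..n. S n i k) - 1\<bar>))"
      proof (rule mult_left_mono)
        have "cmod (\<Sum>i=1..n. G n z \<omega> i i - m) \<le> (\<Sum>i=1..n. cmod (G n z \<omega> i i - m))" by (rule norm_sum)
        also have "\<dots> \<le> (\<Sum>i=1..n. cmod (D n z \<omega> i)) + (\<Sum>i=1..n. \<bar>(\<Sum>k=1..n. S n i k) - 1\<bar>)"
        proof (rule self_consistent_stability[OF _ _ _ C(1) z m])
          show "cmod (G n z \<omega> i i) \<le> 1" if "i \<in> {1..n}" for i using resolvent_bounds(2)[OF W_symmetric z1 that that] .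
          show "S n i j = S n j i" if "i \<in> {1..n}" "j \<in> {1..n}" for i j
            using sigma_commute[of i j] that by (simp add: S_def)
          show "0 \<le> S n i j" for i j by (simp add: S_def)
        qed
        also have "(\<Sum>i=1..n. cmod (D n z \<omega> i)) \<le> (\<Sum>i=1..n. \<eta> + (cmod (D n z \<omega> i))\<^sup>2 / \<eta>)"
        proof (rule sum_mono)
          fix i
          define x where "x = cmod (D n z \<omega> i)"
          have "0 \<le> (x - \<eta>)\<^sup>2 + x * \<eta>" using \<eta> by (simp add: x_def)
          then have "x * \<eta> \<le> \<eta>\<^sup>2 + x\<^sup>2" by (simp add: power2_eq_square algebra_simps)
          then have "x \<le> \<eta> + x\<^sup>2 / \<eta>" using \<eta> by (simp add: field_simps power2_eq_square)
          then show "cmod (D n z \<omega> i) \<le> \<eta> + (cmod (D n z \<omega> i))\<^sup>2 / \<eta>" by (simp only: x_def)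
        qed
        finally show "cmod (\<Sum>i=1..n. G n z \<omega> i i - m)
          \<le> (\<Sum>i=1..n. \<eta> + (cmod (D n z \<omega> i))\<^sup>2 / \<eta>) + (\<Sum>i=1..n. \<bar>(\<Sum>k=1..n. S n i k) - 1\<bar>)"
          by simp
      qed simp
      finally show ?thesis by (simp add: distrib_left)
    qed
    have eq: "stieltjes (spectral_measure n) z - m = (\<integral>\<omega>. (\<Sum>i=1..n. G n z \<omega> i i) / n - m \<partial>M)"
      using iS prob_space by (simp add: stieltjes_spectral_measure[OF n0 z1])
    have "cmod (stieltjes (spectral_measure n) z - m) \<le> (\<integral>\<omega>. ?g \<omega> \<partial>M)"
      unfolding eq using iS by (intro integral_norm_bound_complex(2) ig pt) auto
    also have "\<dots> = \<eta> + ?\<delta> n / \<eta> + ?d n"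
    proof -
      have i1: "integrable M (\<lambda>\<omega>. \<eta> + (cmod (D n z \<omega> i))\<^sup>2 / \<eta>)" if "i \<in> {1..n}" for i
        using iD[OF that] by simp
      have "(\<integral>\<omega>. (\<Sum>i=1..n. \<eta> + (cmod (D n z \<omega> i))\<^sup>2 / \<eta>) \<partial>M)
          = (\<Sum>i=1..n. \<integral>\<omega>. \<eta> + (cmod (D n z \<omega> i))\<^sup>2 / \<eta> \<partial>M)"
        by (rule Bochner_Integration.integral_sum) (rule i1)
      also have "\<dots> = (\<Sum>i=1..n. \<eta> + (\<integral>\<omega>. (cmod (D n z \<omega> i))\<^sup>2 \<partial>M) / \<eta>)"
      proof (rule sum.cong[OF refl])
        fix i assume "i \<in> {1..n}"
        then show "(\<integral>\<omega>. \<eta> + (cmod (D n z \<omega> i))\<^sup>2 / \<eta> \<partial>M) = \<eta> + (\<integral>\<omega>. (cmod (D n z \<omega> i))\<^sup>2 \<partial>M) / \<eta>"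
          using iD[of i] prob_space by simp
      qed
      also have "\<dots> = n * \<eta> + (\<Sum>i=1..n. \<integral>\<omega>. (cmod (D n z \<omega> i))\<^sup>2 \<partial>M) / \<eta>"
        by (simp only: sum.distrib sum_divide_distrib sum_constant card_atLeastAtMost) simp
      finally have e: "(\<integral>\<omega>. (\<Sum>i=1..n. \<eta> + (cmod (D n z \<omega> i))\<^sup>2 / \<eta>) \<partial>M) = \<dots>" .
      have i2: "integrable M (\<lambda>\<omega>. 1 / n * (\<Sum>i=1..n. \<eta> + (cmod (D n z \<omega> i))\<^sup>2 / \<eta>))"
        by (intro integrable_mult_right Bochner_Integration.integrable_sum i1)
      have "(\<integral>\<omega>. ?g \<omega> \<partial>M) = (\<integral>\<omega>. 1 / n * (\<Sum>i=1..n. \<eta> + (cmod (D n z \<omega> i))\<^sup>2 / \<eta>) \<partial>M) + (\<integral>\<omega>. ?d n \<partial>M)"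
        by (rule Bochner_Integration.integral_add[OF i2 integrable_const])
      also have "(\<integral>\<omega>. ?d n \<partial>M) = ?d n" by (simp only: lebesgue_integral_const prob_space scaleR_one)
      finally have "(\<integral>\<omega>. ?g \<omega> \<partial>M) = 1 / n * (\<integral>\<omega>. (\<Sum>i=1..n. \<eta> + (cmod (D n z \<omega> i))\<^sup>2 / \<eta>) \<partial>M) + ?d n"
        unfolding integral_mult_right_zero .
      then show ?thesis unfolding e using n0 by (simp add: distrib_left)
    qed
    also have "\<dots> < r" using N n by simp
    finally show ?thesis .
  qed
  then show "\<exists>no. \<forall>n\<ge>no. norm (stieltjes (spectral_measure n) z - m) < r" by blast
qed

end

section \<open>Weak limits and uniform convergence\<close>

context martingale_array
begin

lemma row_scale_power2: "(row_scale \<sigma> n i)\<^sup>2 = (\<Sum>k=1..n. S n i k)"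
proof -
  have "0 \<le> 1 / real n * (\<Sum>j=1..n. (\<sigma> i j)\<^sup>2)" by (intro mult_nonneg_nonneg sum_nonneg) auto
  then show ?thesis by (simp add: row_scale_def S_def sum_divide_distrib)
qed

lemma weak_limit_spectral_measure:
  assumes C: "\<And>n i. i \<in> {1..n} \<Longrightarrow> (\<Sum>k=1..n. S n i k) \<le> C" "0 \<le> C"
    and b: "(\<lambda>n. 1 / (real n)\<^sup>2 * (\<Sum>i=1..n. \<Sum>j=1..n. cond_var_dev n i j)) \<longlonglongrightarrow> 0"
    and c: "\<And>\<tau>. \<tau> > 0 \<Longrightarrow> (\<lambda>n. lindeberg_fraction M X n \<tau>) \<longlonglongrightarrow> 0"
    and d: "(\<lambda>n. 1 / real n * (\<Sum>i=1..n. \<bar>(\<Sum>k=1..n. S n i k) - 1\<bar>)) \<longlonglongrightarrow> 0"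
    and s: "strict_mono s" and \<nu>: "real_distribution \<nu>"
    and w: "weak_conv_m ((\<lambda>k. spectral_measure (Suc k)) \<circ> s) \<nu>"
  shows "cdf \<nu> x = semicircle_cdf x" "isCont (cdf \<nu>) x"
proof -
  interpret N: real_distribution \<nu> by (rule \<nu>)
  have "(stieltjes \<nu> z)\<^sup>2 + z * stieltjes \<nu> z + 1 = 0" if z: "Im z \<ge> 2 * C + 1" for z
  proof -
    have z1: "1 \<le> Im z" using z C by simp
    obtain m where m: "cmod m \<le> 1" "m\<^sup>2 + z * m + 1 = 0" by (rule semicircle_root_exists)
    have "(\<lambda>k. stieltjes (((\<lambda>k. spectral_measure (Suc k)) \<circ> s) k) z) \<longlonglongrightarrow> stieltjes \<nu> z"
      unfolding stieltjes_def
    proof (rule weak_conv_imp_integral_bdd_continuous_conv[OF _ \<nu> w])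
      show "real_distribution (((\<lambda>k. spectral_measure (Suc k)) \<circ> s) n)" for n
        by (simp add: real_distribution_spectral_measure)
      show "isCont (\<lambda>x. 1 / (complex_of_real x - z)) x" for x
        using stieltjes_kernel_nonzero[of z x] z1 by (intro continuous_intros) auto
      show "norm (1 / (complex_of_real x - z)) \<le> 1" for x
        using norm_stieltjes_kernel[of 1 z x] z1 by simp
    qed
    moreover have "(\<lambda>k. stieltjes (((\<lambda>k. spectral_measure (Suc k)) \<circ> s) k) z) \<longlonglongrightarrow> m"
      using LIMSEQ_subseq_LIMSEQ[OF LIMSEQ_Suc[OF stieltjes_spectral_measure_tendsto[OF C b c d z m]] s]
      by (simp add: o_def)
    ultimately show ?thesis using m(2) LIMSEQ_unique by blast
  qed
  then have q: "(stieltjes \<nu> z)\<^sup>2 + z * stieltjes \<nu> z + 1 = 0" if "Im z > 0" for z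
    using that by (rule N.stieltjes_quadratic_extend)
  show "cdf \<nu> x = semicircle_cdf x" "isCont (cdf \<nu>) x"
    by (rule N.cdf_eq_semicircle_cdf[OF q], assumption)+
qed

text \<open>All subsequential weak limits share one distribution function, so by tightness the whole
  sequence converges to a single measure. The index \<open>Suc k\<close> leaves out the empty
  matrix.\<close>

lemma expected_spectral_cdf_uniform_limit:
  assumes C: "\<And>n i. i \<in> {1..n} \<Longrightarrow> (\<Sum>k=1..n. S n i k) \<le> C" "0 \<le> C"
    and b: "(\<lambda>n. 1 / (real n)\<^sup>2 * (\<Sum>i=1..n. \<Sum>j=1..n. cond_var_dev n i j)) \<longlonglongrightarrow> 0"
    and c: "\<And>\<tau>. \<tau> > 0 \<Longrightarrow> (\<lambda>n. lindeberg_fraction M X n \<tau>) \<longlonglongrightarrow> 0"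
    and d: "(\<lambda>n. 1 / real n * (\<Sum>i=1..n. \<bar>(\<Sum>k=1..n. S n i k) - 1\<bar>)) \<longlonglongrightarrow> 0"
  shows "(\<lambda>n. SUP x. \<bar>expected_spectral_cdf M X n x - semicircle_cdf x\<bar>) \<longlonglongrightarrow> 0"
proof -
  let ?\<mu> = "\<lambda>k. spectral_measure (Suc k)"
  have weak: "cdf \<nu> x = semicircle_cdf x \<and> isCont (cdf \<nu>) x"
    if "strict_mono s" "real_distribution \<nu>" "weak_conv_m (?\<mu> \<circ> s) \<nu>" for s \<nu> x
    using weak_limit_spectral_measure[OF C b c d that] by simp
  have tight: "tight ?\<mu>" by (rule tight_spectral_measure[OF C])
  obtain r \<nu> where r: "strict_mono r" and \<nu>: "real_distribution \<nu>" and w: "weak_conv_m (?\<mu> \<circ> id \<circ> r) \<nu>"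
    using tight_imp_convergent_subsubsequence[OF tight strict_mono_id] by blast
  interpret N: real_distribution \<nu> by (rule \<nu>)
  have \<nu>_cdf: "cdf \<nu> x = semicircle_cdf x" "isCont (cdf \<nu>) x" for x
    using weak[OF r \<nu>, of x] w by simp_all
  have "weak_conv_m ?\<mu> \<nu>"
  proof (rule tight_subseq_weak_converge[OF _ \<nu> tight])
    show "real_distribution (?\<mu> n)" for n by (rule real_distribution_spectral_measure)
    fix s \<nu>' assume s: "strict_mono (s :: nat \<Rightarrow> nat)" "real_distribution \<nu>'" "weak_conv_m (?\<mu> \<circ> s) \<nu>'"
    have "cdf \<nu>' = cdf \<nu>" using weak[OF s] \<nu>_cdf(1) by auto
    then have "\<nu>' = \<nu>" by (rule cdf_unique[OF s(2) \<nu>])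
    then show "weak_conv_m (?\<mu> \<circ> s) \<nu>" using s(3) by simp
  qed
  then have "(\<lambda>k. cdf (?\<mu> k) x) \<longlonglongrightarrow> semicircle_cdf x" for x
    using \<nu>_cdf(1)[of x] \<nu>_cdf(2)[of x] unfolding weak_conv_m_def weak_conv_def by metis
  then have "(\<lambda>k. expected_spectral_cdf M X (Suc k) x) \<longlonglongrightarrow> semicircle_cdf x" for x
    by (simp add: cdf_spectral_measure)
  then have lim: "(\<lambda>n. expected_spectral_cdf M X n x) \<longlonglongrightarrow> semicircle_cdf x" for x
    by (rule LIMSEQ_imp_Suc)
  \<comment> \<open>Monotonicity, continuity and total mass 1 of the semicircle law are read off
    from the limit measure \<open>\<nu>\<close>, in place of computing the integral of the
    density.\<close>
  have sc: "semicircle_cdf = cdf \<nu>" using \<nu>_cdf(1) by auto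
  show ?thesis
  proof (rule polya_uniform_convergence[of 1])
    fix n :: nat assume "1 \<le> n"
    then have e: "expected_spectral_cdf M X n = cdf (spectral_measure n)" by (auto simp: cdf_spectral_measure)
    interpret D: real_distribution "spectral_measure n" by (rule real_distribution_spectral_measure)
    show "mono (expected_spectral_cdf M X n)" unfolding e by (intro monoI D.cdf_nondecreasing)
    show "0 \<le> expected_spectral_cdf M X n x \<and> expected_spectral_cdf M X n x \<le> 1" for x
      unfolding e using D.cdf_nonneg D.cdf_bounded_prob by blast
  next
    show "continuous_on UNIV semicircle_cdf"
      unfolding sc using \<nu>_cdf(2) by (simp add: continuous_at_imp_continuous_on)
    show "mono semicircle_cdf" unfolding sc by (intro monoI N.cdf_nondecreasing)
    show "(semicircle_cdf \<longlongrightarrow> 0) at_bot" unfolding sc by (rule N.cdf_lim_at_bot)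
    show "(semicircle_cdf \<longlongrightarrow> 1) at_top" unfolding sc by (rule N.cdf_lim_at_top_prob)
  qed (rule lim)
qed

end

theorem theorem1p1:
  fixes M :: "'a measure"
    and X :: "nat \<Rightarrow> nat \<Rightarrow> 'a \<Rightarrow> real"
    and \<sigma> :: "nat \<Rightarrow> nat \<Rightarrow> real"
  assumes prob: "prob_space M"
    and rv: "\<And>j k. 1 \<le> j \<Longrightarrow> j \<le> k \<Longrightarrow> X j k \<in> borel_measurable M"
    and square_integrable: "\<And>j k. 1 \<le> j \<Longrightarrow> j \<le> k \<Longrightarrow> integrable M (\<lambda>\<omega>. (X j k \<omega>)\<^sup>2)"
    and mean: "\<And>j k. 1 \<le> j \<Longrightarrow> j \<le> k \<Longrightarrow> (\<integral>\<omega>. X j k \<omega> \<partial>M) = 0"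
    and variance: "\<And>j k. 1 \<le> j \<Longrightarrow> j \<le> k \<Longrightarrow> (\<integral>\<omega>. (X j k \<omega>)\<^sup>2 \<partial>M) = (\<sigma> j k)\<^sup>2"
    and X_sym: "\<And>j k. 1 \<le> j \<Longrightarrow> j < k \<Longrightarrow> X k j = X j k"
    and \<sigma>_sym: "\<And>j k. 1 \<le> j \<Longrightarrow> j < k \<Longrightarrow> \<sigma> k j = \<sigma> j k"
    and a: "\<And>n i j. 1 \<le> i \<Longrightarrow> i \<le> j \<Longrightarrow> j \<le> n \<Longrightarrow>
              AE \<omega> in M. real_cond_exp M (sigma_without M X n i j) (X i j) \<omega> = 0"
    and b: "(\<lambda>n. 1 / (real n)\<^sup>2 * (\<Sum>i=1..n. \<Sum>j=1..n.
              \<integral>\<omega>. \<bar>real_cond_exp M (sigma_without M X n i j) (\<lambda>\<omega>. (X i j \<omega>)\<^sup>2) \<omega> - (\<sigma> i j)\<^sup>2\<bar> \<partial>M))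
            \<longlonglongrightarrow> 0"
    and c: "\<And>\<tau>. \<tau> > 0 \<Longrightarrow> (\<lambda>n. lindeberg_fraction M X n \<tau>) \<longlonglongrightarrow> 0"
    and d: "(\<lambda>n. 1 / real n * (\<Sum>i=1..n. \<bar>(row_scale \<sigma> n i)\<^sup>2 - 1\<bar>)) \<longlonglongrightarrow> 0"
    and e: "\<exists>C. \<forall>n\<ge>1. (MAX i\<in>{1..n}. row_scale \<sigma> n i) \<le> C"
  shows "(\<lambda>n. SUP x. \<bar>expected_spectral_cdf M X n x - semicircle_cdf x\<bar>) \<longlonglongrightarrow> 0"
proof -
  interpret prob_space M by (rule prob)
  interpret martingale_array M X \<sigma>
    by unfold_locales (use rv square_integrable variance X_sym \<sigma>_sym a in auto)
  obtain C where C: "\<And>n. n \<ge> 1 \<Longrightarrow> (MAX i\<in>{1..n}. row_scale \<sigma> n i) \<le> C" using e by blast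
  \<comment> \<open>The row sums of \<open>S\<close> are the squares of \<open>row_scale\<close>, so
    the bound \<open>C\<close> of (e) enters the estimates as its square.\<close>
  have row: "(\<Sum>k=1..n. S n i k) \<le> C\<^sup>2" if i: "i \<in> {1..n}" for n i
  proof -
    have "row_scale \<sigma> n i \<le> (MAX i\<in>{1..n}. row_scale \<sigma> n i)" using i by (intro Max_ge) auto
    also have "\<dots> \<le> C" using i by (intro C) auto
    finally have "row_scale \<sigma> n i \<le> C" .
    moreover have "0 \<le> row_scale \<sigma> n i" unfolding row_scale_def by (intro real_sqrt_ge_zero mult_nonneg_nonneg sum_nonneg) auto
    ultimately have "(row_scale \<sigma> n i)\<^sup>2 \<le> C\<^sup>2" by (rule power_mono)
    then show ?thesis by (simp only: row_scale_power2)
  qed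
  show ?thesis
  proof (rule expected_spectral_cdf_uniform_limit[OF row])
    show "(\<lambda>n. 1 / (real n)\<^sup>2 * (\<Sum>i=1..n. \<Sum>j=1..n. cond_var_dev n i j)) \<longlonglongrightarrow> 0"
      using b by (simp only: cond_var_dev_def)
    show "(\<lambda>n. 1 / real n * (\<Sum>i=1..n. \<bar>(\<Sum>k=1..n. S n i k) - 1\<bar>)) \<longlonglongrightarrow> 0"
      using d by (simp only: row_scale_power2)
  qed (use c in auto)
qed

end
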